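(* Let $P$ be a standard RAP with parameters $k,m,n$ in which the last row contains no zeros, and for $t=1,\dots,n$ let $P_t$ be the standard RAP obtained from $P$ by setting the entry in column $t$ of the last row to zero. If the cover formula holds for every $P_t$, then it holds for $P$.
   Context: Let $k,m,n$ be positive integers with $\min(m,n)\ge k$. A $k$-assignment in an $m\times n$ matrix is a set of $k$ positions, no two in the same row or column; its cost is the sum of the entries there. A standard RAP $Q$ is given by $k,m,n$ and a set $Z$ of positions: entries at positions of $Z$ are $0$, all others are independent exponential random variables with intensity $1$; $E(Q)$ is the expected minimal cost of a $k$-assignment. A set of rows and columns covers $Z$ if each position of $Z$ lies in one of its rows or columns; a cover with $s$ rows and columns in total is an $s$-cover; a partial $(k-1)$-cover is a subset of some $(k-1)$-cover of $Z$; $d_{i,j}(Q)$ is the number of partial $(k-1)$-covers of $Z$ with exactly $i$ rows and $j$ columns. "The cover formula holds for $Q$" (with parameters $k,m,n$) means $E(Q)=\frac{1}{mn}\sum_{i,j}\frac{d_{i,j}(Q)}{\binom{m-1}{i}\binom{n-1}{j}}$, summed over nonnegative integers $i,j$ with $i+j<k$. *)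

theory Defs
  imports "HOL-Probability.Probability"
begin

text \<open>
  Rows are indexed by \<open>{1..m}\<close>, columns by \<open>{1..n}\<close>; a matrix is a function on
  positions \<open>(row, column)\<close>. A standard RAP (random assignment problem) is given by
  \<open>k\<close>, \<open>m\<close>, \<open>n\<close> and the set \<open>Z\<close> of positions of the zeros.
\<close>

definition positions :: "nat \<Rightarrow> nat \<Rightarrow> (nat \<times> nat) set" where
  "positions m n = {1..m} \<times> {1..n}"

definition standard_RAP :: "nat \<Rightarrow> nat \<Rightarrow> nat \<Rightarrow> (nat \<times> nat) set \<Rightarrow> bool" where
  "standard_RAP k m n Z \<longleftrightarrow> 0 < k \<and> k \<le> min m n \<and> Z \<subseteq> positions m n"

definition k_assignments :: "nat \<Rightarrow> nat \<Rightarrow> nat \<Rightarrow> (nat \<times> nat) set set" where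
  "k_assignments k m n =
     {A. A \<subseteq> positions m n \<and> card A = k \<and>
         (\<forall>p\<in>A. \<forall>q\<in>A. p \<noteq> q \<longrightarrow> fst p \<noteq> fst q \<and> snd p \<noteq> snd q)}"

definition assignment_cost :: "(nat \<times> nat \<Rightarrow> real) \<Rightarrow> (nat \<times> nat) set \<Rightarrow> real" where
  "assignment_cost X A = (\<Sum>p\<in>A. X p)"

definition min_cost :: "nat \<Rightarrow> nat \<Rightarrow> nat \<Rightarrow> (nat \<times> nat \<Rightarrow> real) \<Rightarrow> real" where
  "min_cost k m n X = Min (assignment_cost X ` k_assignments k m n)"

text \<open>
  The joint law of the entries: a product measure (independence) whose factor at a position
  is the point mass at \<open>0\<close> on \<open>Z\<close> and the exponential distribution of intensity \<open>1\<close> elsewhere.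
\<close>

definition entry_distribution :: "(nat \<times> nat) set \<Rightarrow> nat \<times> nat \<Rightarrow> real measure" where
  "entry_distribution Z p =
     (if p \<in> Z then return borel 0 else density lborel (\<lambda>x. ennreal (exponential_density 1 x)))"

definition RAP_measure :: "nat \<Rightarrow> nat \<Rightarrow> (nat \<times> nat) set \<Rightarrow> (nat \<times> nat \<Rightarrow> real) measure" where
  "RAP_measure m n Z = (\<Pi>\<^sub>M p\<in>positions m n. entry_distribution Z p)"

definition expected_min_cost :: "nat \<Rightarrow> nat \<Rightarrow> nat \<Rightarrow> (nat \<times> nat) set \<Rightarrow> real" where
  "expected_min_cost k m n Z = integral\<^sup>L (RAP_measure m n Z) (min_cost k m n)"

text \<open>A set of rows and columns is encoded as a pair \<open>(R, C)\<close>.\<close>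

definition is_cover ::
    "nat \<Rightarrow> nat \<Rightarrow> (nat \<times> nat) set \<Rightarrow> nat \<Rightarrow> nat set \<times> nat set \<Rightarrow> bool" where
  "is_cover m n Z s = (\<lambda>(R, C). R \<subseteq> {1..m} \<and> C \<subseteq> {1..n} \<and> card R + card C = s \<and>
     (\<forall>(i, j)\<in>Z. i \<in> R \<or> j \<in> C))"

definition is_partial_cover ::
    "nat \<Rightarrow> nat \<Rightarrow> (nat \<times> nat) set \<Rightarrow> nat \<Rightarrow> nat set \<times> nat set \<Rightarrow> bool" where
  "is_partial_cover m n Z s = (\<lambda>(R, C). \<exists>R' C'. is_cover m n Z s (R', C') \<and> R \<subseteq> R' \<and> C \<subseteq> C')"

definition d_coeff :: "nat \<Rightarrow> nat \<Rightarrow> nat \<Rightarrow> (nat \<times> nat) set \<Rightarrow> nat \<Rightarrow> nat \<Rightarrow> nat" where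
  "d_coeff k m n Z i j =
     card {(R, C). is_partial_cover m n Z (k - 1) (R, C) \<and> card R = i \<and> card C = j}"

definition cover_formula_holds :: "nat \<Rightarrow> nat \<Rightarrow> nat \<Rightarrow> (nat \<times> nat) set \<Rightarrow> bool" where
  "cover_formula_holds k m n Z \<longleftrightarrow>
     expected_min_cost k m n Z =
       1 / (real m * real n) *
       (\<Sum>(i, j)\<in>{(i, j). i + j < k}.
          real (d_coeff k m n Z i j) / (real ((m - 1) choose i) * real ((n - 1) choose j)))"

end

theory Submission
  imports Defs
begin

text \<open>
  Replacing one exponential entry by zero lowers the expected cost by the probability that this
  entry is used. Summing over the last row, \<open>n E(P) - \<Sum>t. E(P\<^sub>t)\<close> is the probability \<open>p\<close> that
  the optimal \<open>k\<close>-assignment uses the last row, so \<open>p\<close> has to be matched with the corresponding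
  difference of the cover sums.

  Let \<open>D\<close> be the set of rows avoided by some optimal \<open>s\<close>-assignment, where \<open>s\<close> is at least the rank
  of \<open>Z\<close>. Almost surely exactly one row \<open>a \<in> D\<close> acquires an entry outside the columns that have
  zeros in \<open>D\<close> when \<open>s\<close> grows to \<open>s + 1\<close>, and the new set of avoidable rows consists of the
  non-coloops of \<open>D - {a}\<close> in the transversal matroid of \<open>Z\<close>. A dual solution that vanishes exactly
  on \<open>D\<close> shows that swapping two rows of \<open>D\<close> outside these columns preserves \<open>D\<close> and moves \<open>a\<close>
  accordingly; as this swap preserves the measure, \<open>a\<close> is uniform on \<open>D\<close>. Hence \<open>p\<close> satisfies a
  recursion that depends only on the matroid; it is solved by a sum over sets of rows, which is
  also what the difference of the cover sums telescopes to.
\<close>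

section \<open>Duality for perfect matchings\<close>

text \<open>Rows are tracked rather than positions because the nonzero entries of the optimum may
  change completely from size \<open>s\<close> to \<open>s + 1\<close>, whereas a row that has left
  \<open>D\<close> stays outside. Generically all optimal assignments of one size agree off
  \<open>Z\<close>, so a row of \<open>D\<close> is used at size \<open>s\<close> only through a
  zero; within \<open>D\<close> the optimum merely fills the columns that have zeros there, until
  one row leaves. The obstacle is the swap: it changes the matrix, and \<open>D\<close> must be
  recognized in the new one. A dual solution does this, since it stays feasible and complementary
  slackness recovers \<open>D\<close> from it. Plain strong duality only gives multipliers vanishing
  on \<open>D\<close>; positivity elsewhere rests on the fact that forbidding a row does not get
  cheaper as the size grows. The swap is confined to columns without zeros in \<open>D\<close> so
  that it exchanges \<open>Exp(1)\<close> entries only. The sum over sets of rows is an average over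
  random orders: \<open>1 / (card E * (card E - 1 choose card R))\<close> is the chance that exactly
  the rows of \<open>R\<close> precede \<open>m\<close> in a uniform order of
  \<open>E\<close>.\<close>

lemma hall_marriage:
  fixes N :: "'a \<Rightarrow> 'b set"
  assumes "finite I" "\<And>i. i \<in> I \<Longrightarrow> finite (N i)"
    and "\<And>X. X \<subseteq> I \<Longrightarrow> card X \<le> card (\<Union>i\<in>X. N i)"
  shows "\<exists>f. inj_on f I \<and> (\<forall>i\<in>I. f i \<in> N i)"
  using assms
proof (induction "card I" arbitrary: I N rule: less_induct)
  case less
  note fin = less.prems(1,2) and hall = less.prems(3)
  show ?case
  proof (cases "I = {}")
    case True
    then show ?thesis by auto
  next
    case False
    then obtain a where a: "a \<in> I" by auto
    show ?thesis
    \<comment> \<open>If a proper nonempty \<open>X\<close> is tight, \<open>X\<close> is matched by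
      itself and the rest outside its neighbourhood: subtracting the equality for \<open>X\<close>
      from the condition for \<open>X \<union> Y\<close> leaves Hall's condition there.\<close>
    proof (cases "\<exists>X. X \<subset> I \<and> X \<noteq> {} \<and> card X = card (\<Union>i\<in>X. N i)")
      case True
      then obtain X where X: "X \<subset> I" "X \<noteq> {}" "card X = card (\<Union>i\<in>X. N i)" by blast
      define W where "W = (\<Union>i\<in>X. N i)"
      have finX: "finite X" using X fin finite_subset by blast
      have finW: "finite W" unfolding W_def using X fin finX by blast
      have cX: "card X < card I" using X(1) fin by (simp add: psubset_card_mono)
      have "\<exists>f. inj_on f X \<and> (\<forall>i\<in>X. f i \<in> N i)"
      proof (rule less.hyps[OF cX finX])
        show "\<And>i. i \<in> X \<Longrightarrow> finite (N i)" using X fin by auto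
        show "\<And>Y. Y \<subseteq> X \<Longrightarrow> card Y \<le> card (\<Union>i\<in>Y. N i)" by (rule hall) (use X in auto)
      qed
      then obtain f where f: "inj_on f X" "\<forall>i\<in>X. f i \<in> N i" by blast
      have "\<exists>g. inj_on g (I - X) \<and> (\<forall>i\<in>I - X. g i \<in> N i - W)"
      proof (rule less.hyps)
        show "card (I - X) < card I" using X(1,2) fin by (intro psubset_card_mono) auto
        show "finite (I - X)" using fin by auto
        show "\<And>i. i \<in> I - X \<Longrightarrow> finite (N i - W)" using fin by auto
        fix Y assume Y: "Y \<subseteq> I - X"
        have finY: "finite Y" using Y fin finite_subset by blast
        have "card X + card Y = card (X \<union> Y)"
          using Y finX finY by (subst card_Un_disjoint) auto
        also have "\<dots> \<le> card (\<Union>i\<in>X \<union> Y. N i)"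
          by (rule hall) (use X Y in auto)
        also have "(\<Union>i\<in>X \<union> Y. N i) = W \<union> (\<Union>i\<in>Y. N i - W)" by (auto simp: W_def)
        also have "card \<dots> = card W + card (\<Union>i\<in>Y. N i - W)"
          using finW finY fin Y by (subst card_Un_disjoint) auto
        finally show "card Y \<le> card (\<Union>i\<in>Y. N i - W)" using X by (simp add: W_def)
      qed
      then obtain g where g: "inj_on g (I - X)" "\<forall>i\<in>I - X. g i \<in> N i - W" by blast
      have "f i \<noteq> g j" if "i \<in> X" "j \<in> I - X" for i j
        using f g that by (fastforce simp: W_def)
      then have "inj_on (\<lambda>i. if i \<in> X then f i else g i) I"
        using f(1) g(1) unfolding inj_on_def by (metis DiffI)
      moreover have "\<forall>i\<in>I. (if i \<in> X then f i else g i) \<in> N i" using f g by auto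
      ultimately show ?thesis by (intro exI[of _ "\<lambda>i. if i \<in> X then f i else g i"]) auto
    next
      case notight: False
      \<comment> \<open>Without a tight set every nonempty proper subset has a spare neighbour, so
        any one edge \<open>(a, b)\<close> may be fixed.\<close>
      have "card {a} \<le> card (\<Union>i\<in>{a}. N i)" by (rule hall) (use a in auto)
      then obtain b where b: "b \<in> N a" by fastforce
      have "\<exists>g. inj_on g (I - {a}) \<and> (\<forall>i\<in>I - {a}. g i \<in> N i - {b})"
      proof (rule less.hyps)
        show "card (I - {a}) < card I" using a fin by (intro card_Diff1_less) auto
        show "finite (I - {a})" using fin by auto
        show "\<And>i. i \<in> I - {a} \<Longrightarrow> finite (N i - {b})" using fin by auto
        fix Y assume Y: "Y \<subseteq> I - {a}"
        have finY: "finite Y" using Y fin finite_subset by blast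
        show "card Y \<le> card (\<Union>i\<in>Y. N i - {b})"
        proof (cases "Y = {}")
          case False
          have "Y \<subset> I" using Y a by auto
          then have "card Y \<noteq> card (\<Union>i\<in>Y. N i)" using False notight by metis
          moreover have "card Y \<le> card (\<Union>i\<in>Y. N i)" using Y by (intro hall) auto
          ultimately have "card Y + 1 \<le> card (\<Union>i\<in>Y. N i)" by simp
          also have "\<dots> \<le> card (insert b (\<Union>i\<in>Y. N i - {b}))"
            by (rule card_mono) (use finY fin Y in auto)
          also have "\<dots> \<le> card (\<Union>i\<in>Y. N i - {b}) + 1"
            by (subst card_insert_if) (use finY fin Y in auto)
          finally show ?thesis by simp
        qed simp
      qed
      then obtain g where g: "inj_on g (I - {a})" "\<forall>i\<in>I - {a}. g i \<in> N i - {b}" by blast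
      have "x = y" if "x \<in> I" "y \<in> I" "(g(a := b)) x = (g(a := b)) y" for x y
        using that g inj_onD[OF g(1), of x y] by (cases "x = a"; cases "y = a") auto
      then have "inj_on (g(a := b)) I" by (rule inj_onI)
      moreover have "\<forall>i\<in>I. (g(a := b)) i \<in> N i" using g b by auto
      ultimately show ?thesis by blast
    qed
  qed
qed

lemma continuous_on_Min_image:
  fixes g :: "'i \<Rightarrow> 'a::topological_space \<Rightarrow> real"
  assumes "finite I" "I \<noteq> {}" "\<And>i. i \<in> I \<Longrightarrow> continuous_on S (g i)"
  shows "continuous_on S (\<lambda>u. Min ((\<lambda>i. g i u) ` I))"
  using assms
proof (induction I rule: finite_ne_induct)
  case (insert i I)
  have "continuous_on S (\<lambda>u. min (g i u) (Min ((\<lambda>i. g i u) ` I)))"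
    using insert by (intro continuous_on_min) auto
  then show ?case using insert by simp
qed simp

text \<open>Potentials are functions on the whole row type, so compactness of the box is Tychonoff's
  theorem for the product topology.\<close>

lemma compact_box_fun: "compact {u :: 'a \<Rightarrow> real. \<forall>i. a \<le> u i \<and> u i \<le> b}"
proof -
  have "compactin (product_topology (\<lambda>i::'a. euclidean) UNIV) (PiE UNIV (\<lambda>_. {a..b::real}))"
    by (subst compactin_PiE) (auto simp: compactin_euclidean_iff)
  then have "compact (PiE UNIV (\<lambda>_::'a. {a..b}))"
    by (simp add: euclidean_product_topology compactin_euclidean_iff)
  moreover have "PiE UNIV (\<lambda>_::'a. {a..b}) = {u. \<forall>i. a \<le> u i \<and> u i \<le> b}"
    by (auto simp: PiE_def Pi_def)
  ultimately show ?thesis by simp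
qed

text \<open>Potentials maximizing the dual objective exist by compactness: clipping at distance \<open>2B\<close> below
  the largest potential does not change the column minima. At a maximum the tight edges
  satisfy Hall's condition, since otherwise raising the potentials on a violating set would
  increase the objective.\<close>

lemma perfect_matching_dual:
  fixes Y :: "'a \<Rightarrow> 'b \<Rightarrow> real"
  assumes finI: "finite I" and finJ: "finite J" and cIJ: "card I = card J"
  shows "\<exists>f u v. bij_betw f I J \<and> (\<forall>i\<in>I. \<forall>j\<in>J. u i + v j \<le> Y i j) \<and>
                 (\<forall>i\<in>I. u i + v (f i) = Y i (f i))"
proof (cases "I = {}")
  case True
  then have "J = {}" using cIJ finJ by simp
  then show ?thesis using True by (auto simp: bij_betw_def)
next
  case False
  \<comment> \<open>For fixed row potentials \<open>u\<close> the best column potentials are the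
    column minima, so the dual objective \<open>F\<close> depends on \<open>u\<close> alone.\<close>
  define v where "v u j = Min ((\<lambda>i. Y i j - u i) ` I)" for u j
  define F where "F u = sum u I + (\<Sum>j\<in>J. v u j)" for u
  define B where "B = (\<Sum>i\<in>I. \<Sum>j\<in>J. \<bar>Y i j\<bar>)"
  have B: "\<bar>Y i j\<bar> \<le> B" if "i \<in> I" "j \<in> J" for i j
  proof -
    have "\<bar>Y i j\<bar> \<le> (\<Sum>j\<in>J. \<bar>Y i j\<bar>)" using that finJ by (intro member_le_sum) auto
    also have "\<dots> \<le> B" unfolding B_def using that finI by (intro member_le_sum[of i I]) (auto intro: sum_nonneg)
    finally show ?thesis .
  qed
  have v_le: "v u j \<le> Y i j - u i" if "i \<in> I" for u i j
    unfolding v_def using finI that by (intro Min_le) auto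
  have v_ex: "\<exists>i\<in>I. v u j = Y i j - u i" for u j
  proof -
    have "v u j \<in> (\<lambda>i. Y i j - u i) ` I" unfolding v_def using finI False by (intro Min_in) auto
    then show ?thesis by auto
  qed
  have v_ge: "c \<le> v u j" if "\<And>i. i \<in> I \<Longrightarrow> c \<le> Y i j - u i" for c u j
    using v_ex[of u j] that by fastforce
  define S where "S = {u :: 'a \<Rightarrow> real. \<forall>i. 0 \<le> u i \<and> u i \<le> 2 * B}"
  have B0: "B \<ge> 0" unfolding B_def by (intro sum_nonneg) auto
  have "compact S" unfolding S_def by (rule compact_box_fun)
  moreover have "S \<noteq> {}" using B0 by (auto simp: S_def intro!: exI[of _ "\<lambda>_. 0"])
  moreover have "continuous_on S F"
    unfolding F_def v_def
    by (intro continuous_on_add continuous_on_sum continuous_on_Min_image finI False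
        continuous_on_diff continuous_on_const continuous_on_subset[OF continuous_on_product_coordinates subset_UNIV])
  ultimately have "\<exists>w\<in>S. \<forall>u\<in>S. F u \<le> F w" by (rule continuous_attains_sup)
  then obtain w where w: "w \<in> S" "\<And>u. u \<in> S \<Longrightarrow> F u \<le> F w" by blast
  have glob: "F u \<le> F w" for u
  proof -
    define c where "c = Max (u ` I)"
    have c: "u i \<le> c" if "i \<in> I" for i using that finI by (auto simp: c_def)
    have "c \<in> u ` I" unfolding c_def using finI False by (intro Max_in) auto
    then obtain i0 where i0: "i0 \<in> I" "u i0 = c" by auto
    \<comment> \<open>Shift so that the largest potential becomes \<open>2 * B\<close>, then cut off
      at \<open>0\<close>. The shift leaves \<open>F\<close> unchanged because \<open>I\<close> and
      \<open>J\<close> have the same size.\<close>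
    define u' where "u' i = (if i \<in> I then max (u i - c) (- (2 * B)) + 2 * B else 0)" for i
    have u'S: "u' \<in> S" using B0 c by (auto simp: S_def u'_def)
    have "v u j + c - 2 * B \<le> v u' j" if j: "j \<in> J" for j
    proof (rule v_ge)
      fix i assume i: "i \<in> I"
      have a: "v u j \<le> Y i j - u i" using i by (rule v_le)
      have b: "v u j \<le> Y i0 j - c" using v_le[OF i0(1), of u j] i0 by simp
      \<comment> \<open>Where the cut is active, \<open>u' i = 0\<close>, and comparison with row
        \<open>i0\<close> bounds the left side by \<open>Y i0 j - 2 * B\<close>, hence by
        \<open>- B\<close>.\<close>
      show "v u j + c - 2 * B \<le> Y i j - u' i"
        using a b B[OF i j] B[OF i0(1) j] i by (auto simp: u'_def max_def)
    qed
    then have "(\<Sum>j\<in>J. v u j + c - 2 * B) \<le> (\<Sum>j\<in>J. v u' j)" by (intro sum_mono) auto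
    moreover have "(\<Sum>i\<in>I. u i - c + 2 * B) \<le> sum u' I" by (intro sum_mono) (auto simp: u'_def)
    ultimately have "F u \<le> F u'"
      using cIJ by (simp add: F_def sum.distrib sum_subtractf algebra_simps)
    with w(2)[OF u'S] show ?thesis by simp
  qed
  define T where "T i = {j\<in>J. w i + v w j = Y i j}" for i
  have "\<exists>f. inj_on f I \<and> (\<forall>i\<in>I. f i \<in> T i)"
  proof (rule hall_marriage[OF finI])
    show "finite (T i)" for i using finJ by (auto simp: T_def)
    fix X assume X: "X \<subseteq> I"
    have finX: "finite X" using X finI finite_subset by blast
    define W where "W = (\<Union>i\<in>X. T i)"
    have WJ: "W \<subseteq> J" by (auto simp: W_def T_def)
    have finW: "finite W" using WJ finJ finite_subset by blast
    show "card X \<le> card (\<Union>i\<in>X. T i)"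
    proof (rule ccontr)
      assume neg: "\<not> card X \<le> card (\<Union>i\<in>X. T i)"
      \<comment> \<open>Its minimum \<open>e\<close> is the least slack between \<open>X\<close> and
        the columns that are not tight for it; the \<open>1\<close> keeps \<open>E\<close>
        nonempty.\<close>
      define E where "E = insert 1 ((\<lambda>(i,j). Y i j - w i - v w j) ` (X \<times> (J - W)))"
      define e where "e = Min E"
      have finE: "finite E" using finX finJ by (auto simp: E_def)
      have pos: "x > 0" if x: "x \<in> E" for x
      proof (cases "x = 1")
        case False
        then obtain i j where ij: "i \<in> X" "j \<in> J - W" "x = Y i j - w i - v w j"
            using x unfolding E_def by auto
        have "v w j \<le> Y i j - w i" by (rule v_le) (use ij X in auto)
        moreover have "w i + v w j \<noteq> Y i j" using ij by (auto simp: W_def T_def)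
        ultimately show ?thesis using ij by auto
      qed simp
      have e0: "e > 0" unfolding e_def using finE by (intro pos Min_in) (auto simp: E_def)
      have eij: "e \<le> Y i j - w i - v w j" if "i \<in> X" "j \<in> J - W" for i j
        unfolding e_def using finE that by (intro Min_le) (auto simp: E_def)
      define u where "u i = (if i \<in> X then w i + e else w i)" for i
      \<comment> \<open>Column minima outside \<open>W\<close> do not drop and those in
        \<open>W\<close> drop by at most \<open>e\<close>, so \<open>F\<close> gains at least
        \<open>e\<close> times \<open>card X - card W\<close>.\<close>
      have 1: "v w j \<le> v u j" if "j \<in> J - W" for j
        using v_le[of _ w j] eij[OF _ that] by (intro v_ge) (fastforce simp: u_def)
      have 2: "v w j - e \<le> v u j" for j
        using v_le[of _ w j] e0 by (intro v_ge) (fastforce simp: u_def)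
      have "(\<Sum>j\<in>J. v w j) - e * card W = (\<Sum>j\<in>J - W. v w j) + (\<Sum>j\<in>W. v w j - e)"
        using sum.subset_diff[OF WJ finJ, of "v w"] by (simp add: sum_subtractf)
      also have "\<dots> \<le> (\<Sum>j\<in>J - W. v u j) + (\<Sum>j\<in>W. v u j)"
        using 1 2 by (intro add_mono sum_mono) auto
      also have "\<dots> = (\<Sum>j\<in>J. v u j)" using sum.subset_diff[OF WJ finJ, of "v u"] by simp
      finally have A: "(\<Sum>j\<in>J. v w j) - e * card W \<le> (\<Sum>j\<in>J. v u j)" .
      have "sum u I = (\<Sum>i\<in>I. w i + (if i \<in> X then e else 0))" by (intro sum.cong) (auto simp: u_def)
      also have "\<dots> = sum w I + e * card X"
        using X finI by (simp add: sum.distrib sum.If_cases Int_absorb1)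
      finally have "F u \<ge> F w + e * (real (card X) - real (card W))" using A by (simp add: F_def algebra_simps)
      moreover have "e * (real (card X) - real (card W)) > 0" using neg e0 by (simp add: W_def)
      ultimately show False using glob[of u] by simp
    qed
  qed
  then obtain f where f: "inj_on f I" "\<forall>i\<in>I. f i \<in> T i" by blast
  have "f ` I \<subseteq> J" using f by (auto simp: T_def)
  then have "f ` I = J" using f cIJ finJ by (simp add: card_image card_subset_eq)
  then have "bij_betw f I J" using f by (simp add: bij_betw_def)
  moreover have "\<forall>i\<in>I. \<forall>j\<in>J. w i + v w j \<le> Y i j" using v_le[of _ w] by (simp add: le_diff_eq add.commute)
  moreover have "\<forall>i\<in>I. w i + v w (f i) = Y i (f i)" using f by (auto simp: T_def)
  ultimately show ?thesis by blast
qed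

section \<open>Assignments of given size and their duals\<close>

text \<open>Row and column sets are explicit arguments because later proofs delete rows and add
  columns.\<close>

definition asg :: "'a set \<Rightarrow> 'b set \<Rightarrow> nat \<Rightarrow> ('a \<times> 'b) set set" where
  "asg R C s = {A. A \<subseteq> R \<times> C \<and> card A = s \<and> inj_on fst A \<and> inj_on snd A}"

definition opt_cost :: "'a set \<Rightarrow> 'b set \<Rightarrow> ('a \<times> 'b \<Rightarrow> real) \<Rightarrow> nat \<Rightarrow> real" where
  "opt_cost R C X s = Min (sum X ` asg R C s)"

lemma finite_asg: "finite R \<Longrightarrow> finite C \<Longrightarrow> finite (asg R C s)"
  by (rule finite_subset[of _ "Pow (R \<times> C)"]) (auto simp: asg_def)

lemma asgD:
  assumes "A \<in> asg R C s"
  shows "A \<subseteq> R \<times> C" "card A = s" "inj_on fst A" "inj_on snd A"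
  using assms by (auto simp: asg_def)

lemma finite_of_asg: "A \<in> asg R C s \<Longrightarrow> finite R \<Longrightarrow> finite C \<Longrightarrow> finite A"
  by (auto simp: asg_def intro: finite_subset)

lemma asg_mono: "R \<subseteq> R' \<Longrightarrow> C \<subseteq> C' \<Longrightarrow> asg R C s \<subseteq> asg R' C' s"
  by (auto simp: asg_def)

lemma asg_nonempty:
  assumes "finite R" "finite C" "s \<le> card R" "s \<le> card C"
  shows "asg R C s \<noteq> {}"
proof -
  obtain R' C' where R': "R' \<subseteq> R" "card R' = s" and C': "C' \<subseteq> C" "card C' = s"
    using assms obtain_subset_with_card_n by metis
  have "finite R'" "finite C'" using R' C' assms finite_subset by auto
  then obtain f where f: "bij_betw f R' C'" using R' C' finite_same_card_bij by metis
  have "(\<lambda>i. (i, f i)) ` R' \<in> asg R C s"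
    using R' C' f unfolding asg_def by (auto simp: inj_on_def bij_betw_def card_image)
  then show ?thesis by blast
qed

lemma opt_cost_le: "finite R \<Longrightarrow> finite C \<Longrightarrow> A \<in> asg R C s \<Longrightarrow> opt_cost R C X s \<le> sum X A"
  unfolding opt_cost_def by (intro Min_le finite_imageI finite_asg imageI) auto

lemma opt_cost_attained:
  assumes "finite R" "finite C" "s \<le> card R" "s \<le> card C"
  shows "\<exists>A\<in>asg R C s. sum X A = opt_cost R C X s"
proof -
  have "opt_cost R C X s \<in> sum X ` asg R C s"
    unfolding opt_cost_def using assms by (intro Min_in finite_imageI finite_asg) (auto simp: asg_nonempty)
  then show ?thesis by (metis imageE)
qed

lemma abs_sum_asg_le:
  assumes "finite R" "finite C" "A \<in> asg R C s"
  shows "\<bar>sum X A\<bar> \<le> (\<Sum>p\<in>R \<times> C. \<bar>X p :: real\<bar>)"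
proof -
  have "\<bar>sum X A\<bar> \<le> (\<Sum>p\<in>A. \<bar>X p\<bar>)" by (rule sum_abs)
  also have "\<dots> \<le> (\<Sum>p\<in>R \<times> C. \<bar>X p\<bar>)"
    using assms asgD(1)[OF assms(3)] by (intro sum_mono2) auto
  finally show ?thesis .
qed

lemma asg_dual_gap:
  fixes X :: "'a \<times> 'b \<Rightarrow> real"
  assumes "finite R" "finite C" "A \<in> asg R C t"
  shows "sum X A - (real t * l - sum al R - sum be C) =
    (\<Sum>(i,j)\<in>A. X (i,j) - (l - al i - be j)) + sum al (R - fst ` A) + sum be (C - snd ` A)"
proof -
  have A: "finite A" "A \<subseteq> R \<times> C" "card A = t" "inj_on fst A" "inj_on snd A"
    using finite_of_asg[OF assms(3,1,2)] asgD[OF assms(3)] by auto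
  have "sum al R = sum al (R - fst ` A) + sum al (fst ` A)"
    using A assms by (intro sum.subset_diff) auto
  moreover have "sum al (fst ` A) = (\<Sum>(i,j)\<in>A. al i)"
    using A by (simp add: sum.reindex case_prod_unfold)
  moreover have "sum be C = sum be (C - snd ` A) + sum be (snd ` A)"
    using A assms by (intro sum.subset_diff) auto
  moreover have "sum be (snd ` A) = (\<Sum>(i,j)\<in>A. be j)"
    using A by (simp add: sum.reindex case_prod_unfold)
  moreover have "(\<Sum>(i,j)\<in>A. X (i,j) - (l - al i - be j)) =
      sum X A - real t * l + (\<Sum>(i,j)\<in>A. al i) + (\<Sum>(i,j)\<in>A. be j)"
    using A by (simp add: case_prod_unfold sum.distrib sum_subtractf algebra_simps)
  ultimately show ?thesis by simp
qed

lemma asg_weak_duality: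
  fixes X :: "'a \<times> 'b \<Rightarrow> real"
  assumes "finite R" "finite C" "A \<in> asg R C t"
    and "\<And>i. i \<in> R \<Longrightarrow> 0 \<le> al i" "\<And>j. j \<in> C \<Longrightarrow> 0 \<le> be j"
    and "\<And>i j. i \<in> R \<Longrightarrow> j \<in> C \<Longrightarrow> l - al i - be j \<le> X (i,j)"
  shows "real t * l - sum al R - sum be C \<le> sum X A"
proof -
  have "0 \<le> (\<Sum>(i,j)\<in>A. X (i,j) - (l - al i - be j)) + sum al (R - fst ` A) + sum be (C - snd ` A)"
    using assms asgD(1)[OF assms(3)] by (intro add_nonneg_nonneg sum_nonneg) auto
  then show ?thesis using asg_dual_gap[OF assms(1-3), of X l al be] by linarith
qed

lemma asg_complementary_slackness:
  fixes X :: "'a \<times> 'b \<Rightarrow> real"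
  assumes "finite R" "finite C" "A \<in> asg R C t"
    and "\<And>i. i \<in> R \<Longrightarrow> 0 \<le> al i" "\<And>j. j \<in> C \<Longrightarrow> 0 \<le> be j"
    and "\<And>i j. i \<in> R \<Longrightarrow> j \<in> C \<Longrightarrow> l - al i - be j \<le> X (i,j)"
    and "sum X A \<le> real t * l - sum al R - sum be C"
  shows "\<And>i j. (i,j) \<in> A \<Longrightarrow> X (i,j) = l - al i - be j"
    and "\<And>i. i \<in> R \<Longrightarrow> i \<notin> fst ` A \<Longrightarrow> al i = 0"
    and "\<And>j. j \<in> C \<Longrightarrow> j \<notin> snd ` A \<Longrightarrow> be j = 0"
proof -
  have A: "finite A" "A \<subseteq> R \<times> C"
    using finite_of_asg[OF assms(3,1,2)] asgD(1)[OF assms(3)] by auto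
  have n: "0 \<le> (\<Sum>(i,j)\<in>A. X (i,j) - (l - al i - be j))" "0 \<le> sum al (R - fst ` A)" "0 \<le> sum be (C - snd ` A)"
    using assms A by (auto intro!: sum_nonneg)
  then have z: "(\<Sum>(i,j)\<in>A. X (i,j) - (l - al i - be j)) = 0" "sum al (R - fst ` A) = 0" "sum be (C - snd ` A) = 0"
    using asg_dual_gap[OF assms(1-3), of X l al be] assms(7) by linarith+
  have "\<forall>p\<in>A. (case p of (i,j) \<Rightarrow> X (i,j) - (l - al i - be j)) = 0"
    using z(1) A assms(6) by (subst (asm) sum_nonneg_eq_0_iff) auto
  then show "\<And>i j. (i,j) \<in> A \<Longrightarrow> X (i,j) = l - al i - be j" by fastforce
  show "\<And>i. i \<in> R \<Longrightarrow> i \<notin> fst ` A \<Longrightarrow> al i = 0"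
    using z(2) assms(1,4) by (subst (asm) sum_nonneg_eq_0_iff) auto
  show "\<And>j. j \<in> C \<Longrightarrow> j \<notin> snd ` A \<Longrightarrow> be j = 0"
    using z(3) assms(2,5) by (subst (asm) sum_nonneg_eq_0_iff) auto
qed

text \<open>Completing with \<open>card C - s\<close> dummy rows and \<open>card R - s\<close> dummy columns turns assignments of
  size \<open>t \<ge> s\<close> into perfect matchings with \<open>t - s\<close> dummy-dummy pairs, each of cost \<open>\<kappa>\<close>.\<close>

lemma asg_strong_duality:
  fixes X :: "'a \<times> 'b \<Rightarrow> real"
  assumes finR: "finite R" and finC: "finite C" and sR: "s < card R" and sC: "s < card C"
  shows "\<exists>l al be t A. - \<kappa> \<le> l \<and> (\<forall>i\<in>R. 0 \<le> al i) \<and> (\<forall>j\<in>C. 0 \<le> be j) \<and>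
    (\<forall>i\<in>R. \<forall>j\<in>C. l - al i - be j \<le> X (i,j)) \<and> s \<le> t \<and> A \<in> asg R C t \<and>
    sum X A + (real t - real s) * \<kappa> \<le> real s * l - sum al R - sum be C"
proof -
  define P where "P = {..<card C - s}"
  define Q where "Q = {..<card R - s}"
  define Y where "Y x y = (case x of
      Inl i \<Rightarrow> (case y of Inl j \<Rightarrow> X (i,j) | Inr q \<Rightarrow> 0)
    | Inr p \<Rightarrow> (case y of Inl j \<Rightarrow> 0 | Inr q \<Rightarrow> \<kappa>))" for x :: "'a + nat" and y :: "'b + nat"
  have finP: "finite P" "finite Q" by (auto simp: P_def Q_def)
  have "0 \<in> P" "0 \<in> Q" using sR sC by (auto simp: P_def Q_def)
  then have ne: "P \<noteq> {}" "Q \<noteq> {}" by auto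
  have "card (R <+> P) = card (C <+> Q)"
    using finR finC finP sR sC by (simp add: card_Plus P_def Q_def)
  then obtain f u v where f: "bij_betw f (R <+> P) (C <+> Q)"
    and le: "\<forall>x\<in>R <+> P. \<forall>y\<in>C <+> Q. u x + v y \<le> Y x y"
    and eq: "\<forall>x\<in>R <+> P. u x + v (f x) = Y x (f x)"
    using perfect_matching_dual[of "R <+> P" "C <+> Q" Y] finR finC finP by (metis finite_Plus)
  \<comment> \<open>The largest dummy potentials give the size multiplier
    \<open>l = - (p + q)\<close>. Pairs of a real and a dummy line cost \<open>0\<close>, whence
    \<open>al\<close> and \<open>be\<close> are nonnegative; dummy-dummy pairs cost
    \<open>\<kappa>\<close>, which bounds \<open>l\<close>.\<close>
  define p where "p = Max ((\<lambda>i. u (Inr i)) ` P)"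
  define q where "q = Max ((\<lambda>i. v (Inr i)) ` Q)"
  have "p \<in> (\<lambda>i. u (Inr i)) ` P" "q \<in> (\<lambda>i. v (Inr i)) ` Q"
    unfolding p_def q_def using finP ne by (intro Max_in; simp)+
  then obtain p0 q0 where p0: "p0 \<in> P" "p = u (Inr p0)" and q0: "q0 \<in> Q" "q = v (Inr q0)" by auto
  have p_ge: "u (Inr i) \<le> p" if "i \<in> P" for i unfolding p_def using that finP by auto
  have q_ge: "v (Inr i) \<le> q" if "i \<in> Q" for i unfolding q_def using that finP by auto
  define al where "al i = - (u (Inl i) + q)" for i
  define be where "be j = - (v (Inl j) + p)" for j
  define l where "l = - (p + q)"
  have le': "u x + v y \<le> Y x y" if "x \<in> R <+> P" "y \<in> C <+> Q" for x y using le that by blast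
  have "p + q \<le> \<kappa>" using le'[OF InrI InrI, of p0 q0] p0 q0 by (simp add: Y_def)
  then have l: "- \<kappa> \<le> l" by (simp add: l_def)
  have "0 \<le> al i" if "i \<in> R" for i
    using le'[OF InlI[OF that] InrI[OF q0(1)]] q0(2) by (simp add: Y_def al_def)
  then have al: "\<forall>i\<in>R. 0 \<le> al i" by blast
  have "0 \<le> be j" if "j \<in> C" for j
    using le'[OF InrI[OF p0(1)] InlI[OF that]] p0(2) by (simp add: Y_def be_def)
  then have be: "\<forall>j\<in>C. 0 \<le> be j" by blast
  have "l - al i - be j \<le> X (i,j)" if "i \<in> R" "j \<in> C" for i j
    using le'[OF InlI[OF that(1)] InlI[OF that(2)]] by (simp add: Y_def al_def be_def l_def)
  then have feas: "\<forall>i\<in>R. \<forall>j\<in>C. l - al i - be j \<le> X (i,j)" by blast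
  define R' where "R' = {i\<in>R. isl (f (Inl i))}"
  define P' where "P' = {i\<in>P. \<not> isl (f (Inr i))}"
  define A where "A = (\<lambda>i. (i, projl (f (Inl i)))) ` R'"
  have fin': "finite R'" "finite P'" using finR finP by (auto simp: R'_def P'_def)
  have fx: "f x \<in> C <+> Q" if "x \<in> R <+> P" for x using f that by (auto simp: bij_betw_def)
  have finj: "x = y" if "f x = f y" "x \<in> R <+> P" "y \<in> R <+> P" for x y
    using f that by (auto simp: bij_betw_def dest: inj_onD)
  have A_asg: "A \<in> asg R C (card R')"
  proof -
    have "A \<subseteq> R \<times> C"
    proof -
      have "projl (f (Inl i)) \<in> C" if "i \<in> R'" for i
        using fx[OF InlI, of i] that by (auto simp: R'_def)
      then show ?thesis by (auto simp: A_def R'_def)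
    qed
    moreover have "card A = card R'" unfolding A_def by (intro card_image) (auto simp: inj_on_def)
    moreover have "inj_on fst A" by (auto simp: A_def inj_on_def)
    moreover have "i = i'" if "i \<in> R'" "i' \<in> R'" "projl (f (Inl i)) = projl (f (Inl i'))" for i i'
      using that finj[OF _ InlI InlI, of i i'] by (auto simp: R'_def intro: sum.expand)
    then have "inj_on snd A" by (auto simp: A_def inj_on_def)
    ultimately show ?thesis by (simp add: asg_def)
  qed
  have dd: "real (card P') = real (card R') - real s"
  proof -
    define W where "W = {x\<in>R <+> P. \<not> isl (f x)}"
    have "bij_betw f W (Inr ` Q)"
    proof (rule bij_betw_subset[OF f])
      show "W \<subseteq> R <+> P" by (auto simp: W_def)
      have "y \<in> f ` W" if "y \<in> Inr ` Q" for y
      proof -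
        have "y \<in> f ` (R <+> P)" using f that by (auto simp: bij_betw_def)
        then show ?thesis using that by (auto simp: W_def)
      qed
      moreover have "f x \<in> Inr ` Q" if "x \<in> W" for x using fx[of x] that by (auto simp: W_def)
      ultimately show "f ` W = Inr ` Q" by blast
    qed
    then have "card W = card Q" by (simp add: bij_betw_same_card card_image)
    moreover have "W = (R - R') <+> P'" by (auto simp: W_def R'_def P'_def)
    ultimately have "card (R - R') + card P' = card R - s"
      using finR fin' by (simp add: card_Plus Q_def)
    moreover have "card (R - R') = card R - card R'" "card R' \<le> card R"
      using finR by (auto simp: R'_def intro!: card_Diff_subset card_mono)
    ultimately show ?thesis using sR by linarith
  qed
  have "sum X A + real (card P') * \<kappa> = (\<Sum>x\<in>R <+> P. Y x (f x))"
  proof -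
    have "(\<Sum>i\<in>R. Y (Inl i) (f (Inl i))) = (\<Sum>i\<in>R'. Y (Inl i) (f (Inl i)))"
      using finR by (intro sum.mono_neutral_right) (auto simp: R'_def Y_def split: sum.splits)
    also have "\<dots> = sum X A"
      unfolding A_def by (subst sum.reindex) (auto simp: inj_on_def R'_def Y_def split: sum.splits intro!: sum.cong)
    finally have 1: "(\<Sum>i\<in>R. Y (Inl i) (f (Inl i))) = sum X A" .
    have "(\<Sum>i\<in>P. Y (Inr i) (f (Inr i))) = (\<Sum>i\<in>P'. Y (Inr i) (f (Inr i)))"
      using finP by (intro sum.mono_neutral_right) (auto simp: P'_def Y_def split: sum.splits)
    also have "\<dots> = (\<Sum>i\<in>P'. \<kappa>)"
      by (intro sum.cong) (auto simp: P'_def Y_def split: sum.splits)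
    finally show ?thesis using 1 finR finP by (simp add: sum.Plus)
  qed
  also have "\<dots> = (\<Sum>x\<in>R <+> P. u x) + (\<Sum>x\<in>R <+> P. v (f x))"
    using eq by (simp add: sum.distrib[symmetric])
  also have "(\<Sum>x\<in>R <+> P. v (f x)) = (\<Sum>y\<in>C <+> Q. v y)" using f by (rule sum.reindex_bij_betw)
  also have "(\<Sum>x\<in>R <+> P. u x) = (\<Sum>i\<in>R. - al i - q) + (\<Sum>i\<in>P. u (Inr i))"
    using finR finP by (simp add: sum.Plus al_def)
  also have "(\<Sum>y\<in>C <+> Q. v y) = (\<Sum>j\<in>C. - be j - p) + (\<Sum>j\<in>Q. v (Inr j))"
    using finC finP by (simp add: sum.Plus be_def)
  finally have "sum X A + real (card P') * \<kappa> = (\<Sum>i\<in>R. - al i - q) + (\<Sum>i\<in>P. u (Inr i)) +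
      ((\<Sum>j\<in>C. - be j - p) + (\<Sum>j\<in>Q. v (Inr j)))" .
  \<comment> \<open>All dummy potentials are raised to their maximum, so the dual value can only
    grow.\<close>
  also have "\<dots> \<le> (\<Sum>i\<in>R. - al i - q) + (\<Sum>i\<in>P. p) + ((\<Sum>j\<in>C. - be j - p) + (\<Sum>j\<in>Q. q))"
    using p_ge q_ge by (intro add_mono sum_mono order_refl)
  also have "\<dots> = real s * l - sum al R - sum be C"
    using sR sC by (simp add: sum_subtractf sum_negf P_def Q_def l_def of_nat_diff algebra_simps)
  finally have "sum X A + (real (card R') - real s) * \<kappa> \<le> real s * l - sum al R - sum be C"
    by (simp add: dd)
  moreover have "s \<le> card R'" using dd by linarith
  ultimately show ?thesis using l al be feas A_asg by blast
qed

section \<open>Dependence of the optimal cost on the size and on the rows\<close>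

text \<open>A dual solution that is optimal for size \<open>s + 1\<close> is feasible for every size
  and its value is linear in the size: a supporting line.\<close>

lemma opt_cost_convex:
  assumes fin: "finite R" "finite C" and R: "s + 2 \<le> card R" and C: "s + 2 \<le> card C"
  shows "2 * opt_cost R C X (s + 1) \<le> opt_cost R C X s + opt_cost R C X (s + 2)"
proof -
  define W where "W = (\<Sum>p\<in>R \<times> C. \<bar>X p\<bar>)"
  \<comment> \<open>So expensive that no dummy-dummy pair can occur, which forces
    \<open>t = s + 1\<close>.\<close>
  define \<kappa> where "\<kappa> = \<bar>opt_cost R C X (s + 1)\<bar> + W + 1"
  have W: "W \<ge> 0" unfolding W_def by (intro sum_nonneg) auto
  obtain l al be t A where al: "\<forall>i\<in>R. 0 \<le> al i" and be: "\<forall>j\<in>C. 0 \<le> be j"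
    and feas: "\<forall>i\<in>R. \<forall>j\<in>C. l - al i - be j \<le> X (i,j)" and t: "s + 1 \<le> t" and A: "A \<in> asg R C t"
    and le: "sum X A + (real t - real (s + 1)) * \<kappa> \<le> real (s + 1) * l - sum al R - sum be C"
    using asg_strong_duality[OF fin, of "s + 1" \<kappa> X] R C by (auto simp del: of_nat_add)
  have weak: "real q * l - sum al R - sum be C \<le> opt_cost R C X q" if q: "q \<le> card R" "q \<le> card C" for q
  proof -
    obtain B where B: "B \<in> asg R C q" "sum X B = opt_cost R C X q" using opt_cost_attained[OF fin q] by blast
    show ?thesis using asg_weak_duality[OF fin B(1), of al be l X] al be feas B(2) by auto
  qed
  have "t = s + 1"
  proof (rule ccontr)
    assume "t \<noteq> s + 1"
    then have "1 * \<kappa> \<le> (real t - real (s + 1)) * \<kappa>"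
      using t W by (intro mult_right_mono) (auto simp: \<kappa>_def)
    moreover have "- W \<le> sum X A" using abs_sum_asg_le[OF fin A, of X] unfolding W_def by linarith
    moreover have "real (s + 1) * l - sum al R - sum be C \<le> opt_cost R C X (s + 1)" using R C by (intro weak) auto
    moreover have "opt_cost R C X (s + 1) + W + 1 \<le> \<kappa>" by (simp add: \<kappa>_def)
    ultimately show False using le by linarith
  qed
  then have "opt_cost R C X (s + 1) \<le> real (s + 1) * l - sum al R - sum be C"
    using le opt_cost_le[OF fin, of A "s + 1" X] A by simp
  moreover have "real s * l - sum al R - sum be C \<le> opt_cost R C X s"
    "real (s + 2) * l - sum al R - sum be C \<le> opt_cost R C X (s + 2)" using R C by (intro weak; simp)+
  ultimately show ?thesis by (simp add: algebra_simps)
qed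

text \<open>By convexity the increments of the cost grow with the size, so the first one bounds all
  later ones from below.\<close>

lemma opt_cost_supporting_line:
  assumes fin: "finite R" "finite C" and "s \<le> t" "t \<le> card R" "t \<le> card C"
    and s: "s < card R" "s < card C"
  shows "opt_cost R C X s + real (t - s) * (opt_cost R C X (s + 1) - opt_cost R C X s) \<le> opt_cost R C X t"
proof -
  have incr: "opt_cost R C X (s + 1) - opt_cost R C X s \<le> opt_cost R C X (s + q + 1) - opt_cost R C X (s + q)"
    if "s + q + 1 \<le> card R" "s + q + 1 \<le> card C" for q
    using that
  proof (induction q)
    case (Suc q)
    then show ?case using opt_cost_convex[OF fin, of "s + q" X] by simp
  qed simp
  have "opt_cost R C X s + real q * (opt_cost R C X (s + 1) - opt_cost R C X s) \<le> opt_cost R C X (s + q)"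
    if "s + q \<le> card R" "s + q \<le> card C" for q
    using that
  proof (induction q)
    case (Suc q)
    then show ?case using incr[of q] by (simp add: algebra_simps)
  qed simp
  from this[of "t - s"] show ?thesis using assms by simp
qed

text \<open>Adding a column whose only affordable entry lies in row \<open>e\<close> and has cost \<open>\<mu>\<close>, with \<open>\<mu>\<close>
  chosen so that using it or not is indifferent at size \<open>s + 1\<close>, reduces the claim to
  convexity of the optimal cost in the size.\<close>

lemma opt_cost_delete_row_mono1:
  fixes R :: "'a set" and C :: "nat set"
  assumes fin: "finite R" "finite C" and e: "e \<in> R" and R: "s + 2 \<le> card R" and C: "s + 1 \<le> card C"
  shows "opt_cost (R - {e}) C X s - opt_cost R C X s \<le> opt_cost (R - {e}) C X (s + 1) - opt_cost R C X (s + 1)"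
proof -
  define \<mu> where "\<mu> = opt_cost R C X (s + 1) - opt_cost (R - {e}) C X s"
  define W where "W = (\<Sum>p\<in>R \<times> C. \<bar>X p\<bar>)"
  \<comment> \<open>A fresh column exists because columns are natural numbers.\<close>
  obtain c where c: "c \<notin> C" using ex_new_if_finite[OF infinite_UNIV_nat fin(2)] by blast
  define K where "K = opt_cost R C X (s + 1) + W"
  define X' where "X' p = (if snd p = c then (if fst p = e then \<mu> else K) else X p)" for p
  have same: "sum X' A = sum X A" if "A \<subseteq> R \<times> C" for A
    using that c by (intro sum.cong) (auto simp: X'_def)
  have cR: "card (R - {e}) = card R - 1" using e fin by simp
  have finRe: "finite (R - {e})" using fin by simp
  have "2 * opt_cost R (insert c C) X' (s + 1) \<le> opt_cost R (insert c C) X' s + opt_cost R (insert c C) X' (s + 2)"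
    using fin R C c by (intro opt_cost_convex) auto
  moreover have "opt_cost R (insert c C) X' s \<le> opt_cost R C X s"
  proof -
    obtain A where A: "A \<in> asg R C s" "sum X A = opt_cost R C X s"
      using opt_cost_attained[OF fin, of s X] R C by auto
    have "A \<in> asg R (insert c C) s" using A asg_mono[of R R C "insert c C"] by auto
    then show ?thesis using opt_cost_le[of R "insert c C" A s X'] fin same[OF asgD(1)[OF A(1)]] A by simp
  qed
  moreover have "opt_cost R (insert c C) X' (s + 2) \<le> opt_cost (R - {e}) C X (s + 1) + \<mu>"
  proof -
    obtain A where A: "A \<in> asg (R - {e}) C (s + 1)" "sum X A = opt_cost (R - {e}) C X (s + 1)"
      using opt_cost_attained[OF finRe fin(2) _ C, of X] R cR by fastforce
    note D = asgD[OF A(1)] and finA = finite_of_asg[OF A(1) finRe fin(2)]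
    have ec: "(e, c) \<notin> A" using D(1) by auto
    have "insert (e,c) A \<in> asg R (insert c C) (s + 2)"
      using D finA ec e c unfolding asg_def by (auto simp: inj_on_insert)
    from opt_cost_le[OF fin(1) _ this, of X'] have "opt_cost R (insert c C) X' (s + 2) \<le> sum X' (insert (e,c) A)"
      using fin by simp
    also have "\<dots> = \<mu> + sum X A"
      using finA ec same[of A] D(1) by (auto simp: X'_def)
    finally show ?thesis using A by simp
  qed
  \<comment> \<open>The new column brings no gain at size \<open>s + 1\<close>: with
    \<open>(e, c)\<close> the choice of \<open>\<mu>\<close> balances exactly, and in any other row
    \<open>K\<close> outweighs the remaining sum, which is at least \<open>- W\<close>.\<close>
  moreover have "opt_cost R C X (s + 1) \<le> opt_cost R (insert c C) X' (s + 1)"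
  proof -
    obtain A where A: "A \<in> asg R (insert c C) (s + 1)" "sum X' A = opt_cost R (insert c C) X' (s + 1)"
      using opt_cost_attained[of R "insert c C" "s + 1" X'] fin R C c by auto
    note D = asgD[OF A(1)] and finA = finite_of_asg[OF A(1)]
    have "opt_cost R C X (s + 1) \<le> sum X' A"
    proof (cases "c \<in> snd ` A")
      case False
      then have "A \<subseteq> R \<times> C" using D(1) by force
      then have "A \<in> asg R C (s + 1)" using D by (simp add: asg_def)
      then show ?thesis using opt_cost_le[OF fin, of A "s + 1" X] same[OF \<open>A \<subseteq> R \<times> C\<close>] by simp
    next
      case True
      then obtain i where i: "(i,c) \<in> A" by force
      define B where "B = A - {(i,c)}"
      have B: "B \<subseteq> (R - {i}) \<times> C"
      proof
        fix p assume p: "p \<in> B"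
        then have "p \<in> A" "p \<noteq> (i,c)" by (auto simp: B_def)
        then have "fst p \<noteq> i" "snd p \<noteq> c" using i D(3,4) by (auto simp: inj_on_def)
        then show "p \<in> (R - {i}) \<times> C" using \<open>p \<in> A\<close> D(1) by auto
      qed
      have Basg: "B \<in> asg (R - {i}) C s"
        using B D i finA fin by (auto simp: asg_def B_def inj_on_diff)
      have sumA: "sum X' A = X' (i,c) + sum X B"
        using i finA fin same[of B] B by (subst sum.remove[of A "(i,c)"]) (auto simp: B_def)
      show ?thesis
      proof (cases "i = e")
        case True
        then have "opt_cost (R - {e}) C X s \<le> sum X B" using opt_cost_le[OF finRe fin(2), of B s X] Basg by simp
        then show ?thesis using sumA True by (simp add: X'_def \<mu>_def)
      next
        case False
        have "B \<in> asg R C s" using Basg asg_mono[of "R - {i}" R C C] by blast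
        then have "- W \<le> sum X B" using abs_sum_asg_le[OF fin, of B s X] unfolding W_def by linarith
        then show ?thesis using sumA False by (simp add: X'_def K_def)
      qed
    qed
    then show ?thesis using A by simp
  qed
  ultimately show ?thesis by (simp add: \<mu>_def)
qed

text \<open>Needed for the perturbation below: a lower bound on the price of forbidding row
  \<open>e\<close> at size \<open>s\<close> stays valid at every larger size.\<close>

lemma opt_cost_delete_row_mono:
  fixes R :: "'a set" and C :: "nat set"
  assumes fin: "finite R" "finite C" and e: "e \<in> R" and "s \<le> t" "t < card R" "t \<le> card C"
  shows "opt_cost (R - {e}) C X s - opt_cost R C X s \<le> opt_cost (R - {e}) C X t - opt_cost R C X t"
proof -
  have "opt_cost (R - {e}) C X s - opt_cost R C X s \<le> opt_cost (R - {e}) C X (s + q) - opt_cost R C X (s + q)"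
    if "s + q < card R" "s + q \<le> card C" for q
    using that
  proof (induction q)
    case (Suc q)
    then show ?case using opt_cost_delete_row_mono1[OF fin e, of "s + q" X] by simp
  qed simp
  from this[of "t - s"] show ?thesis using assms by simp
qed

definition avoidable :: "'a set \<Rightarrow> 'b set \<Rightarrow> ('a \<times> 'b \<Rightarrow> real) \<Rightarrow> nat \<Rightarrow> 'a set" where
  "avoidable R C X s = {e\<in>R. \<exists>A\<in>asg R C s. sum X A = opt_cost R C X s \<and> e \<notin> fst ` A}"

lemma opt_cost_delete_unavoidable_row:
  assumes fin: "finite R" "finite C" and s: "s < card R" "s \<le> card C"
    and e: "e \<in> R - avoidable R C X s"
  shows "opt_cost R C X s < opt_cost (R - {e}) C X s"
proof -
  have finRe: "finite (R - {e})" using fin by simp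
  obtain A where A: "A \<in> asg (R - {e}) C s" "sum X A = opt_cost (R - {e}) C X s"
    using opt_cost_attained[OF finRe fin(2) _ s(2), of X] s e fin by fastforce
  have "A \<in> asg R C s" using A(1) asg_mono[of "R - {e}" R C C] by blast
  then have "opt_cost R C X s \<le> sum X A" "sum X A \<noteq> opt_cost R C X s"
    using opt_cost_le[OF fin] e asgD(1)[OF A(1)] by (force simp: avoidable_def)+
  then show ?thesis using A by simp
qed

text \<open>Strict positivity of \<open>al\<close> off the avoidable rows comes from perturbing these rows by a small
  \<open>\<epsilon>\<close>: no optimal solution of size \<open>\<ge> s\<close> changes, so \<open>\<epsilon>\<close> can be added to a dual solution of
  the perturbed problem.\<close>

lemma asg_certificate:
  fixes R :: "'a set" and C :: "nat set"
  assumes fin: "finite R" "finite C" and s: "s < card R" "s < card C"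
    and l: "l = opt_cost R C X (s + 1) - opt_cost R C X s"
  obtains al be where "\<And>i. i \<in> R \<Longrightarrow> 0 \<le> al i" "\<And>j. j \<in> C \<Longrightarrow> 0 \<le> be j"
    "\<And>i j. i \<in> R \<Longrightarrow> j \<in> C \<Longrightarrow> l - al i - be j \<le> X (i,j)"
    "real s * l - sum al R - sum be C = opt_cost R C X s"
    "\<And>i. i \<in> R \<Longrightarrow> al i = 0 \<longleftrightarrow> i \<in> avoidable R C X s"
proof -
  define U where "U = R - avoidable R C X s"
  have UR: "U \<subseteq> R" and finU: "finite U" using fin by (auto simp: U_def)
  \<comment> \<open>The least price of forbidding an unavoidable row; the \<open>1\<close> covers
    the case that there is none.\<close>
  define d where "d = Min (insert 1 ((\<lambda>e. opt_cost (R - {e}) C X s - opt_cost R C X s) ` U))"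
  have d0: "d > 0"
    unfolding d_def using finU opt_cost_delete_unavoidable_row[OF fin s(1)] s(2) by (subst Min_gr_iff) (auto simp: U_def)
  have d: "d \<le> opt_cost (R - {e}) C X s - opt_cost R C X s" if "e \<in> U" for e
    unfolding d_def using that finU by (intro Min_le) auto
  \<comment> \<open>Small enough that a solution using all of \<open>U\<close> pays at most
    \<open>d\<close> extra; the \<open>+ 1\<close> avoids division by zero.\<close>
  define \<epsilon> where "\<epsilon> = d / (real (card U) + 1)"
  have eps: "\<epsilon> > 0" "\<epsilon> * real (card U) \<le> d" using d0 by (auto simp: \<epsilon>_def field_simps)
  define X' where "X' p = X p + (if fst p \<in> U then \<epsilon> else 0)" for p
  \<comment> \<open>With \<open>\<kappa> = - l\<close> each pair beyond \<open>s\<close> is credited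
    with \<open>l\<close>, the slope of the supporting line at \<open>s\<close>, so \<open>t\<close>
    need not be controlled; the bound on the multiplier becomes \<open>l \<le> l'\<close>.\<close>
  obtain l' al' be t A where l': "- (- l) \<le> l'" and al': "\<forall>i\<in>R. 0 \<le> al' i" and be: "\<forall>j\<in>C. 0 \<le> be j"
    and feas': "\<forall>i\<in>R. \<forall>j\<in>C. l' - al' i - be j \<le> X' (i,j)" and t: "s \<le> t" and A: "A \<in> asg R C t"
    and le: "sum X' A + (real t - real s) * (- l) \<le> real s * l' - sum al' R - sum be C"
    using asg_strong_duality[OF fin s, of "- l" X'] by metis
  note D = asgD[OF A] and finA = finite_of_asg[OF A fin]
  have tR: "t \<le> card R" using D fin card_image[of fst A] card_mono[of R "fst ` A"] by force
  have tC: "t \<le> card C" using D fin card_image[of snd A] card_mono[of C "snd ` A"] by force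
  have sumA: "sum X' A = sum X A + \<epsilon> * real (card (fst ` A \<inter> U))"
  proof -
    have "(\<Sum>p\<in>A. if fst p \<in> U then \<epsilon> else 0) = (\<Sum>i\<in>fst ` A. if i \<in> U then \<epsilon> else 0)"
      using D by (simp add: sum.reindex)
    also have "\<dots> = \<epsilon> * real (card (fst ` A \<inter> U))" using finA by (simp add: sum.If_cases Collect_mem_eq)
    finally show ?thesis by (simp add: X'_def sum.distrib)
  qed
  have supp: "opt_cost R C X s + real (t - s) * l \<le> opt_cost R C X t"
    unfolding l using opt_cost_supporting_line[OF fin t tR tC s] .
  \<comment> \<open>Either \<open>A\<close> meets every row of \<open>U\<close> and pays
    \<open>\<epsilon>\<close> for each, or it misses one and pays at least \<open>d\<close> for
    that.\<close>
  have "opt_cost R C X s + real (t - s) * l + \<epsilon> * real (card U) \<le> sum X' A"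
  proof (cases "U \<subseteq> fst ` A")
    case True
    then have "fst ` A \<inter> U = U" by auto
    then show ?thesis using sumA supp opt_cost_le[OF fin A, of X] by simp
  next
    case False
    then obtain e where e: "e \<in> U" "e \<notin> fst ` A" by auto
    have "A \<subseteq> (R - {e}) \<times> C" using D(1) e by force
    then have A': "A \<in> asg (R - {e}) C t" using D by (simp add: asg_def)
    have "fst ` A \<subseteq> R - {e}" using D(1) e by auto
    then have "t \<le> card (R - {e})" using D fin card_image[of fst A] card_mono[of "R - {e}" "fst ` A"] by auto
    then have tlt: "t < card R" using e UR fin s by (auto simp: card_Diff_singleton)
    have "opt_cost (R - {e}) C X s - opt_cost R C X s \<le> opt_cost (R - {e}) C X t - opt_cost R C X t"
      using e UR by (intro opt_cost_delete_row_mono fin t tlt tC) auto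
    moreover have "opt_cost (R - {e}) C X t \<le> sum X A" using opt_cost_le[OF _ fin(2) A', of X] fin by simp
    moreover have "sum X A \<le> sum X' A" using sumA eps by simp
    ultimately show ?thesis using d[OF e(1)] eps(2) supp by linarith
  qed
  then have lower: "opt_cost R C X s + \<epsilon> * real (card U) \<le> real s * l' - sum al' R - sum be C"
    using le t by (simp add: of_nat_diff algebra_simps)
  define al where "al i = al' i + (if i \<in> U then \<epsilon> else 0)" for i
  have al: "0 \<le> al i" if "i \<in> R" for i using al' eps that by (auto simp: al_def)
  have feas: "l' - al i - be j \<le> X (i,j)" if "i \<in> R" "j \<in> C" for i j
    using feas' that by (force simp: al_def X'_def)
  have "sum al R = sum al' R + \<epsilon> * real (card U)"
    using fin UR by (simp add: al_def sum.distrib sum.If_cases Int_absorb1)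
  then have val: "opt_cost R C X s \<le> real s * l' - sum al R - sum be C" using lower by simp
  have weak: "real q * l' - sum al R - sum be C \<le> opt_cost R C X q" if q: "q \<le> card R" "q \<le> card C" for q
  proof -
    obtain B where B: "B \<in> asg R C q" "sum X B = opt_cost R C X q" using opt_cost_attained[OF fin q] by blast
    show ?thesis using asg_weak_duality[OF fin B(1), of al be l' X] al be feas B(2) by auto
  qed
  \<comment> \<open>The dual line lies at or above the optimal cost at \<open>s\<close> and at or
    below it at \<open>s + 1\<close>.\<close>
  have "l' \<le> l" using weak[of "s + 1"] s val l by (simp add: algebra_simps)
  then have ll: "l' = l" using l' by simp
  have val': "real s * l - sum al R - sum be C = opt_cost R C X s" using val weak[of s] s ll by auto
  have "al i = 0 \<longleftrightarrow> i \<in> avoidable R C X s" if i: "i \<in> R" for i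
  proof
    assume "al i = 0"
    then have "i \<notin> U" using eps al' i by (auto simp: al_def add_eq_0_iff)
    then show "i \<in> avoidable R C X s" using i by (simp add: U_def)
  next
    assume "i \<in> avoidable R C X s"
    then obtain B where B: "B \<in> asg R C s" "sum X B = opt_cost R C X s" "i \<notin> fst ` B" by (auto simp: avoidable_def)
    show "al i = 0"
      by (rule asg_complementary_slackness(2)[OF fin B(1) al _ _ _ i B(3), where be = be and l = l and X = X])
         (use be feas ll val' B(2) in auto)
  qed
  then show ?thesis using that[of al be] al be feas ll val' by auto
qed

section \<open>Covers and zero assignments\<close>

text \<open>By Koenig's theorem this is the rank of \<open>E\<close> in the transversal matroid of
  the zeros in the columns \<open>C\<close>. Once the covering columns \<open>K\<close> are chosen,
  the covering rows are determined, so minimizing over \<open>K\<close> suffices.\<close>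

definition cover_number :: "('a \<times> 'b) set \<Rightarrow> 'b set \<Rightarrow> 'a set \<Rightarrow> nat" where
  "cover_number Z C E = Min ((\<lambda>K. card K + card {i\<in>E. \<exists>j\<in>C - K. (i,j) \<in> Z}) ` Pow C)"

lemma cover_number_le:
  "finite C \<Longrightarrow> K \<subseteq> C \<Longrightarrow> cover_number Z C E \<le> card K + card {i\<in>E. \<exists>j\<in>C - K. (i,j) \<in> Z}"
  unfolding cover_number_def by (intro Min_le) auto

lemma cover_number_attained:
  assumes "finite C"
  shows "\<exists>K\<subseteq>C. cover_number Z C E = card K + card {i\<in>E. \<exists>j\<in>C - K. (i,j) \<in> Z}"
proof -
  have "cover_number Z C E \<in> (\<lambda>K. card K + card {i\<in>E. \<exists>j\<in>C - K. (i,j) \<in> Z}) ` Pow C"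
    unfolding cover_number_def using assms by (intro Min_in) auto
  then show ?thesis by auto
qed

lemma cover_number_mono:
  assumes "finite C" "finite E'" "E \<subseteq> E'"
  shows "cover_number Z C E \<le> cover_number Z C E'"
proof -
  obtain K where K: "K \<subseteq> C" "cover_number Z C E' = card K + card {i\<in>E'. \<exists>j\<in>C - K. (i,j) \<in> Z}"
    using cover_number_attained[OF assms(1)] by blast
  have "card {i\<in>E. \<exists>j\<in>C - K. (i,j) \<in> Z} \<le> card {i\<in>E'. \<exists>j\<in>C - K. (i,j) \<in> Z}"
    using assms by (intro card_mono) auto
  then show ?thesis using cover_number_le[OF assms(1) K(1), of Z E] K(2) by linarith
qed

text \<open>Uncrossing: of optimal column sets \<open>K\<close> for \<open>A\<close> and
  \<open>L\<close> for \<open>B\<close>, the union serves \<open>A \<union> B\<close> and the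
  intersection serves \<open>A \<inter> B\<close>; no row is then needed more often than
  before.\<close>

lemma cover_number_submodular:
  assumes "finite C" "finite A" "finite B"
  shows "cover_number Z C (A \<union> B) + cover_number Z C (A \<inter> B) \<le> cover_number Z C A + cover_number Z C B"
proof -
  define r where "r K E = {i\<in>E. \<exists>j\<in>C - K. (i,j) \<in> Z}" for K E
  obtain K where K: "K \<subseteq> C" "cover_number Z C A = card K + card (r K A)"
    using cover_number_attained[OF assms(1)] unfolding r_def by blast
  obtain L where L: "L \<subseteq> C" "cover_number Z C B = card L + card (r L B)"
    using cover_number_attained[OF assms(1)] unfolding r_def by blast
  have fin: "finite K" "finite L" using K L assms finite_subset by blast+
  have finr: "finite (r K A)" "finite (r L B)" using assms by (auto simp: r_def)
  have "r (K \<union> L) (A \<union> B) \<union> r (K \<inter> L) (A \<inter> B) \<subseteq> r K A \<union> r L B"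
    "r (K \<union> L) (A \<union> B) \<inter> r (K \<inter> L) (A \<inter> B) \<subseteq> r K A \<inter> r L B"
    by (auto simp: r_def)
  then have "card (r (K \<union> L) (A \<union> B) \<union> r (K \<inter> L) (A \<inter> B)) \<le> card (r K A \<union> r L B)"
    "card (r (K \<union> L) (A \<union> B) \<inter> r (K \<inter> L) (A \<inter> B)) \<le> card (r K A \<inter> r L B)"
    using finr by (auto intro!: card_mono)
  moreover have "card (r K A) + card (r L B) = card (r K A \<union> r L B) + card (r K A \<inter> r L B)"
    using finr by (rule card_Un_Int)
  moreover have "card (r (K \<union> L) (A \<union> B)) + card (r (K \<inter> L) (A \<inter> B)) =
      card (r (K \<union> L) (A \<union> B) \<union> r (K \<inter> L) (A \<inter> B)) + card (r (K \<union> L) (A \<union> B) \<inter> r (K \<inter> L) (A \<inter> B))"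
    using assms by (intro card_Un_Int) (auto simp: r_def)
  moreover have "card K + card L = card (K \<union> L) + card (K \<inter> L)" using fin by (rule card_Un_Int)
  moreover have "cover_number Z C (A \<union> B) \<le> card (K \<union> L) + card (r (K \<union> L) (A \<union> B))"
    "cover_number Z C (A \<inter> B) \<le> card (K \<inter> L) + card (r (K \<inter> L) (A \<inter> B))"
    using K L unfolding r_def by (intro cover_number_le assms; blast)+
  ultimately show ?thesis using K(2) L(2) by linarith
qed

lemma cover_number_insert_le:
  assumes "finite C" "finite E"
  shows "cover_number Z C (insert e E) \<le> cover_number Z C E + 1"
proof -
  obtain K where K: "K \<subseteq> C" "cover_number Z C E = card K + card {i\<in>E. \<exists>j\<in>C - K. (i,j) \<in> Z}"
    using cover_number_attained[OF assms(1)] by blast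
  have "card {i\<in>insert e E. \<exists>j\<in>C - K. (i,j) \<in> Z} \<le> card (insert e {i\<in>E. \<exists>j\<in>C - K. (i,j) \<in> Z})"
    using assms by (intro card_mono) auto
  also have "\<dots> \<le> card {i\<in>E. \<exists>j\<in>C - K. (i,j) \<in> Z} + 1"
    using assms by (subst card_insert_if) auto
  finally show ?thesis using cover_number_le[OF assms(1) K(1), of Z "insert e E"] K(2) by linarith
qed

text \<open>The easy half of Koenig's theorem: each pair of \<open>A\<close> needs its own line of
  the cover.\<close>

lemma zero_asg_le_cover_number:
  assumes "finite C" "finite E" "A \<in> asg E C t" "A \<subseteq> Z"
  shows "t \<le> cover_number Z C E"
proof -
  obtain K where K: "K \<subseteq> C" "cover_number Z C E = card K + card {i\<in>E. \<exists>j\<in>C - K. (i,j) \<in> Z}"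
    using cover_number_attained[OF assms(1)] by blast
  note D = asgD[OF assms(3)] and finA = finite_of_asg[OF assms(3,2,1)]
  have eq: "{p\<in>A. snd p \<in> K} \<union> {p\<in>A. snd p \<notin> K} = A" by auto
  have "t \<le> card {p\<in>A. snd p \<in> K} + card {p\<in>A. snd p \<notin> K}"
    using card_Un_le[of "{p\<in>A. snd p \<in> K}" "{p\<in>A. snd p \<notin> K}"] unfolding eq D(2) .
  moreover have "card {p\<in>A. snd p \<in> K} = card (snd ` {p\<in>A. snd p \<in> K})"
    using D(4) by (intro card_image[symmetric]) (auto simp: inj_on_def)
  moreover have "card (snd ` {p\<in>A. snd p \<in> K}) \<le> card K"
    using finite_subset[OF K(1) assms(1)] by (intro card_mono) auto
  moreover have "card {p\<in>A. snd p \<notin> K} = card (fst ` {p\<in>A. snd p \<notin> K})"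
    using D(3) by (intro card_image[symmetric]) (auto simp: inj_on_def)
  moreover have "card (fst ` {p\<in>A. snd p \<notin> K}) \<le> card {i\<in>E. \<exists>j\<in>C - K. (i,j) \<in> Z}"
  proof (rule card_mono)
    show "finite {i\<in>E. \<exists>j\<in>C - K. (i,j) \<in> Z}" using assms by auto
    show "fst ` {p\<in>A. snd p \<notin> K} \<subseteq> {i\<in>E. \<exists>j\<in>C - K. (i,j) \<in> Z}"
    proof
      fix i assume "i \<in> fst ` {p\<in>A. snd p \<notin> K}"
      then obtain j where "(i,j) \<in> A" "j \<notin> K" by auto
      then show "i \<in> {i\<in>E. \<exists>j\<in>C - K. (i,j) \<in> Z}" using D(1) assms(4) by auto
    qed
  qed
  ultimately show ?thesis using K(2) by linarith
qed

text \<open>Koenig's theorem: in a minimum cover, Hall's condition holds both for the covering rows into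
  the uncovered columns and for the covering columns into the uncovered rows.\<close>

lemma zero_asg_of_cover_number:
  assumes finC: "finite C" and finE: "finite E"
  shows "\<exists>A\<in>asg E C (cover_number Z C E). A \<subseteq> Z"
proof -
  define r where "r K = {i\<in>E. \<exists>j\<in>C - K. (i,j) \<in> Z}" for K
  obtain K where K: "K \<subseteq> C" "cover_number Z C E = card K + card (r K)"
    using cover_number_attained[OF finC] unfolding r_def by blast
  have opt: "card K + card (r K) \<le> card L + card (r L)" if "L \<subseteq> C" for L
    using cover_number_le[OF finC that, of Z E] K(2) unfolding r_def by simp
  have finK: "finite K" using K finC finite_subset by blast
  have finr: "finite (r L)" for L using finE by (auto simp: r_def)
  define N where "N i = {j\<in>C - K. (i,j) \<in> Z}" for i
  define M where "M j = {i\<in>E - r K. (i,j) \<in> Z}" for j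
  have "\<exists>f. inj_on f (r K) \<and> (\<forall>i\<in>r K. f i \<in> N i)"
  proof (rule hall_marriage[OF finr])
    show "\<And>i. finite (N i)" using finC by (auto simp: N_def)
    fix S assume S: "S \<subseteq> r K"
    have finS: "finite S" using S finr finite_subset by blast
    have finN: "finite (\<Union>i\<in>S. N i)" using finS finC by (auto simp: N_def)
    \<comment> \<open>Replacing the rows \<open>S\<close> of the cover by the columns in their
      neighbourhood gives a cover again, so minimality yields Hall's condition.\<close>
    have "r (K \<union> (\<Union>i\<in>S. N i)) \<subseteq> r K - S" by (auto simp: r_def N_def)
    then have "card (r (K \<union> (\<Union>i\<in>S. N i))) \<le> card (r K - S)" using finr by (intro card_mono) auto
    also have "\<dots> = card (r K) - card S" using S finS by (intro card_Diff_subset) auto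
    finally have 1: "card (r (K \<union> (\<Union>i\<in>S. N i))) \<le> card (r K) - card S" .
    have "card (K \<union> (\<Union>i\<in>S. N i)) = card K + card (\<Union>i\<in>S. N i)"
      using finK finN by (intro card_Un_disjoint) (auto simp: N_def)
    moreover have "card S \<le> card (r K)" using S finr by (intro card_mono)
    moreover have "card K + card (r K) \<le> card (K \<union> (\<Union>i\<in>S. N i)) + card (r (K \<union> (\<Union>i\<in>S. N i)))"
      using K by (intro opt) (auto simp: N_def)
    ultimately show "card S \<le> card (\<Union>i\<in>S. N i)" using 1 by linarith
  qed
  then obtain f where f: "inj_on f (r K)" "\<forall>i\<in>r K. f i \<in> N i" by blast
  have "\<exists>g. inj_on g K \<and> (\<forall>j\<in>K. g j \<in> M j)"
  proof (rule hall_marriage[OF finK])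
    show "\<And>j. finite (M j)" using finE by (auto simp: M_def)
    fix S assume S: "S \<subseteq> K"
    have finS: "finite S" using S finK finite_subset by blast
    have finM: "finite (\<Union>j\<in>S. M j)" using finS finE by (auto simp: M_def)
    \<comment> \<open>Dually, the columns \<open>S\<close> are replaced by the uncovered rows that
      they reach.\<close>
    have "r (K - S) \<subseteq> r K \<union> (\<Union>j\<in>S. M j)" by (auto simp: r_def M_def)
    then have "card (r (K - S)) \<le> card (r K \<union> (\<Union>j\<in>S. M j))" using finr finM by (intro card_mono) auto
    also have "\<dots> \<le> card (r K) + card (\<Union>j\<in>S. M j)" by (rule card_Un_le)
    finally have "card (r (K - S)) \<le> card (r K) + card (\<Union>j\<in>S. M j)" .
    moreover have "card (K - S) = card K - card S" using S finS by (intro card_Diff_subset) auto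
    moreover have "card S \<le> card K" using S finK by (intro card_mono)
    moreover have "card K + card (r K) \<le> card (K - S) + card (r (K - S))" using K by (intro opt) auto
    ultimately show "card S \<le> card (\<Union>j\<in>S. M j)" by linarith
  qed
  then obtain g where g: "inj_on g K" "\<forall>j\<in>K. g j \<in> M j" by blast
  define A where "A = (\<lambda>i. (i, f i)) ` r K"
  define B where "B = (\<lambda>j. (g j, j)) ` K"
  have AB: "A \<inter> B = {}" using f g by (auto simp: A_def B_def N_def M_def)
  have "A \<union> B \<subseteq> Z" using f g by (auto simp: A_def B_def N_def M_def)
  moreover have "A \<union> B \<in> asg E C (cover_number Z C E)"
  proof -
    have "A \<union> B \<subseteq> E \<times> C" using f g K by (auto simp: A_def B_def N_def M_def r_def)
    moreover have "card (A \<union> B) = cover_number Z C E"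
      using AB finr finK unfolding K(2) A_def B_def
      by (subst card_Un_disjoint) (auto simp: card_image inj_on_def)
    moreover have "inj_on fst (A \<union> B)"
    proof -
      have "inj_on fst A" "inj_on fst B" using g(1) by (auto simp: A_def B_def inj_on_def)
      moreover have "fst ` A \<inter> fst ` B = {}" using g by (auto simp: A_def B_def M_def)
      ultimately show ?thesis by (auto simp: inj_on_Un)
    qed
    moreover have "inj_on snd (A \<union> B)"
    proof -
      have "inj_on snd A" "inj_on snd B" using f(1) by (auto simp: A_def B_def inj_on_def)
      moreover have "snd ` A \<inter> snd ` B = {}" using f by (auto simp: A_def B_def N_def)
      ultimately show ?thesis by (auto simp: inj_on_Un)
    qed
    ultimately show ?thesis by (simp add: asg_def)
  qed
  ultimately show ?thesis by blast
qed

lemma asg_Un: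
  assumes "A \<in> asg R C s" "B \<in> asg R' C' t" "finite A" "finite B"
    and "fst ` A \<inter> fst ` B = {}" "snd ` A \<inter> snd ` B = {}"
  shows "A \<union> B \<in> asg (R \<union> R') (C \<union> C') (s + t)"
proof -
  have "A \<inter> B = {}" using assms(5) by auto
  then show ?thesis using assms by (auto simp: asg_def card_Un_disjoint inj_on_Un)
qed

section \<open>The entering row of a generic matrix\<close>

text \<open>Almost sure properties of the random matrix. Ties between assignments that differ only
  in zeros cannot be excluded, so \<open>generic\<close> asks for agreement off \<open>Z\<close>
  only.\<close>

locale generic_matrix =
  fixes R :: "'a set" and C :: "nat set" and Z :: "('a \<times> nat) set" and X :: "'a \<times> nat \<Rightarrow> real"
  assumes finite_R: "finite R" and finite_C: "finite C" and Z_sub: "Z \<subseteq> R \<times> C"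
    and zero: "\<And>p. p \<in> Z \<Longrightarrow> X p = 0"
    and pos: "\<And>p. p \<in> R \<times> C - Z \<Longrightarrow> 0 < X p"
    and generic: "\<And>s A B. A \<in> asg R C s \<Longrightarrow> B \<in> asg R C s \<Longrightarrow> sum X A = sum X B \<Longrightarrow> A - Z = B - Z"

definition optimal :: "'a set \<Rightarrow> 'b set \<Rightarrow> ('a \<times> 'b \<Rightarrow> real) \<Rightarrow> nat \<Rightarrow> ('a \<times> 'b) set \<Rightarrow> bool" where
  "optimal R C X s A \<longleftrightarrow> A \<in> asg R C s \<and> sum X A = opt_cost R C X s"

text \<open>Row \<open>a\<close> is the row that enters when the size grows from \<open>s\<close> to \<open>s + 1\<close>.\<close>

definition enters :: "'a set \<Rightarrow> 'b set \<Rightarrow> ('a \<times> 'b) set \<Rightarrow> ('a \<times> 'b \<Rightarrow> real) \<Rightarrow> nat \<Rightarrow> 'a set \<Rightarrow> 'a \<Rightarrow> bool" where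
  "enters R C Z X s D a \<longleftrightarrow> avoidable R C X s = D \<and> a \<in> D \<and>
     (\<exists>A j. optimal R C X (s + 1) A \<and> (a,j) \<in> A \<and> j \<notin> Z `` D)"

text \<open>By Koenig's theorem, the rows missed by some maximum zero assignment of the rows
  \<open>E\<close>.\<close>

definition noncoloops :: "('a \<times> 'b) set \<Rightarrow> 'b set \<Rightarrow> 'a set \<Rightarrow> 'a set" where
  "noncoloops Z C E = {e\<in>E. cover_number Z C (E - {e}) = cover_number Z C E}"

lemma optimalD:
  assumes "optimal R C X s A"
  shows "A \<in> asg R C s" "sum X A = opt_cost R C X s" "A \<subseteq> R \<times> C" "card A = s" "inj_on fst A" "inj_on snd A"
  using assms by (auto simp: optimal_def asg_def)

lemma avoidable_optimal: "avoidable R C X s = {e\<in>R. \<exists>A. optimal R C X s A \<and> e \<notin> fst ` A}"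
  by (auto simp: avoidable_def optimal_def)

locale generic_step = generic_matrix +
  fixes s :: nat and D C0 l
  assumes s_R: "s < card R" and s_C: "s < card C" and s_nu: "cover_number Z C R \<le> s"
  defines "D \<equiv> avoidable R C X s" and "C0 \<equiv> Z `` D" and "l \<equiv> opt_cost R C X (s + 1) - opt_cost R C X s"
begin

section \<open>Structure of the optimal assignments of sizes \<open>s\<close> and
  \<open>s + 1\<close>\<close>

lemma D_sub: "D \<subseteq> R" by (auto simp: D_def avoidable_def)

lemma C0_sub: "C0 \<subseteq> C" using Z_sub by (auto simp: C0_def)

lemma fin: "finite R" "finite C" "finite D" "finite C0"
  using finite_R finite_C D_sub C0_sub finite_subset by auto

lemma nonneg: "p \<in> R \<times> C \<Longrightarrow> 0 \<le> X p"
  using zero[of p] pos[of p] by (cases "p \<in> Z") auto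

lemma l_eq: "l = opt_cost R C X (s + 1) - opt_cost R C X s" by (simp add: l_def)

text \<open>Since \<open>s + 1\<close> exceeds the rank of \<open>Z\<close>, an optimal assignment
  of that size has a nonzero entry, and dropping it leaves a cheaper one of size \<open>s\<close>.
  Strictness matters below: a column with \<open>l \<le> be j\<close> must be used.\<close>

lemma l_pos: "0 < l"
proof -
  obtain A where A: "A \<in> asg R C (s + 1)" "sum X A = opt_cost R C X (s + 1)"
    using opt_cost_attained[OF fin(1,2), of "s + 1" X] s_R s_C by auto
  note AD = asgD[OF A(1)] and finA = finite_of_asg[OF A(1) fin(1,2)]
  have "\<not> A \<subseteq> Z"
    using zero_asg_le_cover_number[OF fin(2,1) A(1), of Z] s_nu by auto
  then obtain p where p: "p \<in> A" "p \<notin> Z" by blast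
  have "A - {p} \<in> asg R C s" using AD p by (auto simp: asg_def inj_on_diff)
  then have "opt_cost R C X s \<le> sum X (A - {p})" by (rule opt_cost_le[OF fin(1,2)])
  moreover have "sum X A = X p + sum X (A - {p})" using finA p by (intro sum.remove) auto
  moreover have "0 < X p" using p AD(1) by (intro pos) auto
  ultimately show ?thesis using A(2) by (simp add: l_def)
qed

lemma exists_optimal: "t \<le> s + 1 \<Longrightarrow> \<exists>A. optimal R C X t A"
  using opt_cost_attained[OF fin(1,2), of t X] s_R s_C by (auto simp: optimal_def)

text \<open>As \<open>l\<close> is the cost increment, one dual solution is optimal at both sizes
  and complementary slackness applies to both. A column with \<open>l \<le> be j\<close> is used,
  and \<open>X (i,j) = l - al i - be j\<close>, being nonnegative, forces \<open>al i = 0\<close>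
  and \<open>X (i,j) = 0\<close>: it is matched by a zero in a row of \<open>D\<close>. Conversely,
  feasibility at a zero in \<open>D\<close> gives \<open>l \<le> be j\<close>.\<close>

lemma certificate:
  obtains al be where "\<And>i. i \<in> R \<Longrightarrow> 0 \<le> al i" "\<And>j. j \<in> C \<Longrightarrow> 0 \<le> be j"
    "\<And>i j. i \<in> R \<Longrightarrow> j \<in> C \<Longrightarrow> l - al i - be j \<le> X (i,j)"
    "real s * l - sum al R - sum be C = opt_cost R C X s"
    "\<And>i. i \<in> R \<Longrightarrow> al i = 0 \<longleftrightarrow> i \<in> D"
    "\<And>j. j \<in> C \<Longrightarrow> l \<le> be j \<longleftrightarrow> j \<in> C0"
    "\<And>t A i. t \<in> {s, s + 1} \<Longrightarrow> optimal R C X t A \<Longrightarrow> i \<in> R - D \<Longrightarrow> i \<in> fst ` A"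
    "\<And>t A j. t \<in> {s, s + 1} \<Longrightarrow> optimal R C X t A \<Longrightarrow> j \<in> C0 \<Longrightarrow> \<exists>i\<in>D. (i,j) \<in> A \<and> (i,j) \<in> Z"
proof -
  obtain al be where al: "\<And>i. i \<in> R \<Longrightarrow> 0 \<le> al i" and be: "\<And>j. j \<in> C \<Longrightarrow> 0 \<le> be j"
    and feas: "\<And>i j. i \<in> R \<Longrightarrow> j \<in> C \<Longrightarrow> l - al i - be j \<le> X (i,j)"
    and val: "real s * l - sum al R - sum be C = opt_cost R C X s"
    and D: "\<And>i. i \<in> R \<Longrightarrow> al i = 0 \<longleftrightarrow> i \<in> D"
    unfolding D_def by (rule asg_certificate[OF fin(1,2) s_R s_C l_eq]) blast
  have val1: "sum X A \<le> real t * l - sum al R - sum be C" if "t \<in> {s, s + 1}" "optimal R C X t A" for t A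
    using that val by (auto simp: optimal_def l_def algebra_simps)
  have slack: "\<And>i j. (i,j) \<in> A \<Longrightarrow> X (i,j) = l - al i - be j"
       "\<And>i. i \<in> R \<Longrightarrow> i \<notin> fst ` A \<Longrightarrow> al i = 0" "\<And>j. j \<in> C \<Longrightarrow> j \<notin> snd ` A \<Longrightarrow> be j = 0"
    if "t \<in> {s, s + 1}" "optimal R C X t A" for t A
    using asg_complementary_slackness[OF fin(1,2) _ al be feas val1[OF that]] that(2)
    by (auto simp: optimal_def)
  have rows: "i \<in> fst ` A" if "t \<in> {s, s + 1}" "optimal R C X t A" "i \<in> R - D" for t A i
    using slack(2)[OF that(1,2), of i] D[of i] that(3) by auto
  have cols: "\<exists>i\<in>D. (i,j) \<in> A \<and> (i,j) \<in> Z"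
    if t: "t \<in> {s, s + 1}" and A: "optimal R C X t A" and j: "j \<in> C" "l \<le> be j" for t A j
  proof -
    have "j \<in> snd ` A" using slack(3)[OF t A j(1)] j(2) l_pos by auto
    then obtain i where i: "(i,j) \<in> A" by auto
    have iR: "i \<in> R" using optimalD(3)[OF A] i by auto
    have "X (i,j) = l - al i - be j" using slack(1)[OF t A i] .
    moreover have "0 \<le> X (i,j)" using iR j(1) by (intro nonneg) auto
    ultimately have "al i = 0" "X (i,j) = 0" using al[OF iR] j(2) by linarith+
    then have "i \<in> D" "(i,j) \<in> Z" using D[OF iR] pos[of "(i,j)"] iR j(1) by auto
    then show ?thesis using i by blast
  qed
  have C0: "l \<le> be j \<longleftrightarrow> j \<in> C0" if j: "j \<in> C" for j
  proof
    assume "l \<le> be j"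
    obtain A where A: "optimal R C X s A" using exists_optimal[of s] by auto
    obtain i where "i \<in> D" "(i,j) \<in> Z" using cols[OF _ A j \<open>l \<le> be j\<close>] by auto
    then show "j \<in> C0" by (auto simp: C0_def)
  next
    assume "j \<in> C0"
    then obtain i where i: "i \<in> D" "(i,j) \<in> Z" by (auto simp: C0_def)
    have iR: "i \<in> R" using i D_sub by auto
    show "l \<le> be j" using feas[OF iR j] zero[OF i(2)] D[OF iR] i(1) by auto
  qed
  show ?thesis
  proof (rule that[OF al be feas val D C0 rows])
    fix t A j assume "t \<in> {s, s + 1}" "optimal R C X t A" "j \<in> C0"
    then show "\<exists>i\<in>D. (i,j) \<in> A \<and> (i,j) \<in> Z"
      using C0[of j] C0_sub by (intro cols) auto
  qed
qed

lemma optimal_rows: "t \<in> {s, s + 1} \<Longrightarrow> optimal R C X t A \<Longrightarrow> i \<in> R - D \<Longrightarrow> i \<in> fst ` A"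
  by (rule certificate) blast

lemma optimal_cols:
  "t \<in> {s, s + 1} \<Longrightarrow> optimal R C X t A \<Longrightarrow> j \<in> C0 \<Longrightarrow> \<exists>i\<in>D. (i,j) \<in> A \<and> (i,j) \<in> Z"
  by (rule certificate) blast

lemma optimal_C0:
  assumes t: "t \<in> {s, s + 1}" and A: "optimal R C X t A" and p: "p \<in> A" "snd p \<in> C0"
  shows "fst p \<in> D" "p \<in> Z"
proof -
  obtain i where i: "i \<in> D" "(i, snd p) \<in> A" "(i, snd p) \<in> Z"
    using optimal_cols[OF t A p(2)] by blast
  have "p = (i, snd p)" using inj_onD[OF optimalD(6)[OF A] _ p(1) i(2)] by simp
  then show "fst p \<in> D" "p \<in> Z" using i by (metis fst_conv)+
qed

lemma optimal_part_C0:
  assumes t: "t \<in> {s, s + 1}" and A: "optimal R C X t A"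
  shows "{p\<in>A. snd p \<in> C0} \<in> asg D C0 (card C0)" "{p\<in>A. snd p \<in> C0} \<subseteq> Z"
proof -
  have AD: "A \<subseteq> R \<times> C" "inj_on fst A" "inj_on snd A" using optimalD[OF A] by auto
  have "snd ` {p\<in>A. snd p \<in> C0} = C0" using optimal_cols[OF t A] by force
  moreover have "card (snd ` {p\<in>A. snd p \<in> C0}) = card {p\<in>A. snd p \<in> C0}"
    using AD(3) by (intro card_image) (auto simp: inj_on_def)
  moreover have "{p\<in>A. snd p \<in> C0} \<subseteq> D \<times> C0" using optimal_C0[OF t A] by force
  ultimately show "{p\<in>A. snd p \<in> C0} \<in> asg D C0 (card C0)"
    using AD by (auto simp: asg_def inj_on_def)
  show "{p\<in>A. snd p \<in> C0} \<subseteq> Z" using optimal_C0[OF t A] by auto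
qed

text \<open>Another optimal assignment misses this row, and optimal assignments share their nonzero
  part.\<close>

lemma optimal_D_row_zero:
  assumes A: "optimal R C X s A" and p: "p \<in> A" "fst p \<in> D"
  shows "p \<in> Z"
proof (rule ccontr)
  assume "p \<notin> Z"
  obtain B where B: "optimal R C X s B" "fst p \<notin> fst ` B"
    using p(2) unfolding D_def avoidable_optimal by blast
  have "A - Z = B - Z" using A B(1) by (intro generic) (auto simp: optimal_def)
  then show False using p(1) \<open>p \<notin> Z\<close> B(2) by force
qed

lemma optimal_D_rows:
  assumes A: "optimal R C X s A"
  shows "{p\<in>A. fst p \<in> D} = {p\<in>A. snd p \<in> C0}"
proof (intro equalityI subsetI)
  fix p assume p: "p \<in> {p\<in>A. fst p \<in> D}"
  then have "p \<in> Z" using optimal_D_row_zero[OF A] by simp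
  then show "p \<in> {p\<in>A. snd p \<in> C0}" using p by (cases p) (auto simp: C0_def)
next
  fix p assume "p \<in> {p\<in>A. snd p \<in> C0}"
  then show "p \<in> {p\<in>A. fst p \<in> D}" using optimal_C0(1)[OF _ A] by auto
qed

lemma card_split:
  assumes A: "optimal R C X t A" and t: "t \<in> {s, s + 1}"
  shows "t = card (R - D) + card {p\<in>A. fst p \<in> D}"
proof -
  have AD: "A \<subseteq> R \<times> C" "card A = t" "inj_on fst A" using optimalD[OF A] by auto
  have finA: "finite A" using A finite_of_asg[OF _ fin(1,2)] by (auto simp: optimal_def)
  have "fst ` {p\<in>A. fst p \<notin> D} = R - D"
    using AD(1) optimal_rows[OF t A] by force
  moreover have "card (fst ` {p\<in>A. fst p \<notin> D}) = card {p\<in>A. fst p \<notin> D}"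
    using AD(3) by (intro card_image) (auto simp: inj_on_def)
  moreover have "A = {p\<in>A. fst p \<notin> D} \<union> {p\<in>A. fst p \<in> D}" by auto
  then have "card A = card {p\<in>A. fst p \<notin> D} + card {p\<in>A. fst p \<in> D}"
    using finA by (subst card_Un_disjoint[symmetric]) auto
  ultimately show ?thesis using AD(2) by simp
qed

text \<open>All rows outside \<open>D\<close> are used, and the rows of \<open>D\<close> in use are
  those matched to \<open>C0\<close>, whose columns are all used.\<close>

lemma s_eq: "s = card (R - D) + card C0"
proof -
  obtain A where A: "optimal R C X s A" using exists_optimal[of s] by auto
  have "card {p\<in>A. snd p \<in> C0} = card C0" using optimal_part_C0(1)[OF _ A] asgD(2) by blast
  then show ?thesis using card_split[OF A] optimal_D_rows[OF A] by simp
qed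

text \<open>Counting as in \<open>s_eq\<close>: at size \<open>s + 1\<close> the rows outside
  \<open>D\<close> and the columns \<open>C0\<close> are again all used, so just one further pair
  remains.\<close>

lemma optimal_Suc_split:
  assumes A: "optimal R C X (s + 1) A"
  obtains a j where "a \<in> D" "j \<in> C - C0" "(a,j) \<in> A" "{p\<in>A. fst p \<in> D} = insert (a,j) {p\<in>A. snd p \<in> C0}"
proof -
  have AR: "A \<subseteq> R \<times> C" using optimalD[OF A] by auto
  have finA: "finite A" using A finite_of_asg[OF _ fin(1,2)] by (auto simp: optimal_def)
  have sub: "{p\<in>A. snd p \<in> C0} \<subseteq> {p\<in>A. fst p \<in> D}" using optimal_C0[OF _ A] by auto
  have "card {p\<in>A. fst p \<in> D} = card C0 + 1" using card_split[OF A] s_eq by simp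
  moreover have "card {p\<in>A. snd p \<in> C0} = card C0" using optimal_part_C0(1)[OF _ A] asgD(2) by blast
  ultimately have "card ({p\<in>A. fst p \<in> D} - {p\<in>A. snd p \<in> C0}) = 1"
    using sub finA by (subst card_Diff_subset) auto
  then obtain p where p: "{p\<in>A. fst p \<in> D} - {p\<in>A. snd p \<in> C0} = {p}" by (auto simp: card_1_singleton_iff)
  then have "p \<in> A" "fst p \<in> D" "snd p \<notin> C0" by auto
  moreover have "{p\<in>A. fst p \<in> D} = insert p {p\<in>A. snd p \<in> C0}" using p sub by auto
  ultimately show ?thesis using that[of "fst p" "snd p"] AR by auto
qed

lemma optimal_Suc_D_rows:
  assumes A: "optimal R C X (s + 1) A" and aj: "(a,j) \<in> A" "a \<in> D" "j \<notin> C0"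
  shows "{p\<in>A. fst p \<in> D} = insert (a,j) {p\<in>A. snd p \<in> C0}"
proof -
  obtain b i where "b \<in> D" "i \<in> C - C0" "(b,i) \<in> A"
    and b: "{p\<in>A. fst p \<in> D} = insert (b,i) {p\<in>A. snd p \<in> C0}"
    by (rule optimal_Suc_split[OF A])
  have "(a,j) \<in> {p\<in>A. fst p \<in> D}" using aj by simp
  then have "(a,j) = (b,i)" unfolding b using aj(3) by simp
  then show ?thesis using b by simp
qed

text \<open>The \<open>C0\<close> part of an optimal \<open>s\<close>-assignment that avoids
  \<open>a\<close>. It shows that no row of \<open>D\<close> is a coloop of
  \<open>D\<close>.\<close>

lemma zero_asg_avoiding:
  assumes "a \<in> D"
  shows "\<exists>B\<in>asg (D - {a}) C0 (card C0). B \<subseteq> Z"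
proof -
  obtain A where A: "optimal R C X s A" "a \<notin> fst ` A"
    using assms unfolding D_def avoidable_optimal by blast
  have "{p\<in>A. snd p \<in> C0} \<in> asg (D - {a}) C0 (card C0)"
    using optimal_part_C0(1)[OF _ A(1)] A(2) by (force simp: asg_def)
  then show ?thesis using optimal_part_C0(2)[OF _ A(1)] by blast
qed

lemma cover_number_D_le:
  assumes "E \<subseteq> D"
  shows "cover_number Z C E \<le> card C0"
proof -
  have e: "{i\<in>E. \<exists>j\<in>C - C0. (i,j) \<in> Z} = {}" using assms by (auto simp: C0_def)
  show ?thesis using cover_number_le[OF fin(2) C0_sub, of Z E] unfolding e by simp
qed

lemma cover_number_D_ge:
  assumes "E \<subseteq> D" "B \<in> asg E C0 (card C0)" "B \<subseteq> Z"
  shows "cover_number Z C E = card C0"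
proof -
  have "finite E" using assms fin finite_subset by auto
  moreover have "B \<in> asg E C (card C0)" using assms(2) asg_mono[of E E C0 C] C0_sub by blast
  ultimately have "card C0 \<le> cover_number Z C E" using assms(3) fin by (intro zero_asg_le_cover_number) auto
  then show ?thesis using cover_number_D_le[OF assms(1)] by simp
qed

lemma cover_number_D:
  assumes "a \<in> D"
  shows "cover_number Z C (D - {a}) = card C0" "cover_number Z C D = card C0"
proof -
  show 1: "cover_number Z C (D - {a}) = card C0"
    using zero_asg_avoiding[OF assms] cover_number_D_ge[of "D - {a}"] by blast
  show "cover_number Z C D = card C0"
    using cover_number_mono[OF fin(2,3), of "D - {a}" Z] cover_number_D_le[of D] 1 by auto
qed

text \<open>Within \<open>D\<close> an optimal assignment of size \<open>s + 1\<close> is one pair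
  \<open>(a,j)\<close> and a zero assignment filling \<open>C0\<close>, and both may be exchanged at
  equal cost. With \<open>X' = X\<close> and \<open>b = a\<close> this frees rows other than
  \<open>a\<close>; with the swapped matrix as \<open>X'\<close> it makes \<open>b\<close> the
  entering row.\<close>

lemma replace_zero_part:
  assumes A: "optimal R C X (s + 1) A" and aj: "(a,j) \<in> A" "a \<in> D" "j \<notin> C0"
    and split: "{p\<in>A. fst p \<in> D} = insert (a,j) {p\<in>A. snd p \<in> C0}"
    and b: "b \<in> D" and B: "B \<in> asg (D - {b}) C0 (card C0)" "B \<subseteq> Z"
    and same: "\<And>p. p \<in> A \<Longrightarrow> fst p \<notin> D \<Longrightarrow> X' p = X p" "X' (b,j) = X (a,j)" "\<And>p. p \<in> Z \<Longrightarrow> X' p = 0"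
  shows "insert (b,j) ({p\<in>A. fst p \<notin> D} \<union> B) \<in> asg R C (s + 1)"
    and "sum X' (insert (b,j) ({p\<in>A. fst p \<notin> D} \<union> B)) = opt_cost R C X (s + 1)"
proof -
  have AD: "A \<in> asg R C (s + 1)" "sum X A = opt_cost R C X (s + 1)" using A by (auto simp: optimal_def)
  note AR = asgD[OF AD(1)] and BR = asgD[OF B(1)]
  have finA: "finite A" using finite_of_asg[OF AD(1) fin(1,2)] .
  have finB: "finite B" using finite_of_asg[OF B(1)] fin by simp
  define U where "U = {p\<in>A. fst p \<notin> D}"
  \<comment> \<open>The part of \<open>A\<close> outside \<open>D\<close> uses no column of
    \<open>C0\<close>, so it cannot collide with the new zeros.\<close>
  have U: "U \<in> asg (R - D) (C - C0) (card (R - D))"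
  proof -
    have "U \<subseteq> (R - D) \<times> (C - C0)" using AR(1) optimal_C0(1)[OF _ A] by (fastforce simp: U_def)
    moreover have "card U + card {p\<in>A. fst p \<in> D} = s + 1"
    proof -
      have "A = U \<union> {p\<in>A. fst p \<in> D}" by (auto simp: U_def)
      then have "card A = card U + card {p\<in>A. fst p \<in> D}"
        using finA by (subst card_Un_disjoint[symmetric]) (auto simp: U_def)
      then show ?thesis using AR(2) by simp
    qed
    then have "card U = card (R - D)" using card_split[OF A] by simp
    ultimately show ?thesis using AR by (auto simp: asg_def U_def inj_on_def)
  qed
  note UR = asgD[OF U]
  have j: "j \<in> C" "j \<notin> snd ` U"
    using AR(1) inj_onD[OF AR(4) _ aj(1)] aj(1,2) by (auto simp: U_def)
  have UB: "U \<union> B \<in> asg ((R - D) \<union> (D - {b})) ((C - C0) \<union> C0) (card (R - D) + card C0)"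
    using UR(1) BR(1) by (intro asg_Un U B finB finite_subset[OF _ finA]) (auto simp: U_def)
  have bUB: "b \<notin> fst ` (U \<union> B)" "j \<notin> snd ` (U \<union> B)" using UR(1) BR(1) b aj j by auto
  have "{(b,j)} \<union> (U \<union> B) \<in> asg ({b} \<union> ((R - D) \<union> (D - {b}))) ({j} \<union> ((C - C0) \<union> C0)) (1 + (card (R - D) + card C0))"
    using bUB finA finB by (intro asg_Un UB) (auto simp: asg_def U_def)
  moreover have "{b} \<union> ((R - D) \<union> (D - {b})) = R" "{j} \<union> ((C - C0) \<union> C0) = C"
    using b D_sub j C0_sub by auto
  ultimately show "insert (b,j) ({p\<in>A. fst p \<notin> D} \<union> B) \<in> asg R C (s + 1)" using s_eq by (simp add: U_def)
  have "sum X' (insert (b,j) (U \<union> B)) = X' (b,j) + sum X' (U \<union> B)"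
  proof (rule sum.insert)
    show "finite (U \<union> B)" using finA finB by (simp add: U_def)
    show "(b,j) \<notin> U \<union> B" using bUB(1) by (metis fst_conv image_eqI)
  qed
  also have "sum X' (U \<union> B) = sum X' U + sum X' B"
  proof (rule sum.union_disjoint)
    show "finite U" "finite B" using finA finB by (simp_all add: U_def)
    show "U \<inter> B = {}" using BR(1) by (auto simp: U_def)
  qed
  also have "sum X' B = 0" using B(2) same(3) by (intro sum.neutral) auto
  also have "sum X' U = sum X U" using same(1) by (intro sum.cong) (auto simp: U_def)
  finally have 1: "sum X' (insert (b,j) (U \<union> B)) = X (a,j) + sum X U" using same(2) by simp
  have UA: "U \<union> {p\<in>A. fst p \<in> D} = A" by (auto simp: U_def)
  have "sum X (U \<union> {p\<in>A. fst p \<in> D}) = sum X U + sum X {p\<in>A. fst p \<in> D}"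
    using finA by (intro sum.union_disjoint) (auto simp: U_def)
  then have "sum X A = sum X U + sum X {p\<in>A. fst p \<in> D}" unfolding UA .
  then have "sum X A = sum X U + sum X (insert (a,j) {p\<in>A. snd p \<in> C0})" unfolding split .
  also have "sum X (insert (a,j) {p\<in>A. snd p \<in> C0}) = X (a,j) + sum X {p\<in>A. snd p \<in> C0}"
    using aj finA by (intro sum.insert) auto
  also have "sum X {p\<in>A. snd p \<in> C0} = 0"
    using optimal_part_C0(2)[OF _ A] zero by (intro sum.neutral) auto
  finally show "sum X' (insert (b,j) ({p\<in>A. fst p \<notin> D} \<union> B)) = opt_cost R C X (s + 1)"
    using 1 AD(2) by (simp add: U_def)
qed

lemma optimal_Suc_nonzero:
  assumes "optimal R C X (s + 1) A" "optimal R C X (s + 1) A'" "(a,j) \<in> A" "a \<in> D" "j \<notin> C0"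
  shows "(a,j) \<in> A'"
proof -
  have "A - Z = A' - Z" using optimalD(1,2)[OF assms(1)] optimalD(1,2)[OF assms(2)] generic by metis
  moreover have "(a,j) \<notin> Z" using assms(4,5) by (auto simp: C0_def)
  ultimately show ?thesis using assms(3) by blast
qed

text \<open>The leftover pair is not in \<open>Z\<close>, because the zeros of \<open>D\<close> lie
  in \<open>C0\<close>; hence it is common to all optimal assignments of size
  \<open>s + 1\<close>.\<close>

lemma enters_unique: "\<exists>!a. enters R C Z X s D a"
proof -
  obtain A where A: "optimal R C X (s + 1) A" using exists_optimal[of "s + 1"] by auto
  obtain a j where aj: "a \<in> D" "j \<in> C - C0" "(a,j) \<in> A" by (rule optimal_Suc_split[OF A])
  show ?thesis
  proof
    show "enters R C Z X s D a" using A aj unfolding enters_def D_def[symmetric] C0_def[symmetric] by blast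
    fix a' assume "enters R C Z X s D a'"
    then obtain A' j' where A': "optimal R C X (s + 1) A'" "(a',j') \<in> A'" "j' \<notin> C0" "a' \<in> D"
      by (auto simp: enters_def C0_def)
    have "(a',j') \<in> A" using optimal_Suc_nonzero[OF A'(1) A A'(2,4,3)] .
    then have "(a',j') \<in> {p\<in>A. fst p \<in> D}" using A'(4) by simp
    then have "(a',j') \<in> insert (a,j) {p\<in>A. snd p \<in> C0}"
      using optimal_Suc_D_rows[OF A aj(3,1)] aj(2) by blast
    then show "a' = a" using A'(3) by simp
  qed
qed

text \<open>At size \<open>s + 1\<close> row \<open>a\<close> and the rows outside \<open>D\<close>
  are always used, and the other rows of \<open>D\<close> only serve to fill \<open>C0\<close> with
  zeros. So \<open>e\<close> can be spared exactly if \<open>D - {a} - {e}\<close> still has rank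
  \<open>card C0\<close>.\<close>

lemma avoidable_Suc:
  assumes "enters R C Z X s D a"
  shows "avoidable R C X (s + 1) = noncoloops Z C (D - {a})"
proof -
  obtain A j where A: "optimal R C X (s + 1) A" and aj: "(a,j) \<in> A" "j \<notin> C0" "a \<in> D"
    using assms by (auto simp: enters_def C0_def)
  have splitA: "{p\<in>A'. fst p \<in> D} = insert (a,j) {p\<in>A'. snd p \<in> C0}" "(a,j) \<in> A'"
    if A': "optimal R C X (s + 1) A'" for A'
  proof -
    show "(a,j) \<in> A'" using optimal_Suc_nonzero[OF A A' aj(1,3,2)] .
    then show "{p\<in>A'. fst p \<in> D} = insert (a,j) {p\<in>A'. snd p \<in> C0}"
      using optimal_Suc_D_rows[OF A' _ aj(3,2)] by simp
  qed
  have nu: "cover_number Z C (D - {a}) = card C0" using cover_number_D(1)[OF aj(3)] .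
  show ?thesis
  proof (intro equalityI subsetI)
    fix e assume "e \<in> avoidable R C X (s + 1)"
    then obtain A' where A': "optimal R C X (s + 1) A'" "e \<notin> fst ` A'" "e \<in> R"
      by (auto simp: avoidable_optimal)
    have e: "e \<in> D" using optimal_rows[OF _ A'(1), of e] A' by blast
    have "e \<noteq> a" using splitA(2)[OF A'(1)] A'(2) by force
    have "{p\<in>A'. snd p \<in> C0} \<in> asg (D - {a} - {e}) C0 (card C0)"
    proof -
      have P: "{p\<in>A'. snd p \<in> C0} \<in> asg D C0 (card C0)" using optimal_part_C0(1)[OF _ A'(1)] by blast
      have "inj_on fst A'" using optimalD(5)[OF A'(1)] .
      then have "fst p \<noteq> a" if "p \<in> A'" "snd p \<in> C0" for p
        using inj_onD[OF \<open>inj_on fst A'\<close> _ that(1) splitA(2)[OF A'(1)]] aj(2) that(2) by (cases p) auto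
      then show ?thesis using P A'(2) by (force simp: asg_def)
    qed
    then have "cover_number Z C (D - {a} - {e}) = card C0"
      by (rule cover_number_D_ge[rotated]) (use optimal_part_C0(2)[OF _ A'(1)] in auto)
    then show "e \<in> noncoloops Z C (D - {a})" using e \<open>e \<noteq> a\<close> nu by (simp add: noncoloops_def)
  next
    fix e assume "e \<in> noncoloops Z C (D - {a})"
    then have e: "e \<in> D" "e \<noteq> a" "cover_number Z C (D - {a} - {e}) = card C0" using nu by (auto simp: noncoloops_def)
    obtain B where B: "B \<in> asg (D - {a} - {e}) C (card C0)" "B \<subseteq> Z"
      using zero_asg_of_cover_number[OF fin(2), of "D - {a} - {e}" Z] e(3) fin by auto
    have B': "B \<in> asg (D - {a}) C0 (card C0)" using B by (force simp: asg_def C0_def)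
    let ?A = "insert (a,j) ({p\<in>A. fst p \<notin> D} \<union> B)"
    have "?A \<in> asg R C (s + 1)" "sum X ?A = opt_cost R C X (s + 1)"
      using replace_zero_part[where X' = X, OF A aj(1,3,2) splitA(1)[OF A] aj(3) B' B(2)] zero by blast+
    moreover have "e \<notin> fst ` ?A" using e asgD(1)[OF B(1)] by auto
    ultimately show "e \<in> avoidable R C X (s + 1)" using e D_sub unfolding avoidable_def by blast
  qed
qed

text \<open>Outside the columns of \<open>C0\<close> the certificate treats all rows of \<open>D\<close> alike, so permuting them
  there keeps it valid.\<close>

lemma enters_swap:
  assumes a: "enters R C Z X s D a" and b: "b \<in> D"
    and X': "\<And>i j. i \<in> R \<Longrightarrow> j \<in> C \<Longrightarrow> X' (i,j) = (if j \<in> C0 then X (i,j) else X (Transposition.transpose a b i, j))"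
  shows "enters R C Z X' s D b"
proof -
  obtain al be where al: "\<And>i. i \<in> R \<Longrightarrow> 0 \<le> al i" and be: "\<And>j. j \<in> C \<Longrightarrow> 0 \<le> be j"
    and feas: "\<And>i j. i \<in> R \<Longrightarrow> j \<in> C \<Longrightarrow> l - al i - be j \<le> X (i,j)"
    and val: "real s * l - sum al R - sum be C = opt_cost R C X s"
    and D: "\<And>i. i \<in> R \<Longrightarrow> al i = 0 \<longleftrightarrow> i \<in> D"
    by (rule certificate) blast
  obtain A j where A: "optimal R C X (s + 1) A" and aj: "(a,j) \<in> A" "j \<notin> C0" "a \<in> D"
    using a by (auto simp: enters_def C0_def)
  have jC: "j \<in> C" using optimalD(3)[OF A] aj by auto
  have ab: "a \<in> R" "b \<in> R" using aj b D_sub by auto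
  have same: "X' (i,j) = X (i,j)" if "i \<in> R" "j \<in> C" "i \<in> D \<Longrightarrow> j \<in> C0" for i j
    using X'[OF that(1,2)] that aj b by (auto simp: Transposition.transpose_def)
  \<comment> \<open>Feasibility survives because \<open>al\<close> vanishes at both \<open>a\<close>
    and \<open>b\<close>.\<close>
  have feas': "l - al i - be j \<le> X' (i,j)" if "i \<in> R" "j \<in> C" for i j
  proof (cases "j \<in> C0")
    case False
    have "al a = 0" "al b = 0" using D ab aj b by auto
    then have "al (Transposition.transpose a b i) = al i" by (auto simp: Transposition.transpose_def)
    moreover have "Transposition.transpose a b i \<in> R" using ab that by (auto simp: Transposition.transpose_def)
    ultimately show ?thesis using feas[of "Transposition.transpose a b i" j] X'[OF that] that False by auto
  qed (use feas[OF that] X'[OF that] in auto)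
  have weak: "real t * l - sum al R - sum be C \<le> opt_cost R C X' t" if t: "t \<in> {s, s + 1}" for t
  proof -
    obtain B where B: "B \<in> asg R C t" "sum X' B = opt_cost R C X' t"
      using opt_cost_attained[OF fin(1,2), of t X'] s_R s_C t by auto
    show ?thesis using asg_weak_duality[OF fin(1,2) B(1), of al be l X'] al be feas' B(2) by auto
  qed
  \<comment> \<open>Optimal \<open>s\<close>-assignments for \<open>X\<close> meet the rows of
    \<open>D\<close> only in \<open>C0\<close>, where \<open>X'\<close> and \<open>X\<close>
    agree.\<close>
  have sum': "sum X' B = opt_cost R C X s" if "optimal R C X s B" for B
  proof -
    have "sum X' B = sum X B"
    proof (rule sum.cong)
      fix p assume p: "p \<in> B"
      have "fst p \<in> D \<Longrightarrow> snd p \<in> C0" using optimal_D_rows[OF that] p by blast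
      then show "X' p = X p" using same[of "fst p" "snd p"] optimalD(3)[OF that] p by auto
    qed simp
    then show ?thesis using optimalD(2)[OF that] by simp
  qed
  obtain B0 where "optimal R C X s B0" using exists_optimal[of s] by auto
  then have mcs: "opt_cost R C X' s = opt_cost R C X s"
    using opt_cost_le[OF fin(1,2), of B0 s X'] sum'[of B0] weak[of s] val by (simp add: optimal_def)
  have opt': "optimal R C X' s B" if "optimal R C X s B" for B
    using that sum'[OF that] mcs by (simp add: optimal_def)
  have "avoidable R C X' s = D"
  proof (intro equalityI subsetI)
    fix e assume "e \<in> D"
    then show "e \<in> avoidable R C X' s" using opt' unfolding D_def avoidable_optimal by blast
  next
    fix e assume "e \<in> avoidable R C X' s"
    then obtain B where B: "B \<in> asg R C s" "sum X' B = opt_cost R C X' s" "e \<notin> fst ` B" "e \<in> R"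
      by (auto simp: avoidable_def)
    \<comment> \<open>Here the positivity of \<open>al\<close> off \<open>D\<close> is decisive: no
      new avoidable row can arise.\<close>
    have "al e = 0"
      by (rule asg_complementary_slackness(2)[OF fin(1,2) B(1) al be _ _ B(4,3), where l = l and X = X'])
         (use B(2) mcs val feas' in auto)
    then show "e \<in> D" using D[OF B(4)] by simp
  qed
  moreover have "\<exists>A j. optimal R C X' (s + 1) A \<and> (b,j) \<in> A \<and> j \<notin> Z `` D"
  proof -
    \<comment> \<open>A zero assignment that leaves \<open>b\<close> free for the pair
      \<open>(b,j)\<close>, whose entry in \<open>X'\<close> is the former
      \<open>X (a,j)\<close>.\<close>
    obtain B where B: "B \<in> asg (D - {b}) C0 (card C0)" "B \<subseteq> Z" using zero_asg_avoiding[OF b] by blast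
    note split = optimal_Suc_D_rows[OF A aj(1,3,2)]
    have z: "X' p = 0" if "p \<in> Z" for p
      using same[of "fst p" "snd p"] zero[OF that] that Z_sub by (force simp: C0_def)
    have u: "X' p = X p" if "p \<in> A" "fst p \<notin> D" for p
      using same[of "fst p" "snd p"] that optimalD(3)[OF A] by auto
    have "X' (b,j) = X (a,j)" using X'[OF ab(2) jC] aj by (simp)
    note rep = replace_zero_part[where X' = X', OF A aj(1,3,2) split b B u this z]
    let ?A = "insert (b,j) ({p\<in>A. fst p \<notin> D} \<union> B)"
    have "opt_cost R C X' (s + 1) \<le> opt_cost R C X (s + 1)" using opt_cost_le[OF fin(1,2) rep(1), of X'] rep(2) by simp
    moreover have "opt_cost R C X (s + 1) \<le> opt_cost R C X' (s + 1)" using weak[of "s + 1"] val by (simp add: l_def algebra_simps)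
    ultimately have "optimal R C X' (s + 1) ?A" using rep by (simp add: optimal_def)
    then show ?thesis using aj(2) unfolding C0_def by blast
  qed
  ultimately show ?thesis using b by (simp add: enters_def)
qed

end

section \<open>Cover coefficients\<close>

text \<open>Meant as the probability that row \<open>m\<close> is used at size \<open>k\<close> on
  the rows \<open>E\<close>, by conditioning on a uniform first row \<open>a\<close>: if
  \<open>a = m\<close>, the row is used provided the size exceeds the rank; otherwise
  \<open>a\<close> is removed and one unit of size is spent. That \<open>a\<close> ranges over
  coloops too is justified by \<open>row_prob_coloop\<close>.\<close>

primrec row_prob :: "('a \<times> 'b) set \<Rightarrow> 'b set \<Rightarrow> 'a \<Rightarrow> nat \<Rightarrow> 'a set \<Rightarrow> real" where
  "row_prob Z C m 0 E = 0"
| "row_prob Z C m (Suc k) E =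
    (of_bool (cover_number Z C E \<le> k) + (\<Sum>a\<in>E - {m}. row_prob Z C m k (E - {a}))) / real (card E)"

lemma cover_number_delete_le: "finite C \<Longrightarrow> finite E \<Longrightarrow> cover_number Z C E \<le> cover_number Z C (E - {a}) + 1"
  using cover_number_insert_le[of C "E - {a}" Z a] cover_number_mono[of C "insert a (E - {a})" E Z]
  by (cases "a \<in> E") (auto simp: insert_absorb)

lemma row_prob_eq_0:
  assumes "finite C" "finite E" "k \<le> cover_number Z C E"
  shows "row_prob Z C m k E = 0"
  using assms
proof (induction k arbitrary: E)
  case (Suc k)
  have "row_prob Z C m k (E - {a}) = 0" for a
    using Suc.prems cover_number_delete_le[OF Suc.prems(1,2), of Z a] by (intro Suc.IH) auto
  then show ?case using Suc.prems by simp
qed simp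

text \<open>Submodularity for \<open>E - {a}\<close> and \<open>E - {c}\<close>: deleting another
  row cannot end the coloop property.\<close>

lemma coloop_delete:
  assumes "finite C" "finite E" "c \<in> E" "a \<noteq> c" "cover_number Z C E = cover_number Z C (E - {c}) + 1"
  shows "cover_number Z C (E - {a}) = cover_number Z C (E - {a} - {c}) + 1"
proof (cases "a \<in> E")
  case True
  have "(E - {a}) \<union> (E - {c}) = E" "(E - {a}) \<inter> (E - {c}) = E - {a} - {c}" using assms(4) by auto
  then have "cover_number Z C E + cover_number Z C (E - {a} - {c}) \<le> cover_number Z C (E - {a}) + cover_number Z C (E - {c})"
    using cover_number_submodular[of C "E - {a}" "E - {c}" Z] assms by simp
  then show ?thesis using cover_number_delete_le[of C "E - {a}" Z c] assms by simp
qed (use assms in simp)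

text \<open>A coloop only takes away one unit of size. In the recursion the term
  \<open>a = c\<close> is the claimed value \<open>r\<close>; by induction the other terms and the
  indicator add up to \<open>r * (card E - 1)\<close>, so the average is \<open>r\<close>.\<close>

lemma row_prob_coloop:
  assumes "finite C" "finite E" "m \<in> E" "c \<in> E" "c \<noteq> m"
    and "cover_number Z C E = cover_number Z C (E - {c}) + 1"
  shows "row_prob Z C m (Suc k) E = row_prob Z C m k (E - {c})"
  using assms(2-)
proof (induction k arbitrary: E)
  case 0
  then show ?case by simp
next
  case (Suc k)
  define N where "N = card (E - {c})"
  have "m \<in> E - {c}" using Suc.prems by auto
  then have N: "card E = Suc N" "N > 0"
    using Suc.prems card_Suc_Diff1[of E c] by (auto simp: N_def card_gt_0_iff simp del: card_Diff_insert)
  define r where "r = row_prob Z C m (Suc k) (E - {c})"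
  have eq: "row_prob Z C m (Suc k) (E - {a}) = row_prob Z C m k (E - {c} - {a})" if a: "a \<in> E - {m} - {c}" for a
  proof -
    have "row_prob Z C m (Suc k) (E - {a}) = row_prob Z C m k (E - {a} - {c})"
      using a Suc.prems coloop_delete[OF assms(1) Suc.prems(1,3) _ Suc.prems(5), of a] by (intro Suc.IH) auto
    moreover have "E - {a} - {c} = E - {c} - {a}" by auto
    ultimately show ?thesis by simp
  qed
  have "(\<Sum>a\<in>E - {m}. row_prob Z C m (Suc k) (E - {a})) =
      r + (\<Sum>a\<in>E - {m} - {c}. row_prob Z C m (Suc k) (E - {a}))"
    using Suc.prems unfolding r_def by (intro sum.remove) auto
  also have "(\<Sum>a\<in>E - {m} - {c}. row_prob Z C m (Suc k) (E - {a})) =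
      (\<Sum>a\<in>E - {c} - {m}. row_prob Z C m k (E - {c} - {a}))"
    using eq by (intro sum.cong) auto
  finally have s: "(\<Sum>a\<in>E - {m}. row_prob Z C m (Suc k) (E - {a})) =
      r + (\<Sum>a\<in>E - {c} - {m}. row_prob Z C m k (E - {c} - {a}))" .
  have r: "r * real N = of_bool (cover_number Z C (E - {c}) \<le> k) + (\<Sum>a\<in>E - {c} - {m}. row_prob Z C m k (E - {c} - {a}))"
    using N by (simp add: r_def N_def)
  have "row_prob Z C m (Suc (Suc k)) E = (of_bool (cover_number Z C E \<le> Suc k) +
      (\<Sum>a\<in>E - {m}. row_prob Z C m (Suc k) (E - {a}))) / real (card E)"
    by (rule row_prob.simps(2))
  also have "of_bool (cover_number Z C E \<le> Suc k) = (of_bool (cover_number Z C (E - {c}) \<le> k) :: real)"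
    using Suc.prems by simp
  also have "of_bool (cover_number Z C (E - {c}) \<le> k) + (\<Sum>a\<in>E - {m}. row_prob Z C m (Suc k) (E - {a})) = r * real N + r"
    unfolding s r by (simp only: ac_simps)
  finally have "row_prob Z C m (Suc (Suc k)) E = (r * real N + r) / real (card E)" .
  also have "\<dots> = r" using N by (simp add: field_simps)
  finally show ?case by (simp add: r_def)
qed

lemma row_prob_coloops:
  assumes "finite C" "finite E" "m \<in> E" "finite Q" "Q \<subseteq> E - {m}"
    and "\<And>c. c \<in> Q \<Longrightarrow> cover_number Z C E = cover_number Z C (E - {c}) + 1"
  shows "row_prob Z C m (card Q + k) E = row_prob Z C m k (E - Q) \<and>
    cover_number Z C E = cover_number Z C (E - Q) + card Q"
  using assms(4,2,3,5,6)
proof (induction Q arbitrary: E rule: finite_induct)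
  case (insert c Q)
  have "cover_number Z C (E - {c}) = cover_number Z C (E - {c} - {q}) + 1" if "q \<in> Q" for q
    using insert.prems(1,3,4) insert.hyps(2) that by (intro coloop_delete assms(1)) auto
  then have "row_prob Z C m (card Q + k) (E - {c}) = row_prob Z C m k (E - {c} - Q) \<and>
      cover_number Z C (E - {c}) = cover_number Z C (E - {c} - Q) + card Q"
    using insert.prems(1-3) insert.hyps(2) by (intro insert.IH) auto
  moreover have "row_prob Z C m (Suc (card Q + k)) E = row_prob Z C m (card Q + k) (E - {c})"
    using insert.prems by (intro row_prob_coloop assms(1)) auto
  moreover have "E - insert c Q = E - {c} - Q" by auto
  ultimately show ?case using insert.prems(4)[of c] insert.hyps by (simp del: row_prob.simps)
qed simp

text \<open>Removing coloops one at a time lowers rank and size together. This lets the recursion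
  run over plain deletions \<open>D - {a}\<close>, although the avoidable set loses the coloops as
  well.\<close>

lemma row_prob_noncoloops:
  assumes "finite C" "finite E" "m \<in> noncoloops Z C E"
  shows "row_prob Z C m (cover_number Z C E + k) E =
    row_prob Z C m (cover_number Z C (noncoloops Z C E) + k) (noncoloops Z C E)"
proof -
  define Q where "Q = E - noncoloops Z C E"
  have Q: "E - Q = noncoloops Z C E" "m \<in> E" "finite Q" "Q \<subseteq> E - {m}"
    using assms by (auto simp: Q_def noncoloops_def)
  have "cover_number Z C E = cover_number Z C (E - {c}) + 1" if "c \<in> Q" for c
    using that cover_number_delete_le[OF assms(1,2), of Z c] cover_number_mono[OF assms(1,2), of "E - {c}" Z]
    by (auto simp: Q_def noncoloops_def)
  note R = row_prob_coloops[OF assms(1,2) Q(2,3,4) this]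
  show ?thesis using R[of "cover_number Z C (E - Q) + k"] Q(1) by (simp add: ac_simps)
qed

section \<open>Sums over sets of rows, and counting of partial covers\<close>

lemma sum_Pow_insert:
  fixes h :: "'a set \<Rightarrow> real"
  assumes "finite S"
  shows "(\<Sum>a\<in>S. \<Sum>R\<in>Pow (S - {a}). h (insert a R)) = (\<Sum>R\<in>Pow S. real (card R) * h R)"
proof -
  have eq: "(\<Sum>R\<in>Pow (S - {a}). h (insert a R)) = (\<Sum>R\<in>Pow S. if a \<in> R then h R else 0)" if "a \<in> S" for a
  proof -
    have "bij_betw (insert a) (Pow (S - {a})) {R\<in>Pow S. a \<in> R}"
      by (rule bij_betwI[where g = "\<lambda>R. R - {a}"]) (use that in auto)
    then have "(\<Sum>R\<in>Pow (S - {a}). h (insert a R)) = (\<Sum>R\<in>{R\<in>Pow S. a \<in> R}. h R)"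
      by (rule sum.reindex_bij_betw)
    also have "\<dots> = (\<Sum>R\<in>Pow S. if a \<in> R then h R else 0)" using assms by (intro sum.inter_filter) auto
    finally show ?thesis .
  qed
  have "(\<Sum>a\<in>S. \<Sum>R\<in>Pow (S - {a}). h (insert a R)) = (\<Sum>a\<in>S. \<Sum>R\<in>Pow S. if a \<in> R then h R else 0)"
    by (intro sum.cong refl eq)
  also have "\<dots> = (\<Sum>R\<in>Pow S. \<Sum>a\<in>S. if a \<in> R then h R else 0)" by (rule sum.swap)
  also have "\<dots> = (\<Sum>R\<in>Pow S. real (card R) * h R)"
    using assms by (intro sum.cong) (auto simp: sum.If_cases Int_absorb1)
  finally show ?thesis .
qed

lemma sum_Pow_delete:
  fixes h :: "'a set \<Rightarrow> real"
  assumes "finite S"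
  shows "(\<Sum>a\<in>S. \<Sum>R\<in>Pow (S - {a}). h R) = (\<Sum>R\<in>Pow S. (real (card S) - real (card R)) * h R)"
proof -
  have eq: "(\<Sum>R\<in>Pow (S - {a}). h R) = (\<Sum>R\<in>Pow S. if a \<in> R then 0 else h R)" for a
  proof -
    have "Pow (S - {a}) = {R\<in>Pow S. a \<notin> R}" by auto
    then have "(\<Sum>R\<in>Pow (S - {a}). h R) = (\<Sum>R\<in>{R\<in>Pow S. a \<notin> R}. h R)" by simp
    also have "\<dots> = (\<Sum>R\<in>Pow S. if a \<notin> R then h R else 0)" using assms by (intro sum.inter_filter) auto
    also have "\<dots> = (\<Sum>R\<in>Pow S. if a \<in> R then 0 else h R)" by (intro sum.cong) auto
    finally show ?thesis .
  qed
  have "(\<Sum>a\<in>S. \<Sum>R\<in>Pow (S - {a}). h R) = (\<Sum>a\<in>S. \<Sum>R\<in>Pow S. if a \<in> R then 0 else h R)"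
    by (intro sum.cong refl eq)
  also have "\<dots> = (\<Sum>R\<in>Pow S. \<Sum>a\<in>S. if a \<in> R then 0 else h R)" by (rule sum.swap)
  also have "\<dots> = (\<Sum>R\<in>Pow S. (real (card S) - real (card R)) * h R)"
  proof (rule sum.cong)
    fix R assume R: "R \<in> Pow S"
    then have "card (S - R) = card S - card R" "card R \<le> card S"
      using assms finite_subset by (auto intro!: card_Diff_subset card_mono)
    moreover have "S \<inter> - R = S - R" by auto
    ultimately show "(\<Sum>a\<in>S. if a \<in> R then 0 else h R) = (real (card S) - real (card R)) * h R"
      using assms by (simp add: sum.If_cases of_nat_diff)
  qed simp
  finally show ?thesis .
qed

text \<open>Unfolding the recursion lists rows in random order until \<open>m\<close> appears, and
  \<open>R\<close> collects the rows before \<open>m\<close>; the term \<open>R = {}\<close> is the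
  case that \<open>m\<close> comes first.\<close>

lemma row_prob_closed_form:
  assumes "finite E" "m \<in> E"
  shows "row_prob Z C m k E =
    (\<Sum>R\<in>Pow (E - {m}). of_bool (card R + cover_number Z C (E - R) < k) / real ((card E - 1) choose card R)) / real (card E)"
  using assms
proof (induction k arbitrary: E)
  case (Suc k)
  define N where "N = card E - 1"
  have cE: "card (E - {a}) = N" if "a \<in> E" for a using Suc.prems that by (simp add: N_def)
  have cEm: "card (E - {m}) = N" using cE Suc.prems by auto
  define f where "f R = of_bool (card R + cover_number Z C (E - R) < Suc k) / real (N choose card R)" for R
  have fin: "finite (E - {m})" using Suc.prems by simp
  have "row_prob Z C m k (E - {a}) = (\<Sum>R\<in>Pow (E - {m} - {a}). f (insert a R) / real (card (insert a R)))"
    if a: "a \<in> E - {m}" for a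
  proof -
    have "row_prob Z C m k (E - {a}) = (\<Sum>R\<in>Pow (E - {a} - {m}). of_bool (card R + cover_number Z C (E - {a} - R) < k)
        / real ((N - 1) choose card R)) / real N"
      using Suc.IH[of "E - {a}"] Suc.prems a cE[of a] by fastforce
    also have "\<dots> = (\<Sum>R\<in>Pow (E - {a} - {m}). f (insert a R) / real (card (insert a R)))"
      unfolding sum_divide_distrib
    proof (rule sum.cong)
      fix R assume R: "R \<in> Pow (E - {a} - {m})"
      then have aR: "a \<notin> R" "finite R" using Suc.prems finite_subset[of R E] by auto
      then have cR: "card (insert a R) = Suc (card R)" by simp
      have "card (E - {m}) > 0" using a fin card_gt_0_iff by blast
      then have N: "N = Suc (N - 1)" using cEm by simp
      \<comment> \<open>Absorption identity; dividing by \<open>card (insert a R)\<close> accounts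
        for the choice of the first row \<open>a\<close> within this set.\<close>
      have "real (Suc (card R)) * real (N choose Suc (card R)) = real N * real ((N - 1) choose card R)"
        using Suc_times_binomial[of "card R" "N - 1"] N by (simp only: of_nat_mult[symmetric])
      moreover have "E - {a} - R = E - insert a R" by auto
      ultimately show "of_bool (card R + cover_number Z C (E - {a} - R) < k) / real ((N - 1) choose card R) / real N =
          f (insert a R) / real (card (insert a R))"
        unfolding f_def cR by (simp add: mult.commute)
    qed simp
    also have "E - {a} - {m} = E - {m} - {a}" by auto
    finally show ?thesis .
  qed
  then have "(\<Sum>a\<in>E - {m}. row_prob Z C m k (E - {a})) =
      (\<Sum>a\<in>E - {m}. \<Sum>R\<in>Pow (E - {m} - {a}). f (insert a R) / real (card (insert a R)))"
    by (rule sum.cong[OF refl])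
  also have "\<dots> = (\<Sum>R\<in>Pow (E - {m}). real (card R) * (f R / real (card R)))"
    by (rule sum_Pow_insert[OF fin, of "\<lambda>R. f R / real (card R)"])
  also have "\<dots> = (\<Sum>R\<in>Pow (E - {m}) - {{}}. f R)"
  proof (rule sum.mono_neutral_cong_right)
    show "\<forall>R\<in>Pow (E - {m}) - (Pow (E - {m}) - {{}}). real (card R) * (f R / real (card R)) = 0" by auto
    fix R assume "R \<in> Pow (E - {m}) - {{}}"
    then have "card R \<noteq> 0" using fin finite_subset by fastforce
    then show "real (card R) * (f R / real (card R)) = f R" by simp
  qed (use fin in auto)
  finally have "f {} + (\<Sum>a\<in>E - {m}. row_prob Z C m k (E - {a})) = (\<Sum>R\<in>Pow (E - {m}). f R)"
    using fin by (subst sum.remove[of _ "{}"]) auto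
  then show ?case by (simp add: f_def N_def less_Suc_eq_le)
qed simp

text \<open>A cover with fewer than \<open>q\<close> lines can be filled up with further rows
  because \<open>q \<le> m\<close>, so the exact size may be relaxed to an upper bound.\<close>

lemma is_partial_cover_iff:
  assumes "q \<le> m"
  shows "is_partial_cover m n Z q (R, C) \<longleftrightarrow>
    (\<exists>R' C'. R \<subseteq> R' \<and> R' \<subseteq> {1..m} \<and> C \<subseteq> C' \<and> C' \<subseteq> {1..n} \<and> card R' + card C' \<le> q \<and>
      (\<forall>(i,j)\<in>Z. i \<in> R' \<or> j \<in> C'))"
proof
  assume "is_partial_cover m n Z q (R, C)"
  then show "\<exists>R' C'. R \<subseteq> R' \<and> R' \<subseteq> {1..m} \<and> C \<subseteq> C' \<and> C' \<subseteq> {1..n} \<and> card R' + card C' \<le> q \<and>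
      (\<forall>(i,j)\<in>Z. i \<in> R' \<or> j \<in> C')"
    unfolding is_partial_cover_def is_cover_def by auto
next
  assume "\<exists>R' C'. R \<subseteq> R' \<and> R' \<subseteq> {1..m} \<and> C \<subseteq> C' \<and> C' \<subseteq> {1..n} \<and> card R' + card C' \<le> q \<and>
      (\<forall>(i,j)\<in>Z. i \<in> R' \<or> j \<in> C')"
  then obtain R' C' where RC: "R \<subseteq> R'" "R' \<subseteq> {1..m}" "C \<subseteq> C'" "C' \<subseteq> {1..n}" "card R' + card C' \<le> q"
    "\<forall>(i,j)\<in>Z. i \<in> R' \<or> j \<in> C'" by blast
  have "card R' \<le> q - card C'" "q - card C' \<le> card {1..m}" using RC(5) assms by simp_all
  then obtain B where B: "R' \<subseteq> B" "B \<subseteq> {1..m}" "card B = q - card C'"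
    using exists_subset_between[OF _ _ RC(2)] by blast
  have "is_cover m n Z q (B, C')" using B RC unfolding is_cover_def by auto
  then show "is_partial_cover m n Z q (R, C)" unfolding is_partial_cover_def using B RC by blast
qed

text \<open>With the rows \<open>R\<close> prescribed, the other lines only have to cover the zeros
  outside \<open>R\<close>, and the least number needed for that is a
  \<open>cover_number\<close>.\<close>

lemma is_partial_cover_empty_iff:
  assumes "q \<le> m" "R \<subseteq> {1..m}" "Z \<subseteq> positions m n"
  shows "is_partial_cover m n Z q (R, {}) \<longleftrightarrow> card R + cover_number Z {1..n} ({1..m} - R) \<le> q"
proof
  assume "is_partial_cover m n Z q (R, {})"
  then obtain R' C' where RC: "R \<subseteq> R'" "R' \<subseteq> {1..m}" "C' \<subseteq> {1..n}" "card R' + card C' \<le> q"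
    "\<forall>(i,j)\<in>Z. i \<in> R' \<or> j \<in> C'" unfolding is_partial_cover_iff[OF assms(1)] by blast
  have finR': "finite R'" using RC(2) finite_subset by blast
  have "card {i\<in>{1..m} - R. \<exists>j\<in>{1..n} - C'. (i,j) \<in> Z} \<le> card (R' - R)"
    using finR' RC by (intro card_mono) auto
  also have "\<dots> = card R' - card R" using RC(1) finR' finite_subset by (intro card_Diff_subset) auto
  finally have "card {i\<in>{1..m} - R. \<exists>j\<in>{1..n} - C'. (i,j) \<in> Z} \<le> card R' - card R" .
  moreover have "card R \<le> card R'" using RC(1) finR' by (intro card_mono)
  moreover have "cover_number Z {1..n} ({1..m} - R) \<le> card C' + card {i\<in>{1..m} - R. \<exists>j\<in>{1..n} - C'. (i,j) \<in> Z}"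
    using RC by (intro cover_number_le) auto
  ultimately show "card R + cover_number Z {1..n} ({1..m} - R) \<le> q" using RC(4) by linarith
next
  assume le: "card R + cover_number Z {1..n} ({1..m} - R) \<le> q"
  obtain K where K: "K \<subseteq> {1..n}" "cover_number Z {1..n} ({1..m} - R) =
      card K + card {i\<in>{1..m} - R. \<exists>j\<in>{1..n} - K. (i,j) \<in> Z}"
    using cover_number_attained[of "{1..n}"] by blast
  define R' where "R' = R \<union> {i\<in>{1..m} - R. \<exists>j\<in>{1..n} - K. (i,j) \<in> Z}"
  have "card R' \<le> card R + card {i\<in>{1..m} - R. \<exists>j\<in>{1..n} - K. (i,j) \<in> Z}"
    unfolding R'_def by (rule card_Un_le)
  then have "card R' + card K \<le> q" using le K(2) by linarith
  moreover have "\<forall>(i,j)\<in>Z. i \<in> R' \<or> j \<in> K" using assms(3) by (auto simp: R'_def positions_def)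
  moreover have "R \<subseteq> R'" "R' \<subseteq> {1..m}" using assms(2) by (auto simp: R'_def)
  ultimately show "is_partial_cover m n Z q (R, {})"
    unfolding is_partial_cover_iff[OF assms(1)] using K(1) by blast
qed

text \<open>Row \<open>m\<close> can cover only the new zero, so unless it is prescribed it can be
  traded for column \<open>t\<close>; and every cover of \<open>Z\<close> that contains column
  \<open>t\<close> covers the new zero.\<close>

lemma is_partial_cover_insert_zero:
  assumes "q \<le> m" "1 \<le> m" "t \<in> {1..n}" "\<forall>j\<in>{1..n}. (m, j) \<notin> Z" "Z \<subseteq> positions m n" "R \<subseteq> {1..m}" "C \<subseteq> {1..n}"
  shows "is_partial_cover m n (insert (m,t) Z) q (R, C) \<longleftrightarrow>
    is_partial_cover m n Z q (R, if m \<in> R then C else insert t C)"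
proof (cases "m \<in> R")
  case True
  then show ?thesis unfolding is_partial_cover_iff[OF assms(1)] by auto
next
  case False
  show ?thesis
  proof
    assume "is_partial_cover m n (insert (m,t) Z) q (R, C)"
    then obtain R' C' where RC: "R \<subseteq> R'" "R' \<subseteq> {1..m}" "C \<subseteq> C'" "C' \<subseteq> {1..n}" "card R' + card C' \<le> q"
      "\<forall>(i,j)\<in>insert (m,t) Z. i \<in> R' \<or> j \<in> C'" unfolding is_partial_cover_iff[OF assms(1)] by blast
    have fin: "finite R'" "finite C'" using RC finite_subset by blast+
    have "card (if t \<in> C' then R' else R' - {m}) + card (insert t C') \<le> q"
    proof (cases "t \<in> C'")
      case tf: False
      then have "m \<in> R'" using RC(6) by auto
      then have "card R' > 0" using fin by (auto simp: card_gt_0_iff)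
      then show ?thesis using tf RC(5) fin \<open>m \<in> R'\<close> by simp
    qed (use RC(5) in \<open>simp add: insert_absorb\<close>)
    moreover have "\<forall>(i,j)\<in>Z. i \<in> (if t \<in> C' then R' else R' - {m}) \<or> j \<in> insert t C'"
    proof -
      have "i \<in> (if t \<in> C' then R' else R' - {m}) \<or> j \<in> insert t C'" if "(i,j) \<in> Z" for i j
        using RC(6) that assms(4,5) by (auto simp: positions_def)
      then show ?thesis by blast
    qed
    moreover have "R \<subseteq> (if t \<in> C' then R' else R' - {m})" using RC(1) False by auto
    moreover have "(if t \<in> C' then R' else R' - {m}) \<subseteq> {1..m}" "insert t C \<subseteq> insert t C'" "insert t C' \<subseteq> {1..n}"
      using RC assms(3) by auto
    ultimately show "is_partial_cover m n Z q (R, if m \<in> R then C else insert t C)"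
      using False unfolding is_partial_cover_iff[OF assms(1)] by (simp only: if_False) blast
  next
    assume "is_partial_cover m n Z q (R, if m \<in> R then C else insert t C)"
    then show "is_partial_cover m n (insert (m,t) Z) q (R, C)"
      using False unfolding is_partial_cover_iff[OF assms(1)] by (simp only: if_False) blast
  qed
qed

definition cover_sum :: "nat \<Rightarrow> nat \<Rightarrow> nat \<Rightarrow> (nat \<times> nat) set \<Rightarrow> real" where
  "cover_sum k m n Z = (\<Sum>(i, j)\<in>{(i, j). i + j < k}.
     real (d_coeff k m n Z i j) / (real ((m - 1) choose i) * real ((n - 1) choose j)))"

lemma cover_sum_eq:
  assumes k: "0 < k" "k \<le> m"
  shows "cover_sum k m n Z = (\<Sum>R\<in>Pow {1..m}. \<Sum>C\<in>Pow {1..n}.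
    of_bool (is_partial_cover m n Z (k - 1) (R, C)) / (real ((m - 1) choose card R) * real ((n - 1) choose card C)))"
proof -
  have k1: "k - 1 \<le> m" using k by simp
  define I where "I = {(i, j). i + j < k}"
  have finI: "finite I" by (rule finite_subset[of _ "{..k} \<times> {..k}"]) (auto simp: I_def)
  define S where "S = Pow {1..m} \<times> Pow {1..n}"
  have finS: "finite S" by (simp add: S_def)
  define u where "u p = (of_bool (is_partial_cover m n Z (k - 1) p) :: real)" for p
  define w where "w i j = real ((m - 1) choose i) * real ((n - 1) choose j)" for i j
  have d: "real (d_coeff k m n Z i j) = (\<Sum>p\<in>S. if (card (fst p), card (snd p)) = (i,j) then u p else 0)" for i j
  proof -
    have "p \<in> S" if pc: "is_partial_cover m n Z (k - 1) p" for p
    proof -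
      obtain R C where RC: "p = (R, C)" by (cases p)
      obtain R' C' where "R \<subseteq> R'" "R' \<subseteq> {1..m}" "C \<subseteq> C'" "C' \<subseteq> {1..n}"
        using pc[unfolded RC is_partial_cover_iff[OF k1]] by blast
      then show ?thesis unfolding S_def RC by blast
    qed
    then have "{(R, C). is_partial_cover m n Z (k - 1) (R, C) \<and> card R = i \<and> card C = j} =
        {p\<in>S. is_partial_cover m n Z (k - 1) p \<and> (card (fst p), card (snd p)) = (i,j)}"
      by auto
    then have "real (d_coeff k m n Z i j) =
        (\<Sum>p\<in>{p\<in>S. is_partial_cover m n Z (k - 1) p \<and> (card (fst p), card (snd p)) = (i,j)}. 1)"
      unfolding d_coeff_def by simp
    also have "\<dots> = (\<Sum>p\<in>S. if is_partial_cover m n Z (k - 1) p \<and> (card (fst p), card (snd p)) = (i,j) then 1 else 0)"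
      using finS by (rule sum.inter_filter)
    also have "\<dots> = (\<Sum>p\<in>S. if (card (fst p), card (snd p)) = (i,j) then u p else 0)"
      by (intro sum.cong) (auto simp: u_def)
    finally show ?thesis .
  qed
  have "cover_sum k m n Z = (\<Sum>q\<in>I. \<Sum>p\<in>S. if (card (fst p), card (snd p)) = q then u p / w (fst q) (snd q) else 0)"
    unfolding cover_sum_def I_def[symmetric] w_def[symmetric]
    by (intro sum.cong) (auto simp: d sum_divide_distrib intro!: sum.cong)
  also have "\<dots> = (\<Sum>p\<in>S. \<Sum>q\<in>I. if (card (fst p), card (snd p)) = q then u p / w (fst q) (snd q) else 0)"
    by (rule sum.swap)
  also have "\<dots> = (\<Sum>p\<in>S. u p / w (card (fst p)) (card (snd p)))"
  proof (rule sum.cong)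
    fix p assume p: "p \<in> S"
    show "(\<Sum>q\<in>I. if (card (fst p), card (snd p)) = q then u p / w (fst q) (snd q) else 0) =
        u p / w (card (fst p)) (card (snd p))"
    proof (cases "(card (fst p), card (snd p)) \<in> I")
      case False
      \<comment> \<open>Subsets of a cover with \<open>k - 1\<close> lines never leave the index
        range \<open>i + j < k\<close>.\<close>
      have "\<not> is_partial_cover m n Z (k - 1) p"
      proof
        assume pc: "is_partial_cover m n Z (k - 1) p"
        obtain R C where RC: "p = (R, C)" by (cases p)
        obtain R' C' where RC': "R \<subseteq> R'" "R' \<subseteq> {1..m}" "C \<subseteq> C'" "C' \<subseteq> {1..n}" "card R' + card C' \<le> k - 1"
          using pc[unfolded RC is_partial_cover_iff[OF k1]] by blast
        moreover have "card R \<le> card R'" "card C \<le> card C'"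
          using RC' finite_subset[of R' "{1..m}"] finite_subset[of C' "{1..n}"] by (auto intro!: card_mono)
        ultimately have "card R + card C < k" using k by linarith
        then show False using False RC by (simp add: I_def)
      qed
      then show ?thesis using False finI by (simp add: u_def)
    qed (use finI in simp)
  qed simp
  also have "\<dots> = (\<Sum>R\<in>Pow {1..m}. \<Sum>C\<in>Pow {1..n}. u (R, C) / w (card R) (card C))"
    by (simp add: S_def sum.cartesian_product case_prod_unfold)
  finally show ?thesis by (simp add: u_def w_def)
qed

text \<open>Exposing the columns in random order, this is a telescoping sum along the order.\<close>

lemma telescope_column_subsets:
  fixes u :: "nat set \<Rightarrow> real"
  assumes n: "0 < n" and u: "u {1..n} = 0"
  shows "(\<Sum>C\<in>Pow {1..n}. \<Sum>t\<in>{1..n}. (u C - u (insert t C)) / real ((n - 1) choose card C)) = real n * u {}"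
proof -
  define w where "w j = real ((n - 1) choose j)" for j
  \<comment> \<open>\<open>w1\<close> and \<open>w2\<close> show that \<open>u C\<close> gets the
    weight \<open>n / (n choose card C)\<close> in its role as \<open>C\<close> and the negative of
    it in its role as \<open>insert t C\<close>, so at most \<open>C = {}\<close> and
    \<open>C = {1..n}\<close> survive.\<close>
  have w1: "(real n - real j) / w j = real n / real (n choose j)" if "j < n" for j
  proof -
    have "n choose j = (n choose (n - j))" "(n - 1) choose j = ((n - 1) choose (n - 1 - j))"
      using that binomial_symmetric[of j n] binomial_symmetric[of j "n - 1"] by auto
    moreover have "Suc (n - 1 - j) * (Suc (n - 1) choose Suc (n - 1 - j)) = Suc (n - 1) * ((n - 1) choose (n - 1 - j))"
      by (rule Suc_times_binomial)
    moreover have "Suc (n - 1 - j) = n - j" "Suc (n - 1) = n" using that by auto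
    ultimately have "(n - j) * (n choose j) = n * ((n - 1) choose j)" by metis
    then have "(real n - real j) * real (n choose j) = real n * w j"
      unfolding w_def using that by (metis of_nat_mult of_nat_diff less_imp_le)
    moreover have "w j > 0" "real (n choose j) > 0" using that by (auto simp: w_def)
    ultimately show ?thesis by (simp add: field_simps)
  qed
  have w2: "real j / w (j - 1) = real n / real (n choose j)" if "0 < j" "j \<le> n" for j
  proof -
    have "Suc (j - 1) * (Suc (n - 1) choose Suc (j - 1)) = Suc (n - 1) * ((n - 1) choose (j - 1))"
      by (rule Suc_times_binomial)
    then have "j * (n choose j) = n * ((n - 1) choose (j - 1))" using that n by simp
    then have "real j * real (n choose j) = real n * w (j - 1)" unfolding w_def by (metis of_nat_mult)
    moreover have "w (j - 1) > 0" "real (n choose j) > 0" using that by (auto simp: w_def)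
    ultimately show ?thesis by (simp add: field_simps)
  qed
  have "(\<Sum>C\<in>Pow {1..n}. \<Sum>t\<in>{1..n}. (u C - u (insert t C)) / w (card C)) =
      (\<Sum>t\<in>{1..n}. \<Sum>C\<in>Pow {1..n}. (u C - u (insert t C)) / w (card C))" by (rule sum.swap)
  also have "\<dots> = (\<Sum>t\<in>{1..n}. \<Sum>C\<in>Pow ({1..n} - {t}). (u C - u (insert t C)) / w (card C))"
    by (intro sum.cong sum.mono_neutral_right refl) (auto simp: insert_absorb)
  also have "\<dots> = (\<Sum>t\<in>{1..n}. \<Sum>C\<in>Pow ({1..n} - {t}). u C / w (card C)) -
      (\<Sum>t\<in>{1..n}. \<Sum>C\<in>Pow ({1..n} - {t}). u (insert t C) / w (card (insert t C) - 1))"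
    unfolding sum_subtractf[symmetric]
  proof (intro sum.cong refl)
    fix t C assume C: "C \<in> Pow ({1..n} - {t})"
    have "finite C" by (rule finite_subset[of C "{1..n}"]) (use C in auto)
    then have "card (insert t C) - 1 = card C" using C by (auto simp: card_insert_if)
    then show "(u C - u (insert t C)) / w (card C) = u C / w (card C) - u (insert t C) / w (card (insert t C) - 1)"
      by (simp add: diff_divide_distrib)
  qed
  also have "(\<Sum>t\<in>{1..n}. \<Sum>C\<in>Pow ({1..n} - {t}). u C / w (card C)) =
      (\<Sum>C\<in>Pow {1..n}. (real n - real (card C)) * (u C / w (card C)))"
    using sum_Pow_delete[of "{1..n}" "\<lambda>C. u C / w (card C)"] by simp
  also have "(\<Sum>t\<in>{1..n}. \<Sum>C\<in>Pow ({1..n} - {t}). u (insert t C) / w (card (insert t C) - 1)) =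
      (\<Sum>C\<in>Pow {1..n}. real (card C) * (u C / w (card C - 1)))"
    using sum_Pow_insert[of "{1..n}" "\<lambda>C. u C / w (card C - 1)"] by simp
  also have "(\<Sum>C\<in>Pow {1..n}. (real n - real (card C)) * (u C / w (card C))) -
      (\<Sum>C\<in>Pow {1..n}. real (card C) * (u C / w (card C - 1))) =
      (\<Sum>C\<in>Pow {1..n}. if C = {} then real n * u {} else 0)"
    unfolding sum_subtractf[symmetric]
  proof (rule sum.cong)
    fix C :: "nat set" assume C: "C \<in> Pow {1..n}"
    then have finC: "finite C" using finite_subset by blast
    have le: "card C \<le> n" using C card_mono[of "{1..n}" C] by simp
    show "(real n - real (card C)) * (u C / w (card C)) - real (card C) * (u C / w (card C - 1)) =
        (if C = {} then real n * u {} else 0)"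
    proof (cases "C = {} \<or> C = {1..n}")
      case True
      then show ?thesis using u n by (auto simp: w_def)
    next
      case False
      then have "0 < card C" using finC by (auto simp: card_gt_0_iff)
      moreover have "card C < n" using False C card_subset_eq[of "{1..n}" C] le by fastforce
      ultimately show ?thesis using w1[of "card C"] w2[of "card C"] le False
        by (simp add: times_divide_eq_right times_divide_eq_left[symmetric] mult.commute[of _ "u C"] divide_inverse mult.assoc)
    qed
  qed simp
  also have "\<dots> = real n * u {}" by simp
  finally show ?thesis by (simp add: w_def)
qed

text \<open>Sets of rows containing \<open>m\<close> contribute equally to all these sums. For the
  others, a zero in column \<open>t\<close> replaces \<open>C\<close> by \<open>insert t C\<close>,
  so the sum over columns telescopes to the term \<open>C = {}\<close>; this is a rank condition on
  \<open>R\<close>, the one in \<open>row_prob_closed_form\<close>.\<close>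

lemma cover_sum_insert_zero:
  assumes RAP: "standard_RAP k m n Z" and row: "\<forall>j\<in>{1..n}. (m, j) \<notin> Z"
  shows "real n * cover_sum k m n Z - (\<Sum>t\<in>{1..n}. cover_sum k m n (insert (m,t) Z)) =
    real m * real n * row_prob Z {1..n} m k {1..m}"
proof -
  have k: "0 < k" "k \<le> m" "k \<le> n" and Z: "Z \<subseteq> positions m n" using RAP by (auto simp: standard_RAP_def)
  have q: "k - 1 \<le> m" "1 \<le> m" "0 < n" using k by auto
  define pc where "pc R C = (of_bool (is_partial_cover m n Z (k - 1) (R, C)) :: real)" for R C
  define v where "v R = real ((m - 1) choose card R)" for R :: "nat set"
  define w where "w C = real ((n - 1) choose card C)" for C :: "nat set"
  have S: "cover_sum k m n Z = (\<Sum>R\<in>Pow {1..m}. \<Sum>C\<in>Pow {1..n}. pc R C / (v R * w C))"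
    using k by (simp add: cover_sum_eq pc_def v_def w_def)
  have St: "cover_sum k m n (insert (m,t) Z) =
      (\<Sum>R\<in>Pow {1..m}. \<Sum>C\<in>Pow {1..n}. pc R (if m \<in> R then C else insert t C) / (v R * w C))"
    if t: "t \<in> {1..n}" for t
    unfolding cover_sum_eq[OF k(1,2)] pc_def v_def w_def
    using is_partial_cover_insert_zero[OF q(1,2) t row Z] by (intro sum.cong refl) auto
  \<comment> \<open>The boundary condition of the telescoping: \<open>n\<close> columns are more
    than the \<open>k - 1\<close> lines allowed.\<close>
  have pc_full: "pc R {1..n} = 0" for R
  proof -
    have "\<not> is_partial_cover m n Z (k - 1) (R, {1..n})"
    proof
      assume "is_partial_cover m n Z (k - 1) (R, {1..n})"
      then obtain R' :: "nat set" and C' where C': "{1..n} \<subseteq> C'" "C' \<subseteq> {1..n}" "card R' + card C' \<le> k - 1"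
        unfolding is_partial_cover_iff[OF q(1)] by blast
      then have "C' = {1..n}" by blast
      then show False using C'(3) k by simp
    qed
    then show ?thesis by (simp add: pc_def)
  qed
  define g where "g R C t = (pc R C - pc R (if m \<in> R then C else insert t C)) / (v R * w C)" for R C t
  have "real n * cover_sum k m n Z - (\<Sum>t\<in>{1..n}. cover_sum k m n (insert (m,t) Z)) =
      (\<Sum>t\<in>{1..n}. cover_sum k m n Z - cover_sum k m n (insert (m,t) Z))"
    by (simp add: sum_subtractf)
  also have "\<dots> = (\<Sum>t\<in>{1..n}. \<Sum>R\<in>Pow {1..m}. \<Sum>C\<in>Pow {1..n}. g R C t)"
    by (intro sum.cong refl) (simp add: S St sum_subtractf g_def diff_divide_distrib)
  also have "\<dots> = (\<Sum>R\<in>Pow {1..m}. \<Sum>t\<in>{1..n}. \<Sum>C\<in>Pow {1..n}. g R C t)" by (rule sum.swap)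
  also have "\<dots> = (\<Sum>R\<in>Pow {1..m}. \<Sum>C\<in>Pow {1..n}. \<Sum>t\<in>{1..n}. g R C t)"
    by (intro sum.cong refl sum.swap)
  also have "\<dots> = (\<Sum>R\<in>Pow ({1..m} - {m}). \<Sum>C\<in>Pow {1..n}. \<Sum>t\<in>{1..n}. g R C t)"
    by (rule sum.mono_neutral_right) (auto simp: g_def)
  also have "\<dots> = (\<Sum>R\<in>Pow ({1..m} - {m}). real n * pc R {} / v R)"
  proof (rule sum.cong)
    fix R assume R: "R \<in> Pow ({1..m} - {m})"
    then have "m \<notin> R" by auto
    then have "(\<Sum>C\<in>Pow {1..n}. \<Sum>t\<in>{1..n}. g R C t) =
        (\<Sum>C\<in>Pow {1..n}. \<Sum>t\<in>{1..n}. (pc R C - pc R (insert t C)) / w C) / v R"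
      by (simp add: g_def sum_divide_distrib divide_divide_eq_left' mult.commute)
    also have "\<dots> = real n * pc R {} / v R"
      unfolding w_def using telescope_column_subsets[of n "pc R", OF q(3) pc_full] by simp
    finally show "(\<Sum>C\<in>Pow {1..n}. \<Sum>t\<in>{1..n}. g R C t) = real n * pc R {} / v R" .
  qed simp
  also have "\<dots> = real n * (\<Sum>R\<in>Pow ({1..m} - {m}). of_bool (card R + cover_number Z {1..n} ({1..m} - R) < k) / v R)"
    unfolding sum_distrib_left
  proof (rule sum.cong)
    fix R assume R: "R \<in> Pow ({1..m} - {m})"
    then have "is_partial_cover m n Z (k - 1) (R, {}) \<longleftrightarrow> card R + cover_number Z {1..n} ({1..m} - R) \<le> k - 1"
      by (intro is_partial_cover_empty_iff q Z) auto
    then have "pc R {} = of_bool (card R + cover_number Z {1..n} ({1..m} - R) < k)"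
      unfolding pc_def using k by auto
    then show "real n * pc R {} / v R = real n * (of_bool (card R + cover_number Z {1..n} ({1..m} - R) < k) / v R)" by simp
  qed simp
  also have "(\<Sum>R\<in>Pow ({1..m} - {m}). of_bool (card R + cover_number Z {1..n} ({1..m} - R) < k) / v R) =
      real m * row_prob Z {1..n} m k {1..m}"
    using q by (subst row_prob_closed_form) (auto simp: v_def)
  finally show ?thesis by simp
qed

section \<open>Expected cost and forced entries\<close>

definition exp1 :: "real measure" where
  "exp1 = density lborel (\<lambda>x. ennreal (exponential_density 1 x))"

lemma sets_exp1 [measurable_cong, simp]: "sets exp1 = sets borel"
  and space_exp1 [simp]: "space exp1 = UNIV"
  by (simp_all add: exp1_def)

lemma prob_space_exp1: "prob_space exp1"
  unfolding exp1_def by (rule prob_space_exponential_density) simp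

lemma AE_exp1_neq: "AE y in exp1. y \<noteq> c"
  unfolding exp1_def using AE_lborel_singleton[of c] by (subst AE_density) auto

lemma AE_exp1_pos: "AE y in exp1. 0 < y"
  unfolding exp1_def using AE_lborel_singleton[of 0]
  by (subst AE_density) (auto simp: exponential_density_def)

lemma emeasure_exp1_greaterThan:
  assumes "0 \<le> z"
  shows "emeasure exp1 {z<..} = ennreal (exp (- z))"
proof -
  interpret prob_space exp1 by (rule prob_space_exp1)
  have "distributed exp1 lborel (\<lambda>x. x) (exponential_density 1)"
    unfolding distributed_def by (auto simp: exp1_def distr_id2)
  from exponential_distributedD_gt[OF this assms]
  have "prob {x. z < x} = exp (- z)" by simp
  moreover have "{x. z < x} = {z<..}" by auto
  ultimately show ?thesis by (simp add: emeasure_eq_measure)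
qed

text \<open>Layer cake: \<open>min y c\<close> is the length of the set of \<open>z \<ge> 0\<close>
  below both \<open>y\<close> and \<open>c\<close>. After Fubini the tail \<open>exp (- z)\<close>
  appears, which for intensity \<open>1\<close> is also the density. The bound \<open>c\<close> may
  be infinite.\<close>

lemma nn_integral_exp1_min:
  "(\<integral>\<^sup>+y. min (ennreal y) c \<partial>exp1) = emeasure exp1 {y. ennreal y < c}"
proof -
  interpret E: prob_space exp1 by (rule prob_space_exp1)
  interpret pair_sigma_finite exp1 lborel ..
  define g :: "real \<Rightarrow> real \<Rightarrow> ennreal" where
    "g y z = (if 0 \<le> z \<and> z < y \<and> ennreal z < c then 1 else 0)" for y z
  have g[measurable]: "case_prod g \<in> borel_measurable (exp1 \<Otimes>\<^sub>M lborel)"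
    unfolding g_def by measurable
  have 1: "(\<integral>\<^sup>+z. g y z \<partial>lborel) = min (ennreal y) c" if y: "0 < y" for y
  proof (cases c)
    case (real r)
    have "(\<integral>\<^sup>+z. g y z \<partial>lborel) = (\<integral>\<^sup>+z. indicator {0..<min y r} z \<partial>lborel)"
      using real by (intro nn_integral_cong) (auto simp: g_def indicator_def ennreal_less_iff)
    also have "\<dots> = ennreal (min y r)" using y real by simp
    finally show ?thesis using y real by (simp add: min_def ennreal_le_iff)
  next
    case top
    have "(\<integral>\<^sup>+z. g y z \<partial>lborel) = (\<integral>\<^sup>+z. indicator {0..<y} z \<partial>lborel)"
      using top by (intro nn_integral_cong) (auto simp: g_def indicator_def)
    also have "\<dots> = ennreal y" using y by simp
    finally show ?thesis using top by (simp add: min_def)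
  qed
  have 2: "(\<integral>\<^sup>+y. g y z \<partial>exp1) = ennreal (exponential_density 1 z) * indicator {y. ennreal y < c} z" for z
  proof (cases "0 \<le> z \<and> ennreal z < c")
    case True
    then have "(\<integral>\<^sup>+y. g y z \<partial>exp1) = (\<integral>\<^sup>+y. indicator {z<..} y \<partial>exp1)"
      by (intro nn_integral_cong) (auto simp: g_def indicator_def)
    then show ?thesis using True emeasure_exp1_greaterThan[of z] by (simp add: exponential_density_def)
  next
    case False
    then have "g y z = 0" for y by (auto simp: g_def)
    then show ?thesis using False by (auto simp: exponential_density_def)
  qed
  have "(\<integral>\<^sup>+y. min (ennreal y) c \<partial>exp1) = (\<integral>\<^sup>+y. \<integral>\<^sup>+z. g y z \<partial>lborel \<partial>exp1)"
    using AE_exp1_pos by (intro nn_integral_cong_AE) (auto simp: 1)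
  also have "\<dots> = (\<integral>\<^sup>+z. \<integral>\<^sup>+y. g y z \<partial>exp1 \<partial>lborel)" by (rule Fubini'[symmetric]) (rule g)
  also have "\<dots> = (\<integral>\<^sup>+z. ennreal (exponential_density 1 z) * indicator {y. ennreal y < c} z \<partial>lborel)"
    by (simp only: 2)
  also have "\<dots> = emeasure exp1 {y. ennreal y < c}"
    unfolding exp1_def by (subst emeasure_density) auto
  finally show ?thesis .
qed

section \<open>The random matrix: measurability, dependence on one entry, genericity\<close>

lemma k_assignments_eq: "k_assignments k m n = asg {1..m} {1..n} k"
proof -
  have "(\<forall>p\<in>A. \<forall>q\<in>A. p \<noteq> q \<longrightarrow> fst p \<noteq> fst q \<and> snd p \<noteq> snd q) \<longleftrightarrow> inj_on fst A \<and> inj_on snd A"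
    for A :: "(nat \<times> nat) set"
    unfolding inj_on_def by meson
  then show ?thesis by (simp add: k_assignments_def asg_def positions_def)
qed

lemma min_cost_eq: "min_cost k m n X = opt_cost {1..m} {1..n} X k"
  by (simp add: min_cost_def opt_cost_def k_assignments_eq assignment_cost_def)

lemma entry_distribution_nonzero: "p \<notin> Z \<Longrightarrow> entry_distribution Z p = exp1"
  by (simp add: entry_distribution_def exp1_def)

lemma sets_entry_distribution [measurable_cong, simp]: "sets (entry_distribution Z p) = sets borel"
  and space_entry_distribution [simp]: "space (entry_distribution Z p) = UNIV"
  by (simp_all add: entry_distribution_def)

lemma prob_space_entry_distribution: "prob_space (entry_distribution Z p)"
  using prob_space_exp1 by (auto simp: entry_distribution_def exp1_def intro!: prob_space_return)

lemma prob_space_RAP: "prob_space (RAP_measure m n Z)"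
  unfolding RAP_measure_def by (intro prob_space_PiM prob_space_entry_distribution)

lemma finite_positions [simp]: "finite (positions m n)"
  by (simp add: positions_def)

lemma measurable_RAP_component:
  assumes "p \<in> positions m n"
  shows "(\<lambda>X. X p) \<in> borel_measurable (RAP_measure m n Z)"
  using measurable_component_singleton[OF assms, of "entry_distribution Z"]
  by (simp add: RAP_measure_def cong: measurable_cong_sets)

lemma measurable_RAP_sum:
  assumes "A \<in> asg {1..m} {1..n} k"
  shows "(\<lambda>X. sum X A) \<in> borel_measurable (RAP_measure m n Z)"
  using asgD(1)[OF assms] by (intro borel_measurable_sum measurable_RAP_component) (auto simp: positions_def)

lemma measurable_RAP_opt_cost: "(\<lambda>X. opt_cost {1..m} {1..n} X k) \<in> borel_measurable (RAP_measure m n Z)"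
  unfolding opt_cost_def by (intro borel_measurable_Min finite_asg measurable_RAP_sum) auto

lemma measurable_RAP_optimal:
  assumes "A \<in> asg {1..m} {1..n} k"
  shows "Measurable.pred (RAP_measure m n Z) (\<lambda>X. sum X A = opt_cost {1..m} {1..n} X k)"
proof -
  show ?thesis
    unfolding pred_def by (rule borel_measurable_eq[OF measurable_RAP_sum[OF assms] measurable_RAP_opt_cost])
qed

lemma nn_integral_RAP_split:
  assumes p: "p \<in> positions m n" and f: "f \<in> borel_measurable (RAP_measure m n Z)"
  shows "(\<integral>\<^sup>+X. f X \<partial>RAP_measure m n Z) =
    (\<integral>\<^sup>+x. (\<integral>\<^sup>+y. f (x(p := y)) \<partial>entry_distribution Z p) \<partial>PiM (positions m n - {p}) (entry_distribution Z))"
proof -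
  interpret product_sigma_finite "entry_distribution Z"
    by (intro product_sigma_finite.intro prob_space_imp_sigma_finite prob_space_entry_distribution)
  have "insert p (positions m n - {p}) = positions m n" using p by auto
  then show ?thesis
    using product_nn_integral_insert[of "positions m n - {p}" p f] f by (simp add: RAP_measure_def)
qed

lemma AE_RAP_entry:
  assumes p: "p \<in> positions m n" and P: "AE y in entry_distribution Z p. P y"
  shows "AE X in RAP_measure m n Z. P (X p)"
  unfolding RAP_measure_def
  by (rule AE_PiM_component[of "positions m n" "entry_distribution Z" p P])
     (use prob_space_entry_distribution p P in auto)

lemma AE_entry_zero:
  assumes "p \<in> Z"
  shows "AE y in entry_distribution Z p. y = 0"
proof -
  have "entry_distribution Z p = return borel 0" using assms by (simp add: entry_distribution_def)
  moreover have "AE y in return borel (0::real). y = 0" by (subst AE_return) auto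
  ultimately show ?thesis by metis
qed

lemma AE_entry_nonneg: "AE y in entry_distribution Z p. 0 \<le> y"
proof (cases "p \<in> Z")
  case True
  show ?thesis using AE_entry_zero[OF True] by eventually_elim simp
next
  case False
  show ?thesis unfolding entry_distribution_nonzero[OF False] using AE_exp1_pos by eventually_elim simp
qed

text \<open>In terms of the entry \<open>y\<close> at \<open>p\<close> the optimal cost is
  \<open>min (a + y) b\<close>, where \<open>a\<close> is the best cost of the other entries over
  assignments through \<open>p\<close> and \<open>b\<close> the best cost over those avoiding
  \<open>p\<close>. So \<open>c\<close> is \<open>b - a\<close> cut off at \<open>0\<close>, or
  \<open>top\<close> if all assignments contain \<open>p\<close>, or \<open>0\<close> if none
  does.\<close>

lemma opt_cost_single_entry:
  assumes fin: "finite R" "finite C" and sR: "k \<le> card R" "k \<le> card C"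
    and nn: "\<And>q. q \<in> R \<times> C - {p} \<Longrightarrow> 0 \<le> x q"
  obtains c :: ennreal where
    "\<And>y. 0 \<le> y \<Longrightarrow> ennreal (opt_cost R C (x(p := y)) k) = ennreal (opt_cost R C (x(p := 0)) k) + min (ennreal y) c"
    "\<And>y. 0 \<le> y \<Longrightarrow> (\<forall>A\<in>asg R C k. sum (x(p := y)) A = opt_cost R C (x(p := y)) k \<longrightarrow> p \<in> A) \<longleftrightarrow> ennreal y < c"
proof -
  define \<A> where "\<A> = {A\<in>asg R C k. p \<in> A}"
  define \<B> where "\<B> = {A\<in>asg R C k. p \<notin> A}"
  have AB: "asg R C k = \<A> \<union> \<B>" by (auto simp: \<A>_def \<B>_def)
  have finAB: "finite \<A>" "finite \<B>" using finite_asg[OF fin, of k] by (auto simp: \<A>_def \<B>_def)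
  define a where "a = Min ((\<lambda>A. sum x (A - {p})) ` \<A>)"
  define b where "b = Min (sum x ` \<B>)"
  have sumA: "sum (x(p := y)) A = sum x (A - {p}) + y" if "A \<in> \<A>" for A y
  proof -
    have "finite A" using that finite_of_asg[OF _ fin] by (auto simp: \<A>_def)
    then have "sum (x(p := y)) A = (x(p := y)) p + sum (x(p := y)) (A - {p})"
      using that by (intro sum.remove) (auto simp: \<A>_def)
    also have "sum (x(p := y)) (A - {p}) = sum x (A - {p})" by (intro sum.cong) auto
    finally show ?thesis by simp
  qed
  have sumB: "sum (x(p := y)) A = sum x A" if "A \<in> \<B>" for A y
    using that by (intro sum.cong) (auto simp: \<B>_def)
  have img: "sum (x(p := y)) ` asg R C k = (\<lambda>A. sum x (A - {p}) + y) ` \<A> \<union> sum x ` \<B>" for y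
    unfolding AB image_Un using sumA sumB by (auto simp: image_def)
  have a_le: "a \<le> sum x (A - {p})" if "A \<in> \<A>" for A
    unfolding a_def using finAB that by (intro Min_le) auto
  have a_ex: "\<exists>A\<in>\<A>. a = sum x (A - {p})" if "\<A> \<noteq> {}"
  proof -
    have "a \<in> (\<lambda>A. sum x (A - {p})) ` \<A>" unfolding a_def using finAB that by (intro Min_in) auto
    then show ?thesis by auto
  qed
  have b_le: "b \<le> sum x A" if "A \<in> \<B>" for A
    unfolding b_def using finAB that by (intro Min_le) auto
  have b_ex: "\<exists>A\<in>\<B>. b = sum x A" if "\<B> \<noteq> {}"
  proof -
    have "b \<in> sum x ` \<B>" unfolding b_def using finAB that by (intro Min_in) auto
    then show ?thesis by auto
  qed
  have a0: "0 \<le> a" if ne: "\<A> \<noteq> {}"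
  proof -
    obtain A where A: "A \<in> \<A>" "a = sum x (A - {p})" using a_ex[OF ne] by blast
    then have "A \<subseteq> R \<times> C" using asgD(1)[of A R C k] unfolding \<A>_def by blast
    then show ?thesis unfolding A(2) by (intro sum_nonneg nn) auto
  qed
  have b0: "0 \<le> b" if ne: "\<B> \<noteq> {}"
  proof -
    obtain A where A: "A \<in> \<B>" "b = sum x A" using b_ex[OF ne] by blast
    then have "A \<subseteq> R \<times> C" "p \<notin> A" using asgD(1)[of A R C k] unfolding \<B>_def by blast+
    then show ?thesis unfolding A(2) by (intro sum_nonneg nn) auto
  qed
  have ne: "\<A> \<noteq> {} \<or> \<B> \<noteq> {}" using asg_nonempty[OF fin sR] AB by auto
  have mc_a: "opt_cost R C (x(p := y)) k = a + y" if "\<B> = {}" for y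
  proof -
    have "\<A> \<noteq> {}" using ne that by auto
    then obtain A where A: "A \<in> \<A>" "a = sum x (A - {p})" using a_ex by blast
    show ?thesis unfolding opt_cost_def img
      by (rule Min_eqI) (use finAB a_le A that in auto)
  qed
  have mc_b: "opt_cost R C (x(p := y)) k = b" if "\<A> = {}" for y
  proof -
    have "\<B> \<noteq> {}" using ne that by auto
    then show ?thesis unfolding opt_cost_def img using that by (simp add: b_def)
  qed
  have mc_ab: "opt_cost R C (x(p := y)) k = min (a + y) b" if ne: "\<A> \<noteq> {}" "\<B> \<noteq> {}" for y
  proof -
    obtain A where A: "A \<in> \<A>" "a = sum x (A - {p})" using a_ex[OF ne(1)] by blast
    obtain B where B: "B \<in> \<B>" "b = sum x B" using b_ex[OF ne(2)] by blast
    have "min (a + y) b \<in> (\<lambda>A. sum x (A - {p}) + y) ` \<A> \<union> sum x ` \<B>"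
      using A B by (cases "a + y \<le> b") (auto simp: min_def)
    then show ?thesis unfolding opt_cost_def img
      by (intro Min_eqI) (use finAB a_le b_le in \<open>auto simp: min_le_iff_disj\<close>)
  qed
  have event: "(\<forall>A\<in>asg R C k. sum (x(p := y)) A = opt_cost R C (x(p := y)) k \<longrightarrow> p \<in> A) \<longleftrightarrow>
      (\<forall>A\<in>\<B>. sum x A \<noteq> opt_cost R C (x(p := y)) k)" for y
  proof (intro iffI ballI impI)
    fix A assume H: "\<forall>A\<in>asg R C k. sum (x(p := y)) A = opt_cost R C (x(p := y)) k \<longrightarrow> p \<in> A" and A: "A \<in> \<B>"
    have "A \<in> asg R C k" "p \<notin> A" using A by (simp_all add: \<B>_def)
    then show "sum x A \<noteq> opt_cost R C (x(p := y)) k" using H sumB[OF A, of y] by metis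
  next
    fix A assume H: "\<forall>A\<in>\<B>. sum x A \<noteq> opt_cost R C (x(p := y)) k"
      and A: "A \<in> asg R C k" "sum (x(p := y)) A = opt_cost R C (x(p := y)) k"
    show "p \<in> A"
    proof (rule ccontr)
      assume "p \<notin> A"
      then have "A \<in> \<B>" using A by (simp add: \<B>_def)
      then show False using H A(2) sumB[of A y] by metis
    qed
  qed
  consider "\<B> = {}" | "\<A> = {}" "\<B> \<noteq> {}" | "\<A> \<noteq> {}" "\<B> \<noteq> {}" by blast
  then show ?thesis
  proof cases
    case 1
    then have a: "0 \<le> a" using a0 ne by blast
    show ?thesis
    proof (rule that[of top])
      fix y :: real assume y: "0 \<le> y"
      show "ennreal (opt_cost R C (x(p := y)) k) = ennreal (opt_cost R C (x(p := 0)) k) + min (ennreal y) top"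
        using a y by (simp add: mc_a[OF 1] ennreal_plus)
      show "(\<forall>A\<in>asg R C k. sum (x(p := y)) A = opt_cost R C (x(p := y)) k \<longrightarrow> p \<in> A) \<longleftrightarrow> ennreal y < top"
        unfolding event 1 by simp
    qed
  next
    case 2
    show ?thesis
    proof (rule that[of 0])
      fix y :: real assume y: "0 \<le> y"
      show "ennreal (opt_cost R C (x(p := y)) k) = ennreal (opt_cost R C (x(p := 0)) k) + min (ennreal y) 0"
        by (simp add: mc_b[OF 2(1)])
      show "(\<forall>A\<in>asg R C k. sum (x(p := y)) A = opt_cost R C (x(p := y)) k \<longrightarrow> p \<in> A) \<longleftrightarrow> ennreal y < 0"
        unfolding event unfolding mc_b[OF 2(1)] using b_ex[OF 2(2)] by auto
    qed
  next
    case 3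
    note m = mc_ab[OF 3] and ab = a0[OF 3(1)] b0[OF 3(2)]
    show ?thesis
    proof (rule that[of "ennreal (b - a)"])
      fix y :: real assume y: "0 \<le> y"
      show "ennreal (opt_cost R C (x(p := y)) k) = ennreal (opt_cost R C (x(p := 0)) k) + min (ennreal y) (ennreal (b - a))"
      proof (cases "a \<le> b")
        case True
        have "ennreal (min (a + y) b) = ennreal (min (a + 0) b + min y (b - a))"
          using True y by (intro arg_cong[where f = ennreal]) (auto simp: min_def)
        also have "\<dots> = ennreal (min (a + 0) b) + ennreal (min y (b - a))"
          using True ab y by (intro ennreal_plus) auto
        also have "ennreal (min y (b - a)) = min (ennreal y) (ennreal (b - a))"
          using True y by (auto simp: min_def ennreal_le_iff)
        finally show ?thesis unfolding m .
      next
        case False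
        then show ?thesis unfolding m using y by (simp add: min_def ennreal_neg)
      qed
      have "(\<forall>A\<in>\<B>. sum x A \<noteq> min (a + y) b) \<longleftrightarrow> a + y < b"
        using b_ex[OF 3(2)] b_le by (force simp: min_def)
      then show "(\<forall>A\<in>asg R C k. sum (x(p := y)) A = opt_cost R C (x(p := y)) k \<longrightarrow> p \<in> A) \<longleftrightarrow> ennreal y < ennreal (b - a)"
        unfolding event unfolding m using y by (simp add: ennreal_less_iff less_diff_eq add.commute)
    qed
  qed
qed

text \<open>Membership in every optimal assignment matches the strict inequality
  \<open>y < c\<close>. Generically, one optimal assignment through a nonzero position implies
  it.\<close>

definition forced :: "nat \<Rightarrow> nat \<Rightarrow> nat \<Rightarrow> nat \<times> nat \<Rightarrow> (nat \<times> nat \<Rightarrow> real) \<Rightarrow> bool" where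
  "forced k m n p X \<longleftrightarrow> (\<forall>A\<in>asg {1..m} {1..n} k. sum X A = opt_cost {1..m} {1..n} X k \<longrightarrow> p \<in> A)"

lemma measurable_forced [measurable]: "Measurable.pred (RAP_measure m n Z) (forced k m n p)"
proof -
  have "Measurable.pred (RAP_measure m n Z)
      (\<lambda>X. \<forall>A\<in>asg {1..m} {1..n} k. sum X A = opt_cost {1..m} {1..n} X k \<longrightarrow> p \<in> A)"
    by (intro pred_intros_finite finite_asg pred_intros_logic measurable_RAP_optimal) auto
  then show ?thesis by (simp add: forced_def[abs_def])
qed

text \<open>Replacing an \<open>Exp(1)\<close> entry by \<open>0\<close> lowers the expected cost by the probability that the
  entry is used, since \<open>E min (x, c) = P (x < c)\<close> for \<open>x\<close> of distribution \<open>Exp(1)\<close>.\<close>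

lemma nn_integral_opt_cost_insert_zero:
  assumes k: "k \<le> m" "k \<le> n" and p: "p \<in> positions m n" "p \<notin> Z"
  shows "(\<integral>\<^sup>+X. ennreal (opt_cost {1..m} {1..n} X k) \<partial>RAP_measure m n Z) =
    (\<integral>\<^sup>+X. ennreal (opt_cost {1..m} {1..n} X k) \<partial>RAP_measure m n (insert p Z)) +
    emeasure (RAP_measure m n Z) {X\<in>space (RAP_measure m n Z). forced k m n p X}"
proof -
  define N where "N = PiM (positions m n - {p}) (entry_distribution Z)"
  have N': "PiM (positions m n - {p}) (entry_distribution (insert p Z)) = N"
    unfolding N_def by (intro PiM_cong) (auto simp: entry_distribution_def)
  have space_upd: "x(p := y) \<in> space (RAP_measure m n Z')" if "x \<in> space N" for x y Z'
    using that p by (auto simp: RAP_measure_def N_def space_PiM PiE_def extensional_def)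
  have upd: "(\<lambda>(x, y). x(p := y)) \<in> measurable (N \<Otimes>\<^sub>M entry_distribution Z p) (RAP_measure m n Z)"
  proof -
    have "insert p (positions m n - {p}) = positions m n" using p by auto
    then show ?thesis
      using measurable_add_dim[where I = "positions m n - {p}" and M = "entry_distribution Z" and i = p]
      by (simp add: N_def RAP_measure_def)
  qed
  have meas_upd: "(\<lambda>x. f (x(p := y))) \<in> borel_measurable N" if "f \<in> borel_measurable (RAP_measure m n Z)" for f :: "_ \<Rightarrow> ennreal" and y
  proof -
    have "(\<lambda>x. x(p := y)) \<in> measurable N (PiM (insert p (positions m n - {p})) (entry_distribution Z))"
      unfolding N_def by (rule measurable_fun_upd[where J = "positions m n - {p}"]) auto
    moreover have "insert p (positions m n - {p}) = positions m n" using p by auto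
    ultimately show ?thesis using that by (auto simp: RAP_measure_def intro: measurable_compose)
  qed
  have nnN: "AE x in N. \<forall>q\<in>positions m n - {p}. 0 \<le> x q"
    unfolding N_def
  proof (rule AE_finite_allI)
    fix q assume "q \<in> positions m n - {p}"
    then show "AE x in PiM (positions m n - {p}) (entry_distribution Z). 0 \<le> x q"
      by (rule AE_PiM_component[of "positions m n - {p}" "entry_distribution Z" q "\<lambda>y. 0 \<le> y", rotated])
         (use prob_space_entry_distribution AE_entry_nonneg in auto)
  qed simp
  \<comment> \<open>The conditional probability that \<open>p\<close> is used, given the other
    entries \<open>x\<close>.\<close>
  define h where "h x = (\<integral>\<^sup>+y. indicator {X\<in>space (RAP_measure m n Z). forced k m n p X} (x(p := y)) \<partial>exp1)" for x
  define f where "f X = ennreal (opt_cost {1..m} {1..n} X k)" for X :: "nat \<times> nat \<Rightarrow> real"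
  have fm: "f \<in> borel_measurable (RAP_measure m n Z')" for Z'
    unfolding f_def using measurable_RAP_opt_cost by measurable
  have key: "AE x in N. (\<integral>\<^sup>+y. f (x(p := y)) \<partial>exp1) = f (x(p := 0)) + h x"
    using nnN AE_space
  proof eventually_elim
    case (elim x)
    obtain c :: ennreal where c: "\<And>y. 0 \<le> y \<Longrightarrow> f (x(p := y)) = f (x(p := 0)) + min (ennreal y) c"
      "\<And>y. 0 \<le> y \<Longrightarrow> forced k m n p (x(p := y)) \<longleftrightarrow> ennreal y < c"
      using opt_cost_single_entry[of "{1..m}" "{1..n}" k p x] k elim(1)
      unfolding f_def forced_def by (auto simp: positions_def)
    have "(\<integral>\<^sup>+y. f (x(p := y)) \<partial>exp1) = (\<integral>\<^sup>+y. f (x(p := 0)) + min (ennreal y) c \<partial>exp1)"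
      using AE_exp1_pos by (intro nn_integral_cong_AE) (auto elim!: eventually_mono intro!: c(1))
    also have "\<dots> = f (x(p := 0)) + (\<integral>\<^sup>+y. min (ennreal y) c \<partial>exp1)"
    proof (subst nn_integral_add)
      show "(\<lambda>y. min (ennreal y) c) \<in> borel_measurable exp1" by measurable
      show "(\<integral>\<^sup>+y. f (x(p := 0)) \<partial>exp1) + (\<integral>\<^sup>+y. min (ennreal y) c \<partial>exp1) =
          f (x(p := 0)) + (\<integral>\<^sup>+y. min (ennreal y) c \<partial>exp1)"
        using prob_space.emeasure_space_1[OF prob_space_exp1] by simp
    qed simp
    also have "(\<integral>\<^sup>+y. min (ennreal y) c \<partial>exp1) = (\<integral>\<^sup>+y. indicator {y. ennreal y < c} y \<partial>exp1)"
      by (simp add: nn_integral_exp1_min)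
    also have "\<dots> = h x"
      unfolding h_def using AE_exp1_pos
      by (intro nn_integral_cong_AE) (auto elim!: eventually_mono simp: indicator_def c(2) space_upd[OF elim(2)])
    finally show ?case .
  qed
  have [measurable]: "f \<in> borel_measurable (RAP_measure m n Z)" by (rule fm)
  have "(\<integral>\<^sup>+X. f X \<partial>RAP_measure m n Z) = (\<integral>\<^sup>+x. \<integral>\<^sup>+y. f (x(p := y)) \<partial>exp1 \<partial>N)"
    using nn_integral_RAP_split[OF p(1) fm] p(2) by (simp add: N_def entry_distribution_nonzero)
  also have "\<dots> = (\<integral>\<^sup>+x. f (x(p := 0)) + h x \<partial>N)" using key by (rule nn_integral_cong_AE)
  also have "\<dots> = (\<integral>\<^sup>+x. f (x(p := 0)) \<partial>N) + (\<integral>\<^sup>+x. h x \<partial>N)"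
  proof (rule nn_integral_add)
    show "(\<lambda>x. f (x(p := 0))) \<in> borel_measurable N" by (rule meas_upd) (rule fm)
    interpret E: prob_space exp1 by (rule prob_space_exp1)
    have [measurable]: "(\<lambda>(x, y). x(p := y)) \<in> measurable (N \<Otimes>\<^sub>M exp1) (RAP_measure m n Z)"
      using upd p(2) by (simp add: entry_distribution_nonzero)
    have "(\<lambda>(x, y). indicator {X\<in>space (RAP_measure m n Z). forced k m n p X} (x(p := y)) :: ennreal) \<in> borel_measurable (N \<Otimes>\<^sub>M exp1)"
      by measurable
    then show "h \<in> borel_measurable N" unfolding h_def by (rule E.borel_measurable_nn_integral)
  qed
  also have "(\<integral>\<^sup>+x. f (x(p := 0)) \<partial>N) = (\<integral>\<^sup>+X. f X \<partial>RAP_measure m n (insert p Z))"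
  proof -
    have "(\<integral>\<^sup>+y. f (x(p := y)) \<partial>entry_distribution (insert p Z) p) = f (x(p := 0))" if x: "x \<in> space N" for x
    proof -
      have "(\<lambda>y. x(p := y)) \<in> measurable (entry_distribution Z p) (RAP_measure m n Z)"
        using measurable_Pair2[OF upd x] by simp
      then have "(\<lambda>y. f (x(p := y))) \<in> borel_measurable (entry_distribution Z p)"
        by (rule measurable_compose[OF _ fm])
      then have "(\<lambda>y. f (x(p := y))) \<in> borel_measurable borel"
        by (simp cong: measurable_cong_sets)
      then show ?thesis by (simp add: entry_distribution_def nn_integral_return)
    qed
    then have "(\<integral>\<^sup>+x. f (x(p := 0)) \<partial>N) =
        (\<integral>\<^sup>+x. \<integral>\<^sup>+y. f (x(p := y)) \<partial>entry_distribution (insert p Z) p \<partial>N)"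
      by (intro nn_integral_cong) simp
    then show ?thesis using nn_integral_RAP_split[OF p(1) fm, of "insert p Z"] N' by simp
  qed
  also have "(\<integral>\<^sup>+x. h x \<partial>N) = (\<integral>\<^sup>+X. indicator {X\<in>space (RAP_measure m n Z). forced k m n p X} X \<partial>RAP_measure m n Z)"
    unfolding h_def using p(2)
    by (subst nn_integral_RAP_split[OF p(1)]) (auto simp: N_def entry_distribution_nonzero)
  also have "\<dots> = emeasure (RAP_measure m n Z) {X\<in>space (RAP_measure m n Z). forced k m n p X}" by simp
  finally show ?thesis by (simp add: f_def)
qed

lemma AE_RAP_nonneg: "AE X in RAP_measure m n Z. \<forall>p\<in>positions m n. 0 \<le> X p"
  using AE_RAP_entry[OF _ AE_entry_nonneg] by (subst AE_finite_all) auto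

lemma AE_RAP_zero: "AE X in RAP_measure m n Z. \<forall>p\<in>positions m n \<inter> Z. X p = 0"
  using AE_RAP_entry[OF _ AE_entry_zero] by (subst AE_finite_all) auto

lemma AE_RAP_pos: "AE X in RAP_measure m n Z. \<forall>p\<in>positions m n - Z. 0 < X p"
proof -
  have "AE X in RAP_measure m n Z. 0 < X p" if "p \<in> positions m n - Z" for p
  proof (rule AE_RAP_entry)
    have "entry_distribution Z p = exp1" using that by (intro entry_distribution_nonzero) auto
    then show "AE y in entry_distribution Z p. 0 < y" using AE_exp1_pos by metis
  qed (use that in auto)
  then show ?thesis by (subst AE_finite_all) auto
qed

lemma opt_cost_nonneg:
  assumes "finite R" "finite C" "k \<le> card R" "k \<le> card C" "\<forall>p\<in>R \<times> C. 0 \<le> X p"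
  shows "0 \<le> opt_cost R C X k"
proof -
  obtain A where A: "A \<in> asg R C k" "sum X A = opt_cost R C X k" using opt_cost_attained[OF assms(1-4)] by blast
  then show ?thesis using asgD(1)[OF A(1)] assms(5) by (metis subsetD sum_nonneg)
qed

text \<open>Induction on the number of nonzero positions: with zeros only, the cost vanishes, and
  releasing one position adds a probability. Finiteness allows the passage to real-valued
  expectations.\<close>

lemma nn_integral_opt_cost_finite:
  assumes k: "k \<le> m" "k \<le> n"
  shows "(\<integral>\<^sup>+X. ennreal (opt_cost {1..m} {1..n} X k) \<partial>RAP_measure m n Z) < \<infinity>"
proof (induction "card (positions m n - Z)" arbitrary: Z)
  case 0
  then have sub: "positions m n \<subseteq> Z" by simp
  have "AE X in RAP_measure m n Z. ennreal (opt_cost {1..m} {1..n} X k) = 0"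
    using AE_RAP_zero
  proof eventually_elim
    case (elim X)
    obtain A where A: "A \<in> asg {1..m} {1..n} k" "sum X A = opt_cost {1..m} {1..n} X k"
      using opt_cost_attained[of "{1..m}" "{1..n}" k X] k by auto
    have "sum X A = 0" using elim sub asgD(1)[OF A(1)] by (intro sum.neutral) (auto simp: positions_def)
    then show ?case using A by simp
  qed
  then have "(\<integral>\<^sup>+X. ennreal (opt_cost {1..m} {1..n} X k) \<partial>RAP_measure m n Z) = 0"
    by (subst nn_integral_cong_AE) auto
  then show ?case by simp
next
  case (Suc c)
  then obtain p where p: "p \<in> positions m n" "p \<notin> Z" by (metis DiffE card.empty ex_in_conv nat.distinct(1))
  have "positions m n - insert p Z = (positions m n - Z) - {p}" by auto
  then have "card (positions m n - insert p Z) = c" using Suc(2) p by simp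
  then have "(\<integral>\<^sup>+X. ennreal (opt_cost {1..m} {1..n} X k) \<partial>RAP_measure m n (insert p Z)) < \<infinity>" using Suc(1) by simp
  moreover interpret prob_space "RAP_measure m n Z" by (rule prob_space_RAP)
  have "emeasure (RAP_measure m n Z) {X\<in>space (RAP_measure m n Z). forced k m n p X} < \<infinity>"
    by (simp add: less_top[symmetric])
  ultimately show ?case unfolding nn_integral_opt_cost_insert_zero[OF k p] by simp
qed

lemma expected_min_cost_insert_zero:
  assumes k: "k \<le> m" "k \<le> n" and p: "p \<in> positions m n" "p \<notin> Z"
  shows "expected_min_cost k m n Z = expected_min_cost k m n (insert p Z) +
    measure (RAP_measure m n Z) {X\<in>space (RAP_measure m n Z). forced k m n p X}"
proof -
  have E: "expected_min_cost k m n Z' = enn2real (\<integral>\<^sup>+X. ennreal (opt_cost {1..m} {1..n} X k) \<partial>RAP_measure m n Z')" for Z'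
    unfolding expected_min_cost_def min_cost_eq[abs_def]
  proof (rule integral_eq_nn_integral)
    show "(\<lambda>X. opt_cost {1..m} {1..n} X k) \<in> borel_measurable (RAP_measure m n Z')" by (rule measurable_RAP_opt_cost)
    show "AE X in RAP_measure m n Z'. 0 \<le> opt_cost {1..m} {1..n} X k"
      using AE_RAP_nonneg by eventually_elim (use k in \<open>auto intro!: opt_cost_nonneg simp: positions_def\<close>)
  qed
  interpret prob_space "RAP_measure m n Z" by (rule prob_space_RAP)
  show ?thesis
    unfolding E nn_integral_opt_cost_insert_zero[OF k p] measure_def
    using nn_integral_opt_cost_finite[OF k, of "insert p Z"] by (intro enn2real_plus) (auto simp: less_top[symmetric])
qed

text \<open>Given all other entries, equality pins \<open>X p\<close> to one value, and the
  exponential law has no atoms.\<close>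

lemma AE_RAP_sum_neq:
  assumes A: "A \<subseteq> positions m n" and B: "B \<subseteq> positions m n" and p: "p \<in> A" "p \<notin> B" "p \<notin> Z"
  shows "AE X in RAP_measure m n Z. sum X A \<noteq> sum X B"
proof -
  have fin: "finite A" "finite B" using A B finite_subset finite_positions by blast+
  have pp: "p \<in> positions m n" using A p by auto
  have meas: "(\<lambda>X. sum X S) \<in> borel_measurable (RAP_measure m n Z)" if "S \<subseteq> positions m n" for S
    using that by (intro borel_measurable_sum measurable_RAP_component) auto
  have ms: "{X\<in>space (RAP_measure m n Z). sum X A = sum X B} \<in> sets (RAP_measure m n Z)"
    by (rule borel_measurable_eq[OF meas[OF A] meas[OF B]])
  define N where "N = PiM (positions m n - {p}) (entry_distribution Z)"
  have "emeasure (RAP_measure m n Z) {X\<in>space (RAP_measure m n Z). sum X A = sum X B} =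
      (\<integral>\<^sup>+X. indicator {X\<in>space (RAP_measure m n Z). sum X A = sum X B} X \<partial>RAP_measure m n Z)"
    using ms by simp
  also have "\<dots> = (\<integral>\<^sup>+x. \<integral>\<^sup>+y. indicator {X\<in>space (RAP_measure m n Z). sum X A = sum X B} (x(p := y)) \<partial>exp1 \<partial>N)"
    unfolding N_def using ms p(3)
    by (subst nn_integral_RAP_split[OF pp]) (auto simp: entry_distribution_nonzero)
  also have "\<dots> = (\<integral>\<^sup>+x. 0 \<partial>N)"
  proof (rule nn_integral_cong)
    fix x
    have "AE y in exp1. indicator {X\<in>space (RAP_measure m n Z). sum X A = sum X B} (x(p := y)) = (0::ennreal)"
      using AE_exp1_neq[of "sum x B - sum x (A - {p})"]
    proof eventually_elim
      case (elim y)
      have "sum (x(p := y)) A = (x(p := y)) p + sum (x(p := y)) (A - {p})"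
        using fin p by (intro sum.remove) auto
      also have "sum (x(p := y)) (A - {p}) = sum x (A - {p})" by (intro sum.cong) auto
      finally have "sum (x(p := y)) A = y + sum x (A - {p})" by simp
      moreover have "sum (x(p := y)) B = sum x B" using p by (intro sum.cong) auto
      ultimately show ?case using elim by (auto simp: indicator_def)
    qed
    then show "(\<integral>\<^sup>+y. indicator {X\<in>space (RAP_measure m n Z). sum X A = sum X B} (x(p := y)) \<partial>exp1) = (0::ennreal)"
      by (subst nn_integral_cong_AE) auto
  qed
  finally have "emeasure (RAP_measure m n Z) {X\<in>space (RAP_measure m n Z). sum X A = sum X B} = 0" by simp
  then show ?thesis using ms by (intro AE_I[where N = "{X\<in>space (RAP_measure m n Z). sum X A = sum X B}"]) auto
qed

lemma AE_generic_matrix: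
  assumes Z: "Z \<subseteq> positions m n"
  shows "AE X in RAP_measure m n Z. generic_matrix {1..m} {1..n} Z X"
proof -
  define T where "T = {(A,B). A \<subseteq> positions m n \<and> B \<subseteq> positions m n \<and> A - Z \<noteq> B - Z}"
  have "finite T" by (rule finite_subset[of _ "Pow (positions m n) \<times> Pow (positions m n)"]) (auto simp: T_def)
  moreover have "AE X in RAP_measure m n Z. sum X (fst q) \<noteq> sum X (snd q)" if qT: "q \<in> T" for q
  proof -
    obtain A B where q: "q = (A, B)" "A \<subseteq> positions m n" "B \<subseteq> positions m n" "A - Z \<noteq> B - Z"
      using qT unfolding T_def by blast
    then consider p where "p \<in> A" "p \<notin> B" "p \<notin> Z" | p where "p \<in> B" "p \<notin> A" "p \<notin> Z" by blast
    then show ?thesis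
    proof cases
      case (1 p)
      then show ?thesis using AE_RAP_sum_neq[OF q(2,3)] q(1) by simp
    next
      case (2 p)
      then have "AE X in RAP_measure m n Z. sum X B \<noteq> sum X A" using AE_RAP_sum_neq[OF q(3,2)] by blast
      then show ?thesis by eventually_elim (use q(1) in auto)
    qed
  qed
  ultimately have "AE X in RAP_measure m n Z. \<forall>q\<in>T. sum X (fst q) \<noteq> sum X (snd q)"
    by (subst AE_finite_all) auto
  then show ?thesis using AE_RAP_zero AE_RAP_pos
  proof eventually_elim
    case (elim X)
    show ?case
    proof
      fix s A B assume AB: "A \<in> asg {1..m} {1..n} s" "B \<in> asg {1..m} {1..n} s" "sum X A = sum X B"
      then have "A \<subseteq> positions m n" "B \<subseteq> positions m n" using asgD(1) unfolding positions_def by blast+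
      moreover have "(A, B) \<notin> T" using elim(1) AB(3) by auto
      ultimately show "A - Z = B - Z" unfolding T_def by blast
    qed (use elim Z in \<open>auto simp: positions_def\<close>)
  qed
qed

section \<open>The probability that a row without zeros is used\<close>

lemma cover_number_loop:
  assumes "\<And>j. (m, j) \<notin> Z"
  shows "cover_number Z C (E - {m}) = cover_number Z C E"
proof -
  have "{i\<in>E - {m}. \<exists>j\<in>C - K. (i,j) \<in> Z} = {i\<in>E. \<exists>j\<in>C - K. (i,j) \<in> Z}" for K
    using assms by auto
  then show ?thesis by (simp add: cover_number_def)
qed

text \<open>\<open>stage_prob k Z C m s D\<close> is the conditional probability that row \<open>m\<close> is used at size \<open>k\<close>,
  given that \<open>D\<close> is the set of avoidable rows at size \<open>s\<close>.\<close>

definition stage_prob :: "nat \<Rightarrow> ('a \<times> 'b) set \<Rightarrow> 'b set \<Rightarrow> 'a \<Rightarrow> nat \<Rightarrow> 'a set \<Rightarrow> real" where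
  "stage_prob k Z C m s D = (if m \<in> D then row_prob Z C m (cover_number Z C D + (k - s)) D else 1)"

text \<open>If row \<open>m\<close> enters, it is no longer avoidable and the value is
  \<open>1\<close>; otherwise the coloops of \<open>D - {a}\<close> may be kept, by
  \<open>row_prob_noncoloops\<close>. As \<open>D\<close> has no coloops, deleting \<open>a\<close>
  does not lower the rank, so the sum over \<open>a\<close> is the recursion of
  \<open>row_prob\<close>.\<close>

lemma stage_prob_step:
  assumes fin: "finite C" "finite D" and ne: "D \<noteq> {}" and sk: "s < k" and m: "\<And>j. (m, j) \<notin> Z"
    and cl: "\<And>a. a \<in> D \<Longrightarrow> cover_number Z C (D - {a}) = cover_number Z C D"
  shows "(\<Sum>a\<in>D. stage_prob k Z C m (s + 1) (noncoloops Z C (D - {a}))) = real (card D) * stage_prob k Z C m s D"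
proof (cases "m \<in> D")
  case False
  then show ?thesis by (simp add: stage_prob_def noncoloops_def)
next
  case True
  define l where "l = cover_number Z C D + (k - Suc s)"
  have "stage_prob k Z C m (s + 1) (noncoloops Z C (D - {a})) = row_prob Z C m l (D - {a})"
    if a: "a \<in> D - {m}" for a
  proof -
    have mnc: "m \<in> noncoloops Z C (D - {a})"
      using True a cover_number_loop[OF m, of C "D - {a}"] by (auto simp: noncoloops_def)
    then have "stage_prob k Z C m (s + 1) (noncoloops Z C (D - {a})) =
        row_prob Z C m (cover_number Z C (D - {a}) + (k - Suc s)) (D - {a})"
      using row_prob_noncoloops[OF fin(1) _ mnc, of "k - Suc s"] fin by (simp add: stage_prob_def)
    then show ?thesis using cl[of a] a by (simp add: l_def)
  qed
  moreover have "stage_prob k Z C m (s + 1) (noncoloops Z C (D - {m})) = 1"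
    by (simp add: stage_prob_def noncoloops_def)
  ultimately have "(\<Sum>a\<in>D. stage_prob k Z C m (s + 1) (noncoloops Z C (D - {a}))) =
      1 + (\<Sum>a\<in>D - {m}. row_prob Z C m l (D - {a}))"
    using fin True by (subst sum.remove[of D m]) auto
  also have "\<dots> = real (card D) * row_prob Z C m (Suc l) D"
    using fin ne by (simp add: l_def)
  also have "Suc l = cover_number Z C D + (k - s)" using sk by (simp add: l_def)
  finally show ?thesis using True by (simp add: stage_prob_def)
qed

text \<open>Integrates an identity between finite combinations of indicators, so that conditioning
  on \<open>D\<close> reduces to case distinctions for a fixed matrix.\<close>

lemma (in prob_space) sum_prob_eq_AE:
  fixes c :: "'i \<Rightarrow> real" and d :: "'j \<Rightarrow> real"
  assumes "finite I" "finite J" "\<And>i. i \<in> I \<Longrightarrow> A i \<in> events" "\<And>j. j \<in> J \<Longrightarrow> B j \<in> events"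
    and AE: "AE x in M. (\<Sum>i\<in>I. c i * indicator (A i) x) = (\<Sum>j\<in>J. d j * indicator (B j) x)"
  shows "(\<Sum>i\<in>I. c i * prob (A i)) = (\<Sum>j\<in>J. d j * prob (B j))"
proof -
  have "(\<Sum>i\<in>I. c i * prob (A i)) = (\<integral>x. (\<Sum>i\<in>I. c i * indicator (A i) x) \<partial>M)"
    using assms(3) by (subst Bochner_Integration.integral_sum) (auto simp: less_top[symmetric])
  also have "\<dots> = (\<integral>x. (\<Sum>j\<in>J. d j * indicator (B j) x) \<partial>M)"
    using AE assms(3,4) by (intro integral_cong_AE) (auto intro!: borel_measurable_sum borel_measurable_times borel_measurable_indicator)
  also have "\<dots> = (\<Sum>j\<in>J. d j * prob (B j))"
    using assms(4) by (subst Bochner_Integration.integral_sum) (auto simp: less_top[symmetric])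
  finally show ?thesis .
qed

section \<open>Measurability of the events about optimal assignments, and uniformity of the entering
  row\<close>

lemma measurable_ex_optimal:
  assumes "\<A> \<subseteq> asg {1..m} {1..n} s"
  shows "Measurable.pred (RAP_measure m n Z) (\<lambda>X. \<exists>A\<in>\<A>. sum X A = opt_cost {1..m} {1..n} X s)"
proof (rule pred_intros_finite(4))
  show "finite \<A>" using finite_asg[of "{1..m}" "{1..n}" s] assms finite_subset by auto
  show "Measurable.pred (RAP_measure m n Z) (\<lambda>X. sum X A = opt_cost {1..m} {1..n} X s)" if "A \<in> \<A>" for A
    using assms that by (intro measurable_RAP_optimal) auto
qed

lemma measurable_mem_avoidable:
  "Measurable.pred (RAP_measure m n Z) (\<lambda>X. e \<in> avoidable {1..m} {1..n} X s)"
proof -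
  have eq: "e \<in> avoidable {1..m} {1..n} X s \<longleftrightarrow>
      (\<exists>A\<in>{A\<in>asg {1..m} {1..n} s. e \<in> {1..m} \<and> e \<notin> fst ` A}. sum X A = opt_cost {1..m} {1..n} X s)" for X
    unfolding avoidable_def by blast
  show ?thesis unfolding eq by (rule measurable_ex_optimal) blast
qed

lemma measurable_avoidable_eq:
  "Measurable.pred (RAP_measure m n Z) (\<lambda>X. avoidable {1..m} {1..n} X s = D)"
proof (cases "D \<subseteq> {1..m}")
  case True
  have eq: "avoidable {1..m} {1..n} X s = D \<longleftrightarrow>
      (\<forall>e\<in>D. e \<in> avoidable {1..m} {1..n} X s) \<and> (\<forall>e\<in>{1..m} - D. e \<notin> avoidable {1..m} {1..n} X s)" for X
  proof -
    have "avoidable {1..m} {1..n} X s \<subseteq> {1..m}" unfolding avoidable_def by blast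
    then show ?thesis using True by blast
  qed
  have fin: "finite D" "finite ({1..m} - D)" using finite_subset[OF True] by auto
  show ?thesis
    unfolding eq
    by (intro pred_intros_logic(3) pred_intros_finite(3)[OF fin(1)] pred_intros_finite(3)[OF fin(2)]
        pred_intros_logic(2) measurable_mem_avoidable)
next
  case False
  then have eq: "avoidable {1..m} {1..n} X s = D \<longleftrightarrow> False" for X unfolding avoidable_def by blast
  show ?thesis unfolding eq by (rule measurable_const) simp
qed

lemma measurable_enters:
  "Measurable.pred (RAP_measure m n Z) (\<lambda>X. enters {1..m} {1..n} Z X s D a)"
proof -
  define \<A> where "\<A> = {A\<in>asg {1..m} {1..n} (s + 1). a \<in> D \<and> (\<exists>j. (a,j) \<in> A \<and> j \<notin> Z `` D)}"
  have eq: "enters {1..m} {1..n} Z X s D a \<longleftrightarrow>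
      avoidable {1..m} {1..n} X s = D \<and> (\<exists>A\<in>\<A>. sum X A = opt_cost {1..m} {1..n} X (s + 1))" for X
    unfolding enters_def optimal_def \<A>_def by blast
  have "\<A> \<subseteq> asg {1..m} {1..n} (s + 1)" unfolding \<A>_def by blast
  then show ?thesis
    unfolding eq by (intro pred_intros_logic(3) measurable_avoidable_eq measurable_ex_optimal)
qed

lemma generic_stepI:
  assumes "generic_matrix {1..m} {1..n} Z X" "s < m" "s < n" "cover_number Z {1..n} {1..m} \<le> s"
  shows "generic_step {1..m} {1..n} Z X s"
  using assms by (intro generic_step.intro generic_step_axioms.intro) auto

text \<open>The map \<open>T\<close> swaps rows \<open>a\<close> and \<open>b\<close> outside the
  columns with zeros in \<open>D\<close>. There both rows consist of \<open>Exp(1)\<close> entries,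
  so \<open>T\<close> preserves the law, and by \<open>enters_swap\<close> it carries one event into
  the other up to a null set. One inequality is enough, as \<open>a\<close> and \<open>b\<close> are
  interchangeable.\<close>

lemma prob_enters_le:
  assumes Z: "Z \<subseteq> positions m n" and s: "s < m" "s < n" "cover_number Z {1..n} {1..m} \<le> s"
    and ab: "a \<in> D" "b \<in> D"
  shows "measure (RAP_measure m n Z) {X\<in>space (RAP_measure m n Z). enters {1..m} {1..n} Z X s D a} \<le>
    measure (RAP_measure m n Z) {X\<in>space (RAP_measure m n Z). enters {1..m} {1..n} Z X s D b}"
proof (cases "D \<subseteq> {1..m}")
  case False
  then have "\<not> enters {1..m} {1..n} Z X s D a" for X by (auto simp: enters_def avoidable_def)
  then show ?thesis by simp
next
  case True
  let ?av = "\<lambda>X. avoidable {1..m} {1..n} X s"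
  interpret prob_space "RAP_measure m n Z" by (rule prob_space_RAP)
  define P where "P = RAP_measure m n Z"
  define \<sigma> where "\<sigma> = (\<lambda>(i,j). if j \<in> Z `` D then (i,j) else (Transposition.transpose a b i, j))"
  define T where "T X = (\<lambda>p\<in>positions m n. X (\<sigma> p))" for X :: "nat \<times> nat \<Rightarrow> real"
  have abm: "a \<in> {1..m}" "b \<in> {1..m}" using True ab by auto
  have \<sigma>: "\<sigma> \<in> positions m n \<rightarrow> positions m n" "inj_on \<sigma> (positions m n)"
  proof -
    show "\<sigma> \<in> positions m n \<rightarrow> positions m n"
      using abm by (auto simp: \<sigma>_def positions_def Transposition.transpose_def)
    show "inj_on \<sigma> (positions m n)"
      by (auto simp: inj_on_def \<sigma>_def split: if_splits dest: injD[OF inj_transpose])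
  qed
  have eD: "entry_distribution Z (\<sigma> p) = entry_distribution Z p" for p
  proof (cases "p \<in> Z \<or> \<sigma> p \<in> Z")
    case True
    then have "\<sigma> p = p" using ab by (cases p) (auto simp: \<sigma>_def Transposition.transpose_def split: if_splits)
    then show ?thesis by simp
  qed (simp add: entry_distribution_nonzero)
  have PT: "distr P P T = P"
  proof -
    have "PiM (positions m n) (\<lambda>p. entry_distribution Z (\<sigma> p)) = P"
      unfolding P_def RAP_measure_def by (simp add: eD)
    then show ?thesis
      using distr_PiM_reindex[of "positions m n" "entry_distribution Z" \<sigma> "positions m n",
          OF prob_space_entry_distribution \<sigma>(2,1)]
      by (simp add: P_def RAP_measure_def T_def[abs_def])
  qed
  have T: "T \<in> measurable P P"
    unfolding P_def RAP_measure_def T_def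
  proof (rule measurable_restrict)
    fix p assume "p \<in> positions m n"
    then have "\<sigma> p \<in> positions m n" using \<sigma>(1) by auto
    then show "(\<lambda>X. X (\<sigma> p)) \<in> measurable (PiM (positions m n) (entry_distribution Z)) (entry_distribution Z p)"
      using measurable_component_singleton[of "\<sigma> p" "positions m n" "entry_distribution Z"] by (simp add: eD)
  qed
  have meas: "{X\<in>space P. enters {1..m} {1..n} Z X s D c} \<in> sets P" for c
    using measurable_enters[of m n Z s D c] by (simp add: P_def pred_def)
  have "measure P {X\<in>space P. enters {1..m} {1..n} Z X s D a} \<le> measure P (T -` {X\<in>space P. enters {1..m} {1..n} Z X s D b} \<inter> space P)"
    unfolding P_def
  proof (rule finite_measure_mono_AE)
    show "T -` {X \<in> space (RAP_measure m n Z). enters {1..m} {1..n} Z X s D b} \<inter> space (RAP_measure m n Z) \<in> events"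
      using measurable_sets[OF T meas[of b]] by (simp add: P_def)
    show "AE X in RAP_measure m n Z. X \<in> {X \<in> space (RAP_measure m n Z). enters {1..m} {1..n} Z X s D a} \<longrightarrow>
        X \<in> T -` {X \<in> space (RAP_measure m n Z). enters {1..m} {1..n} Z X s D b} \<inter> space (RAP_measure m n Z)"
      using AE_generic_matrix[OF Z] AE_space
    proof eventually_elim
      case (elim X)
      show ?case
      proof
        assume "X \<in> {X \<in> space (RAP_measure m n Z). enters {1..m} {1..n} Z X s D a}"
        then have e: "enters {1..m} {1..n} Z X s D a" by simp
        then have D: "?av X = D" by (simp add: enters_def)
        interpret generic_step "{1..m}" "{1..n}" Z X s "?av X" "Z `` ?av X"
            "opt_cost {1..m} {1..n} X (s + 1) - opt_cost {1..m} {1..n} X s"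
          using generic_stepI[OF elim(1) s] by simp_all
        have "enters {1..m} {1..n} Z (T X) s (?av X) b"
        proof (rule enters_swap)
          show "enters {1..m} {1..n} Z X s (?av X) a" using e D by simp
          show "b \<in> ?av X" using ab D by simp
          show "T X (i,j) = (if j \<in> Z `` ?av X then X (i,j) else X (Transposition.transpose a b i, j))"
            if "i \<in> {1..m}" "j \<in> {1..n}" for i j
            using that D by (simp add: T_def \<sigma>_def positions_def)
        qed
        then show "X \<in> T -` {X \<in> space (RAP_measure m n Z). enters {1..m} {1..n} Z X s D b} \<inter> space (RAP_measure m n Z)"
          using elim(2) measurable_space[OF T] D by (simp add: P_def)
      qed
    qed
  qed
  also have "\<dots> = measure (distr P P T) {X\<in>space P. enters {1..m} {1..n} Z X s D b}"
    using T meas by (subst measure_distr) auto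
  finally show ?thesis unfolding PT by (simp add: P_def)
qed

text \<open>The expectation of \<open>stage_prob\<close> at the random set of avoidable rows; it
  will be constant in \<open>s\<close> from the rank up to \<open>k\<close>.\<close>

definition avoid_sum :: "nat \<Rightarrow> nat \<Rightarrow> nat \<Rightarrow> (nat \<times> nat) set \<Rightarrow> nat \<Rightarrow> real" where
  "avoid_sum k m n Z s = (\<Sum>D\<in>Pow {1..m}. stage_prob k Z {1..n} m s D *
    measure (RAP_measure m n Z) {X\<in>space (RAP_measure m n Z). avoidable {1..m} {1..n} X s = D})"

lemma sum_indicator_avoidable:
  fixes g :: "nat set \<Rightarrow> real"
  assumes "X \<in> S"
  shows "(\<Sum>D\<in>Pow {1..m}. g D * indicator {X\<in>S. avoidable {1..m} C X s = D} X) = g (avoidable {1..m} C X s)"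
proof -
  have "avoidable {1..m} C X s \<in> Pow {1..m}" by (auto simp: avoidable_def)
  moreover have "(\<Sum>D\<in>Pow {1..m}. g D * indicator {X\<in>S. avoidable {1..m} C X s = D} X) =
      (\<Sum>D\<in>Pow {1..m}. if avoidable {1..m} C X s = D then g D else 0)"
    using assms by (intro sum.cong) (auto simp: indicator_def)
  ultimately show ?thesis by simp
qed

text \<open>Given \<open>D\<close>, the entering row is uniform on \<open>D\<close>.\<close>

lemma avoid_sum_step:
  assumes Z: "Z \<subseteq> positions m n" and m: "\<And>j. (m, j) \<notin> Z"
    and s: "s < m" "s < n" "cover_number Z {1..n} {1..m} \<le> s" and sk: "s < k"
  shows "avoid_sum k m n Z (s + 1) = avoid_sum k m n Z s"
proof -
  let ?g = "\<lambda>q. stage_prob k Z {1..n} m (s + 1) (noncoloops Z {1..n} (fst q - {snd q}))"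
  let ?h = "\<lambda>q. stage_prob k Z {1..n} m s (fst q)"
  let ?av = "\<lambda>X. avoidable {1..m} {1..n} X s"
  interpret prob_space "RAP_measure m n Z" by (rule prob_space_RAP)
  define P where "P = RAP_measure m n Z"
  \<comment> \<open>These events refine the events that \<open>D\<close> is the avoidable set;
    almost surely exactly one of them occurs.\<close>
  define Q where "Q q = {X\<in>space P. enters {1..m} {1..n} Z X s (fst q) (snd q)}" for q
  define J where "J = (SIGMA D:Pow {1..m}. D)"
  have finJ: "finite J" unfolding J_def by (intro finite_SigmaI) (auto intro: finite_subset)
  have Qm: "Q q \<in> sets P" for q
    using measurable_enters[of m n Z s "fst q" "snd q"] by (simp add: P_def Q_def pred_def)
  have Am: "{X\<in>space P. avoidable {1..m} {1..n} X t = D} \<in> sets P" for t D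
    using measurable_avoidable_eq[of m n t D Z] by (simp add: P_def pred_def)
  have one: "(\<Sum>q\<in>J. g q * indicator (Q q) X) = g (?av X, a)"
    if X: "X \<in> space P" "generic_matrix {1..m} {1..n} Z X"
      and a: "enters {1..m} {1..n} Z X s (?av X) a"
    for g :: "nat set \<times> nat \<Rightarrow> real" and X a
  proof -
    interpret generic_step "{1..m}" "{1..n}" Z X s "?av X" "Z `` ?av X"
        "opt_cost {1..m} {1..n} X (s + 1) - opt_cost {1..m} {1..n} X s"
      using generic_stepI[OF X(2) s] by simp_all
    have "(\<Sum>q\<in>J. g q * indicator (Q q) X) = (\<Sum>q\<in>J. if q = (?av X, a) then g q else 0)"
    proof (rule sum.cong)
      fix q assume "q \<in> J"
      have "X \<in> Q q \<longleftrightarrow> q = (?av X, a)"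
        using enters_unique a X(1) by (cases q) (auto simp: Q_def enters_def)
      then show "g q * indicator (Q q) X = (if q = (?av X, a) then g q else 0)"
        by (simp add: indicator_def)
    qed simp
    moreover have "(?av X, a) \<in> J"
      using a by (auto simp: J_def enters_def avoidable_def)
    ultimately show ?thesis using finJ by simp
  qed
  have 1: "avoid_sum k m n Z s = (\<Sum>q\<in>J. ?h q * prob (Q q))"
    unfolding avoid_sum_def
  proof (rule sum_prob_eq_AE)
    show "AE X in RAP_measure m n Z.
        (\<Sum>D\<in>Pow {1..m}. stage_prob k Z {1..n} m s D *
          indicator {X\<in>space (RAP_measure m n Z). ?av X = D} X) =
        (\<Sum>q\<in>J. ?h q * indicator (Q q) X)"
      using AE_generic_matrix[OF Z] AE_space
    proof eventually_elim
      case (elim X)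
      interpret generic_step "{1..m}" "{1..n}" Z X s "?av X" "Z `` ?av X"
          "opt_cost {1..m} {1..n} X (s + 1) - opt_cost {1..m} {1..n} X s"
        using generic_stepI[OF elim(1) s] by simp_all
      obtain a where a: "enters {1..m} {1..n} Z X s (?av X) a" using enters_unique by blast
      show ?case
        unfolding sum_indicator_avoidable[OF elim(2)]
        using one[OF _ elim(1) a, of "?h"] elim(2)
        by (simp add: P_def)
    qed
  qed (use finJ Qm Am in \<open>auto simp: P_def\<close>)
  have 2: "avoid_sum k m n Z (s + 1) = (\<Sum>q\<in>J. ?g q * prob (Q q))"
    unfolding avoid_sum_def
  proof (rule sum_prob_eq_AE)
    show "AE X in RAP_measure m n Z.
        (\<Sum>D\<in>Pow {1..m}. stage_prob k Z {1..n} m (s + 1) D *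
          indicator {X\<in>space (RAP_measure m n Z). avoidable {1..m} {1..n} X (s + 1) = D} X) =
        (\<Sum>q\<in>J. ?g q * indicator (Q q) X)"
      using AE_generic_matrix[OF Z] AE_space
    proof eventually_elim
      case (elim X)
      interpret generic_step "{1..m}" "{1..n}" Z X s "?av X" "Z `` ?av X"
          "opt_cost {1..m} {1..n} X (s + 1) - opt_cost {1..m} {1..n} X s"
        using generic_stepI[OF elim(1) s] by simp_all
      obtain a where a: "enters {1..m} {1..n} Z X s (?av X) a" using enters_unique by blast
      show ?case
        unfolding sum_indicator_avoidable[OF elim(2)] avoidable_Suc[OF a]
        using one[OF _ elim(1) a, of "?g"] elim(2)
        by (simp add: P_def)
    qed
  qed (use finJ Qm Am in \<open>auto simp: P_def\<close>)
  have "(\<Sum>a\<in>D. stage_prob k Z {1..n} m (s + 1) (noncoloops Z {1..n} (D - {a})) * prob (Q (D,a))) =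
      (\<Sum>a\<in>D. stage_prob k Z {1..n} m s D * prob (Q (D,a)))" if D: "D \<in> Pow {1..m}" for D
  \<comment> \<open>A pair of positive probability is realized by some generic matrix, which
    supplies the deterministic facts about \<open>D\<close>; if all probabilities vanish, both sums
    are \<open>0\<close>.\<close>
  proof (cases "\<exists>a\<in>D. prob (Q (D,a)) \<noteq> 0")
    case True
    then obtain a where a: "a \<in> D" "prob (Q (D,a)) \<noteq> 0" by blast
    have "\<not> (AE X in RAP_measure m n Z. X \<notin> Q (D,a))"
    proof
      assume "AE X in RAP_measure m n Z. X \<notin> Q (D,a)"
      then have "prob (Q (D,a)) = 0" using Qm[of "(D,a)"] prob_eq_0 by (simp add: P_def)
      then show False using a by simp
    qed
    then have "\<exists>X\<in>Q (D,a). generic_matrix {1..m} {1..n} Z X"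
      using AE_generic_matrix[OF Z] by (metis (mono_tags, lifting) eventually_mono)
    then obtain X where X: "enters {1..m} {1..n} Z X s D a" "generic_matrix {1..m} {1..n} Z X" by (auto simp: Q_def)
    interpret generic_step "{1..m}" "{1..n}" Z X s "?av X" "Z `` ?av X"
        "opt_cost {1..m} {1..n} X (s + 1) - opt_cost {1..m} {1..n} X s"
      using generic_stepI[OF X(2) s] by simp_all
    have av: "?av X = D" using X(1) by (simp add: enters_def)
    have cl: "cover_number Z {1..n} (D - {b}) = cover_number Z {1..n} D" if "b \<in> D" for b
      using cover_number_D[of b] av that by simp
    have same: "prob (Q (D,b)) = prob (Q (D,a))" if "b \<in> D" for b
      using prob_enters_le[OF Z s a(1) that] prob_enters_le[OF Z s that a(1)] by (simp add: Q_def P_def)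
    have finD: "finite D" using D finite_subset by blast
    have "(\<Sum>a\<in>D. stage_prob k Z {1..n} m (s + 1) (noncoloops Z {1..n} (D - {a}))) = real (card D) * stage_prob k Z {1..n} m s D"
      by (rule stage_prob_step) (use finD a cl sk m in auto)
    then show ?thesis using same by (simp add: sum_distrib_right[symmetric] cong: sum.cong)
  qed simp
  then have eq: "(\<Sum>D\<in>Pow {1..m}. \<Sum>a\<in>D. stage_prob k Z {1..n} m (s + 1) (noncoloops Z {1..n} (D - {a})) * prob (Q (D,a))) =
      (\<Sum>D\<in>Pow {1..m}. \<Sum>a\<in>D. stage_prob k Z {1..n} m s D * prob (Q (D,a)))"
    by (rule sum.cong[OF refl])
  have J: "(\<Sum>D\<in>Pow {1..m}. \<Sum>a\<in>D. h (D,a)) = sum h J" for h :: "nat set \<times> nat \<Rightarrow> real"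
  proof -
    have "\<forall>D\<in>Pow {1..m}. finite D" using finite_subset[of _ "{1..m}"] by blast
    then show ?thesis unfolding J_def by (subst sum.Sigma) (auto simp: case_prod_unfold)
  qed
  show ?thesis
    unfolding 1 2
    using eq J[of "\<lambda>q. ?g q * prob (Q q)"]
      J[of "\<lambda>q. ?h q * prob (Q q)"]
    by simp
qed

section \<open>Start of the recursion: sizes up to the rank of \<open>Z\<close>\<close>

lemma (in generic_matrix) zero_cost_iff:
  assumes "A \<in> asg R C t"
  shows "sum X A = 0 \<longleftrightarrow> A \<subseteq> Z"
proof
  assume "sum X A = 0"
  have A: "A \<subseteq> R \<times> C" "finite A" using asgD(1)[OF assms] finite_of_asg[OF assms finite_R finite_C] by auto
  have nn: "0 \<le> X p" if "p \<in> A" for p using zero[of p] pos[of p] that A by (cases "p \<in> Z") auto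
  have "\<forall>p\<in>A. X p = 0" using \<open>sum X A = 0\<close> A(2) nn by (subst (asm) sum_nonneg_eq_0_iff) auto
  then show "A \<subseteq> Z" using pos A(1) by fastforce
next
  assume "A \<subseteq> Z"
  then show "sum X A = 0" using zero by (intro sum.neutral) blast
qed

lemma (in generic_matrix) opt_cost_eq_0:
  assumes "t \<le> cover_number Z C R"
  shows "\<exists>A\<in>asg R C t. A \<subseteq> Z" and "opt_cost R C X t = 0"
proof -
  obtain B where B: "B \<in> asg R C (cover_number Z C R)" "B \<subseteq> Z"
    using zero_asg_of_cover_number[OF finite_C finite_R] by blast
  obtain A where "A \<subseteq> B" "card A = t" using obtain_subset_with_card_n[of t B] asgD(2)[OF B(1)] assms by metis
  then have A: "A \<in> asg R C t" "A \<subseteq> Z" using B by (auto simp: asg_def intro: inj_on_subset)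
  then show "\<exists>A\<in>asg R C t. A \<subseteq> Z" by blast
  have "0 \<le> sum X S" if "S \<in> asg R C t" for S
  proof (rule sum_nonneg)
    fix p assume "p \<in> S"
    then show "0 \<le> X p" using zero[of p] pos[of p] asgD(1)[OF that] by (cases "p \<in> Z") auto
  qed
  moreover have "sum X A = 0" using zero_cost_iff[OF A(1)] A(2) by simp
  ultimately show "opt_cost R C X t = 0"
    unfolding opt_cost_def using A(1) finite_asg[OF finite_R finite_C] by (intro Min_eqI) (auto simp: image_iff)
qed

text \<open>At this size the optimal assignments are exactly the zero assignments, and Koenig's
  theorem translates the existence of one without row \<open>e\<close> into ranks. The initial
  avoidable set is thus not random.\<close>

lemma (in generic_matrix) avoidable_cover_number:
  "avoidable R C X (cover_number Z C R) = noncoloops Z C R"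
proof (intro equalityI subsetI)
  fix e assume "e \<in> avoidable R C X (cover_number Z C R)"
  then obtain A where A: "e \<in> R" "A \<in> asg R C (cover_number Z C R)" "sum X A = 0" "e \<notin> fst ` A"
    using opt_cost_eq_0(2)[of "cover_number Z C R"] by (auto simp: avoidable_def)
  have "A \<in> asg (R - {e}) C (cover_number Z C R)" using A(2,4) by (force simp: asg_def)
  moreover have "A \<subseteq> Z" using zero_cost_iff[OF A(2)] A(3) by simp
  ultimately have "cover_number Z C R \<le> cover_number Z C (R - {e})"
    using finite_C finite_R by (intro zero_asg_le_cover_number) auto
  then show "e \<in> noncoloops Z C R"
    using A(1) cover_number_mono[OF finite_C finite_R, of "R - {e}" Z] by (auto simp: noncoloops_def)
next
  fix e assume e: "e \<in> noncoloops Z C R"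
  obtain B where B: "B \<in> asg (R - {e}) C (cover_number Z C (R - {e}))" "B \<subseteq> Z"
    using zero_asg_of_cover_number[OF finite_C, of "R - {e}" Z] finite_R by auto
  have eq: "cover_number Z C (R - {e}) = cover_number Z C R" and eR: "e \<in> R" using e by (auto simp: noncoloops_def)
  have B': "B \<in> asg R C (cover_number Z C R)" using B(1) asg_mono[of "R - {e}" R C C] eq by auto
  have "e \<notin> fst ` B" using asgD(1)[OF B(1)] by auto
  moreover have "sum X B = 0" using zero_cost_iff[OF B'] B(2) by simp
  ultimately show "e \<in> avoidable R C X (cover_number Z C R)"
    using B' eR opt_cost_eq_0(2)[of "cover_number Z C R"] unfolding avoidable_def by auto
qed

text \<open>Up to the rank, zeros suffice and row \<open>m\<close> has none, so both sides are
  \<open>0\<close>. Beyond it, \<open>avoid_sum\<close> does not change between the rank and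
  \<open>k\<close>, and it is evaluated at both ends.\<close>

lemma prob_row_used:
  assumes Z: "Z \<subseteq> positions m n" and m: "\<And>j. (m, j) \<notin> Z" and k: "0 < k" "k \<le> m" "k \<le> n"
  shows "measure (RAP_measure m n Z) {X\<in>space (RAP_measure m n Z). m \<notin> avoidable {1..m} {1..n} X k} =
    row_prob Z {1..n} m k {1..m}"
proof -
  interpret prob_space "RAP_measure m n Z" by (rule prob_space_RAP)
  define r where "r = cover_number Z {1..n} {1..m}"
  have mM: "m \<in> {1..m}" using k by auto
  have ev: "{X\<in>space (RAP_measure m n Z). m \<notin> avoidable {1..m} {1..n} X k} \<in> events"
    using pred_intros_logic(2)[OF measurable_mem_avoidable[of m m n k Z]] by (simp add: pred_def)
  have Am: "{X\<in>space (RAP_measure m n Z). avoidable {1..m} {1..n} X t = D} \<in> events" for t D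
    using measurable_avoidable_eq[of m n t D Z] by (simp add: pred_def)
  show ?thesis
  proof (cases "k \<le> r")
    case True
    have "AE X in RAP_measure m n Z. X \<notin> {X\<in>space (RAP_measure m n Z). m \<notin> avoidable {1..m} {1..n} X k}"
      using AE_generic_matrix[OF Z]
    proof eventually_elim
      case (elim X)
      then interpret generic_matrix "{1..m}" "{1..n}" Z X .
      obtain A where A: "A \<in> asg {1..m} {1..n} k" "A \<subseteq> Z" using opt_cost_eq_0(1)[of k] True r_def by auto
      have "m \<notin> fst ` A" using A(2) m by auto
      moreover have "sum X A = opt_cost {1..m} {1..n} X k"
        using zero_cost_iff[OF A(1)] A(2) opt_cost_eq_0(2)[of k] True r_def by simp
      ultimately have "m \<in> avoidable {1..m} {1..n} X k" using A(1) mM unfolding avoidable_def by blast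
      then show ?case by simp
    qed
    then have "prob {X\<in>space (RAP_measure m n Z). m \<notin> avoidable {1..m} {1..n} X k} = 0"
      using ev prob_eq_0 by blast
    then show ?thesis using True row_prob_eq_0[of "{1..n}" "{1..m}" k Z m] by (simp add: r_def)
  next
    case False
    have "prob {X\<in>space (RAP_measure m n Z). m \<notin> avoidable {1..m} {1..n} X k} = avoid_sum k m n Z k"
    proof -
      \<comment> \<open>At size \<open>k\<close> no unit of size is left: \<open>row_prob\<close> at
        the rank vanishes, so \<open>stage_prob\<close> is an indicator.\<close>
      have sp: "stage_prob k Z {1..n} m k D = of_bool (m \<notin> D)" if "D \<in> Pow {1..m}" for D
        using row_prob_eq_0[of "{1..n}" D "cover_number Z {1..n} D" Z m] that finite_subset[of D "{1..m}"]
        by (auto simp: stage_prob_def)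
      have "(\<Sum>i\<in>{()}. 1 * prob {X\<in>space (RAP_measure m n Z). m \<notin> avoidable {1..m} {1..n} X k}) = avoid_sum k m n Z k"
        unfolding avoid_sum_def
      proof (rule sum_prob_eq_AE)
        show "AE X in RAP_measure m n Z.
          (\<Sum>i\<in>{()}. 1 * indicator {X\<in>space (RAP_measure m n Z). m \<notin> avoidable {1..m} {1..n} X k} X) =
          (\<Sum>D\<in>Pow {1..m}. stage_prob k Z {1..n} m k D *
            indicator {X\<in>space (RAP_measure m n Z). avoidable {1..m} {1..n} X k = D} X)"
          using AE_space
        proof eventually_elim
          case (elim X)
          have "avoidable {1..m} {1..n} X k \<in> Pow {1..m}" by (auto simp: avoidable_def)
          then show ?case unfolding sum_indicator_avoidable[OF elim] using sp by (simp add: indicator_def elim del: Pow_iff)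
        qed
      qed (use ev Am in auto)
      then show ?thesis by simp
    qed
    also have "avoid_sum k m n Z (r + q) = avoid_sum k m n Z r" if "r + q \<le> k" for q
      using that
    proof (induction q)
      case (Suc q)
      then show ?case using avoid_sum_step[OF Z m, of "r + q" k] k by (simp add: r_def)
    qed simp
    from this[of "k - r"] False have "avoid_sum k m n Z k = avoid_sum k m n Z r" by simp
    also have "avoid_sum k m n Z r = row_prob Z {1..n} m k {1..m}"
    proof -
      have nc: "m \<in> noncoloops Z {1..n} {1..m}"
        using mM cover_number_loop[OF m, of "{1..n}" "{1..m}"] by (simp add: noncoloops_def)
      have st: "stage_prob k Z {1..n} m r (noncoloops Z {1..n} {1..m}) = row_prob Z {1..n} m k {1..m}"
        using row_prob_noncoloops[OF _ _ nc, of "k - r"] nc False by (simp add: stage_prob_def r_def)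
      have "avoid_sum k m n Z r = (\<Sum>i\<in>{()}. row_prob Z {1..n} m k {1..m} * prob (space (RAP_measure m n Z)))"
        unfolding avoid_sum_def
      proof (rule sum_prob_eq_AE)
        show "AE X in RAP_measure m n Z.
          (\<Sum>D\<in>Pow {1..m}. stage_prob k Z {1..n} m r D *
            indicator {X\<in>space (RAP_measure m n Z). avoidable {1..m} {1..n} X r = D} X) =
          (\<Sum>i\<in>{()}. row_prob Z {1..n} m k {1..m} * indicator (space (RAP_measure m n Z)) X)"
          using AE_generic_matrix[OF Z] AE_space
        proof eventually_elim
          case (elim X)
          interpret generic_matrix "{1..m}" "{1..n}" Z X by (rule elim(1))
          have "avoidable {1..m} {1..n} X r = noncoloops Z {1..n} {1..m}" unfolding r_def by (rule avoidable_cover_number)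
          then show ?case unfolding sum_indicator_avoidable[OF elim(2)] using st elim(2) by simp
        qed
      qed (use Am in auto)
      then show ?thesis by (simp add: prob_space)
    qed
    finally show ?thesis .
  qed
qed

text \<open>Generically all optimal assignments agree off \<open>Z\<close>, and row \<open>m\<close>
  has no zeros. So if row \<open>m\<close> cannot be avoided, all of them use the same position in
  it and exactly one event on the left occurs; otherwise none does.\<close>

lemma sum_prob_forced:
  assumes Z: "Z \<subseteq> positions m n" and m: "\<And>j. (m, j) \<notin> Z" and k: "0 < k" "k \<le> m" "k \<le> n"
  shows "(\<Sum>t\<in>{1..n}. measure (RAP_measure m n Z) {X\<in>space (RAP_measure m n Z). forced k m n (m,t) X}) =
    measure (RAP_measure m n Z) {X\<in>space (RAP_measure m n Z). m \<notin> avoidable {1..m} {1..n} X k}"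
proof -
  interpret prob_space "RAP_measure m n Z" by (rule prob_space_RAP)
  have mM: "m \<in> {1..m}" using k by auto
  have "(\<Sum>t\<in>{1..n}. 1 * prob {X\<in>space (RAP_measure m n Z). forced k m n (m,t) X}) =
    (\<Sum>i\<in>{()}. 1 * prob {X\<in>space (RAP_measure m n Z). m \<notin> avoidable {1..m} {1..n} X k})"
  proof (rule sum_prob_eq_AE)
    show "{X\<in>space (RAP_measure m n Z). m \<notin> avoidable {1..m} {1..n} X k} \<in> events"
      using pred_intros_logic(2)[OF measurable_mem_avoidable[of m m n k Z]] by (simp add: pred_def)
    show "{X\<in>space (RAP_measure m n Z). forced k m n (m,t) X} \<in> events" for t by measurable
    show "AE X in RAP_measure m n Z.
      (\<Sum>t\<in>{1..n}. 1 * indicator {X\<in>space (RAP_measure m n Z). forced k m n (m,t) X} X) =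
      (\<Sum>i\<in>{()}. 1 * (indicator {X\<in>space (RAP_measure m n Z). m \<notin> avoidable {1..m} {1..n} X k} X :: real))"
      using AE_generic_matrix[OF Z] AE_space
    proof eventually_elim
      case (elim X)
      interpret generic_matrix "{1..m}" "{1..n}" Z X by (rule elim(1))
      obtain A where A: "A \<in> asg {1..m} {1..n} k" "sum X A = opt_cost {1..m} {1..n} X k"
        using opt_cost_attained[of "{1..m}" "{1..n}" k X] k by auto
      show ?case
      proof (cases "m \<in> avoidable {1..m} {1..n} X k")
        case True
        then obtain B where B: "B \<in> asg {1..m} {1..n} k" "sum X B = opt_cost {1..m} {1..n} X k" "m \<notin> fst ` B"
          by (auto simp: avoidable_def)
        then have "\<not> forced k m n (m,t) X" for t by (force simp: forced_def)
        then show ?thesis using True by simp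
      next
        case False
        then have "m \<in> fst ` A" using A mM unfolding avoidable_def by blast
        then obtain t0 where t0: "(m,t0) \<in> A" by auto
        have "forced k m n (m,t) X \<longleftrightarrow> t = t0" for t
        proof
          assume "forced k m n (m,t) X"
          then have "(m,t) \<in> A" using A by (simp add: forced_def)
          then show "t = t0" using inj_onD[OF asgD(3)[OF A(1)] _ _ t0, of "(m,t)"] by simp
        next
          assume "t = t0"
          show "forced k m n (m,t) X"
            unfolding forced_def
          proof (intro ballI impI)
            fix B assume B: "B \<in> asg {1..m} {1..n} k" "sum X B = opt_cost {1..m} {1..n} X k"
            have "A - Z = B - Z" using generic[OF A(1) B(1)] A(2) B(2) by simp
            then show "(m,t) \<in> B" using t0 \<open>t = t0\<close> m by blast
          qed
        qed
        moreover have "t0 \<in> {1..n}" using asgD(1)[OF A(1)] t0 by auto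
        ultimately show ?thesis using False elim(2) by (simp add: indicator_def)
      qed
    qed
  qed auto
  then show ?thesis by simp
qed

theorem theorem5p1:
  fixes k m n :: nat and Z :: "(nat \<times> nat) set"
  assumes "standard_RAP k m n Z"
    and "\<forall>j\<in>{1..n}. (m, j) \<notin> Z"
    and "\<forall>t\<in>{1..n}. cover_formula_holds k m n (insert (m, t) Z)"
  shows "cover_formula_holds k m n Z"
proof -
  have k: "0 < k" "k \<le> m" "k \<le> n" and Z: "Z \<subseteq> positions m n" using assms(1) by (auto simp: standard_RAP_def)
  have m: "(m, j) \<notin> Z" for j using assms(2) Z by (auto simp: positions_def)
  define E where "E = expected_min_cost k m n"
  define p where "p t = measure (RAP_measure m n Z) {X\<in>space (RAP_measure m n Z). forced k m n (m,t) X}" for t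
  have formula: "cover_formula_holds k m n Y \<longleftrightarrow> E Y = 1 / (real m * real n) * cover_sum k m n Y" for Y
    by (simp add: cover_formula_holds_def cover_sum_def E_def)
  have "E Z = E (insert (m,t) Z) + p t" if "t \<in> {1..n}" for t
    unfolding E_def p_def using k m that
    by (intro expected_min_cost_insert_zero) (auto simp: positions_def)
  then have "(\<Sum>t\<in>{1..n}. E Z) = (\<Sum>t\<in>{1..n}. E (insert (m,t) Z) + p t)" by (rule sum.cong[OF refl])
  then have "real n * E Z = (\<Sum>t\<in>{1..n}. E (insert (m,t) Z)) + (\<Sum>t\<in>{1..n}. p t)" by (simp add: sum.distrib)
  also have "(\<Sum>t\<in>{1..n}. p t) = row_prob Z {1..n} m k {1..m}"
    unfolding p_def using sum_prob_forced[OF Z m k] prob_row_used[OF Z m k] by simp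
  also have "(\<Sum>t\<in>{1..n}. E (insert (m,t) Z)) = (\<Sum>t\<in>{1..n}. 1 / (real m * real n) * cover_sum k m n (insert (m,t) Z))"
    using assms(3) by (intro sum.cong refl) (simp add: formula)
  also have "\<dots> = 1 / (real m * real n) * (\<Sum>t\<in>{1..n}. cover_sum k m n (insert (m,t) Z))"
    by (rule sum_distrib_left[symmetric])
  \<comment> \<open>The cover sums satisfy the same linear relation up to the factor
    \<open>m * n\<close>, so the \<open>row_prob\<close> terms cancel.\<close>
  also have "(\<Sum>t\<in>{1..n}. cover_sum k m n (insert (m,t) Z)) =
      real n * cover_sum k m n Z - real m * real n * row_prob Z {1..n} m k {1..m}"
    using cover_sum_insert_zero[OF assms(1,2)] by linarith
  finally have "real n * E Z = real n * (1 / (real m * real n) * cover_sum k m n Z)"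
    using k by (simp add: field_simps)
  then have "E Z = 1 / (real m * real n) * cover_sum k m n Z"
    using k by (subst (asm) mult_left_cancel) auto
  then show ?thesis by (simp only: formula)
qed

end
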